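(* Consider an injective 2D PEPS and three adjacent rectangles $A,B,C$ with $B$ separating $A$ from $C$. If the boundary states $\rho_{\partial AB},\rho_{\partial B},\rho_{\partial BC},\rho_{\partial ABC}$ are $\epsilon$-approximately factorizable with respect to $ABC$ for some $\epsilon\le 1$, then $$\|P_{AB}P_{BC}-P_{ABC}\|\le 8\epsilon ,$$ where $P_X$ is the orthogonal projector onto $\operatorname{Im}V_X$ (tensored with the identity on the sites of $ABC$ outside $X$) and $\|\cdot\|$ is the operator norm.
   Context: PEPS. Let $(G,E)$ be an infinite graph isometrically embedded in $\mathbb{R}^2$ (e.g. the square lattice). Each vertex carries a physical space $\mathbb{C}^d$. Each edge $e$ carries a maximally entangled vector $|\omega_e\rangle=D^{-1/2}\sum_{j=1}^D|j,j\rangle\in\mathbb{C}^D\otimes\mathbb{C}^D$, one factor for each endpoint. Each vertex $v$ of degree $r$ carries a linear map $T_v:(\mathbb{C}^D)^{\otimes r}\to\mathbb{C}^d$ acting on the $r$ factors at $v$ of the incident edges. For a finite region $\Lambda\subset G$ let $\mathcal H_\Lambda=\bigotimes_{v\in\Lambda}\mathbb{C}^d$, let $E_\Lambda$ be the edges with both endpoints in $\Lambda$, let $\partial\Lambda$ be the edges joining $\Lambda$ to its complement, and let $\mathcal H_{\partial\Lambda}=\bigotimes_{e\in\partial\Lambda}\mathbb{C}^D$. Define the linear map $V_\Lambda:\mathcal H_{\partial\Lambda}\to\mathcal H_\Lambda$ by $V_\Lambda|X\rangle=\langle X|\bigotimes_{v\in\Lambda}T_v\bigotimes_{e\in E_\Lambda\cup\partial\Lambda}|\omega_e\rangle$,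 where $\langle X|$ contracts the factors of the edges of $\partial\Lambda$ at endpoints outside $\Lambda$ (bilinearly in the standard basis, so that $V_\Lambda$ is linear). The PEPS is injective if $V_\Lambda$ is injective for every finite $\Lambda$. The boundary state is $\rho_{\partial\Lambda}=V_\Lambda^\dagger V_\Lambda$. Geometry. $A,B,C$ are three adjacent rectangles side by side, of common height, with $B$ in the middle separating $A$ from $C$; $AB$ denotes $A\cup B$, etc. The width of $B$ is at least $3\ell$ for a reference length $\ell$. The edges joining $B$ to the complement of $ABC$ are split, going from the $A$ side to the $C$ side, into three parts $B_L$ (next to $A$), $z$ (middle), $B_R$ (next to $C$), each of length at least $\ell$. Put $a=(\partial A\cap\partial ABC)\cup B_L$, $d=(\partial A\cap\partial B)\cup B_L$, $b=(\partial C\cap\partial ABC)\cup B_R$, $c=(\partial B\cap\partial C)\cup B_R$. Then $\partial ABC=a\cup z\cup b$, $\partial AB=a\cup z\cup c$, $\partial BC=d\cup z\cup b$, $\partial B=d\cup z\cup c$; juxtaposition of letters denotes union. Approximate factorization. The boundary states are $\epsilon$-approximately factorizable with respect to $ABC$ if there are invertible operators $\Delta_{az},\Delta_{zb},\Omega_{dz},\Omega_{zc}$ (not necessarily Hermitian), supported on the regions given by their subscripts, such that with $$\sigma_{\partial ABC}=\Delta_{zb}\Delta_{az},\quad \sigma_{\partial B}=\Omega_{zc}\Omega_{dz},\quad \sigma_{\partial AB}=\Omega_{zc}\Delta_{az},\quad \sigma_{\partial BC}=\Delta_{zb}\Omega_{dz}$$ one has $\|\rho_{\partial R}^{1/2}\sigma_{\partial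 R}^{-1}\rho_{\partial R}^{1/2}-\mathbb 1\|\le\epsilon$ for $R\in\{ABC,AB,BC\}$ and $\|\rho_{\partial B}^{-1/2}\sigma_{\partial B}\rho_{\partial B}^{-1/2}-\mathbb 1\|\le\epsilon$. *)

theory Defs
  imports "HOL-Analysis.Analysis"
begin

section \<open>Operators on finite-dimensional Hilbert spaces\<close>

text \<open>
  A finite index set \<open>I\<close> stands for an orthonormal basis of the Hilbert space \<open>\<complex>\<^sup>I\<close>, whose vectors
  are the functions that are \<open>extensional\<close> on \<open>I\<close>. Operators are matrices \<open>'i \<Rightarrow> 'j \<Rightarrow> complex\<close>
  (row index first); only the entries over the relevant index sets matter. This is why inverse,
  square root and projector are introduced by Hilbert choice below: the required property
  determines them uniquely on \<open>I \<times> I\<close>, and leaves the other entries arbitrary.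
\<close>

definition mat_app :: "'i set \<Rightarrow> 'j set \<Rightarrow> ('i \<Rightarrow> 'j \<Rightarrow> complex) \<Rightarrow> ('j \<Rightarrow> complex) \<Rightarrow> 'i \<Rightarrow> complex"
  where "mat_app I J M x = (\<lambda>i\<in>I. \<Sum>j\<in>J. M i j * x j)"

definition mat_mul :: "'j set \<Rightarrow> ('i \<Rightarrow> 'j \<Rightarrow> complex) \<Rightarrow> ('j \<Rightarrow> 'k \<Rightarrow> complex) \<Rightarrow> 'i \<Rightarrow> 'k \<Rightarrow> complex"
  where "mat_mul J M N = (\<lambda>i k. \<Sum>j\<in>J. M i j * N j k)"

definition mat_id :: "'i \<Rightarrow> 'i \<Rightarrow> complex"
  where "mat_id = (\<lambda>i j. of_bool (i = j))"

definition mat_diff :: "('i \<Rightarrow> 'j \<Rightarrow> complex) \<Rightarrow> ('i \<Rightarrow> 'j \<Rightarrow> complex) \<Rightarrow> 'i \<Rightarrow> 'j \<Rightarrow> complex"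
  where "mat_diff M N = (\<lambda>i j. M i j - N i j)"

definition mat_adj :: "('i \<Rightarrow> 'j \<Rightarrow> complex) \<Rightarrow> 'j \<Rightarrow> 'i \<Rightarrow> complex"
  where "mat_adj M = (\<lambda>j i. cnj (M i j))"

definition mat_eq_on :: "'i set \<Rightarrow> ('i \<Rightarrow> 'i \<Rightarrow> complex) \<Rightarrow> ('i \<Rightarrow> 'i \<Rightarrow> complex) \<Rightarrow> bool"
  where "mat_eq_on I M N \<longleftrightarrow> (\<forall>i\<in>I. \<forall>j\<in>I. M i j = N i j)"

text \<open>Inner product, antilinear in the first argument, and Euclidean norm of \<open>\<complex>\<^sup>I\<close>.\<close>

definition vec_inner :: "'i set \<Rightarrow> ('i \<Rightarrow> complex) \<Rightarrow> ('i \<Rightarrow> complex) \<Rightarrow> complex"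
  where "vec_inner I x y = (\<Sum>i\<in>I. cnj (x i) * y i)"

definition vec_norm :: "'i set \<Rightarrow> ('i \<Rightarrow> complex) \<Rightarrow> real"
  where "vec_norm I x = L2_set (\<lambda>i. cmod (x i)) I"

definition op_norm :: "'i set \<Rightarrow> ('i \<Rightarrow> 'i \<Rightarrow> complex) \<Rightarrow> real"
  where "op_norm I M = (SUP x\<in>{x \<in> extensional I. vec_norm I x \<le> 1}. vec_norm I (mat_app I I M x))"

definition is_mat_inverse :: "'i set \<Rightarrow> ('i \<Rightarrow> 'i \<Rightarrow> complex) \<Rightarrow> ('i \<Rightarrow> 'i \<Rightarrow> complex) \<Rightarrow> bool"
  where "is_mat_inverse I M N \<longleftrightarrow>
    mat_eq_on I (mat_mul I M N) mat_id \<and> mat_eq_on I (mat_mul I N M) mat_id"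

definition invertible_op :: "'i set \<Rightarrow> ('i \<Rightarrow> 'i \<Rightarrow> complex) \<Rightarrow> bool"
  where "invertible_op I M \<longleftrightarrow> (\<exists>N. is_mat_inverse I M N)"

definition op_inv :: "'i set \<Rightarrow> ('i \<Rightarrow> 'i \<Rightarrow> complex) \<Rightarrow> 'i \<Rightarrow> 'i \<Rightarrow> complex"
  where "op_inv I M = (SOME N. is_mat_inverse I M N)"

definition positive_op :: "'i set \<Rightarrow> ('i \<Rightarrow> 'i \<Rightarrow> complex) \<Rightarrow> bool"
  where "positive_op I M \<longleftrightarrow> mat_eq_on I (mat_adj M) M \<and>
    (\<forall>x\<in>extensional I. 0 \<le> Re (vec_inner I x (mat_app I I M x)))"

definition op_sqrt :: "'i set \<Rightarrow> ('i \<Rightarrow> 'i \<Rightarrow> complex) \<Rightarrow> 'i \<Rightarrow> 'i \<Rightarrow> complex"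
  where "op_sqrt I M = (SOME S. positive_op I S \<and> mat_eq_on I (mat_mul I S S) M)"

definition orth_projector :: "'i set \<Rightarrow> ('i \<Rightarrow> complex) set \<Rightarrow> 'i \<Rightarrow> 'i \<Rightarrow> complex"
  where "orth_projector I W = (SOME P. \<forall>x\<in>extensional I. mat_app I I P x \<in> W \<and>
    (\<forall>w\<in>W. vec_inner I w (\<lambda>i. x i - mat_app I I P x i) = 0))"

text \<open>
  The tensor product \<open>\<Otimes>\<^bsub>s\<in>S\<^esub> \<complex>\<^sup>n\<close> has the product basis indexed by \<open>configs n S\<close>.
  For \<open>S \<subseteq> R\<close>, \<open>extend_op S R K\<close> is the operator \<open>K\<close> on the factors in \<open>S\<close>, tensored with
  the identity on the factors in \<open>R - S\<close>.
\<close>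

definition configs :: "nat \<Rightarrow> 's set \<Rightarrow> ('s \<Rightarrow> nat) set"
  where "configs n S = S \<rightarrow>\<^sub>E {..<n}"

definition extend_op :: "'s set \<Rightarrow> 's set \<Rightarrow> (('s \<Rightarrow> nat) \<Rightarrow> ('s \<Rightarrow> nat) \<Rightarrow> complex)
    \<Rightarrow> ('s \<Rightarrow> nat) \<Rightarrow> ('s \<Rightarrow> nat) \<Rightarrow> complex"
  where "extend_op S R K =
    (\<lambda>x y. K (restrict x S) (restrict y S) * of_bool (\<forall>s\<in>R - S. x s = y s))"


section \<open>PEPS\<close>

text \<open>
  Edges are two-element sets of vertices. \<open>tensor \<Gamma> v i k\<close> is the matrix element
  \<open>\<langle>i| T\<^sub>v |k\<rangle>\<close>, where \<open>k\<close> assigns a basis index to each edge incident to \<open>v\<close>.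
\<close>

record 'v peps =
  verts :: "'v set"
  edges :: "'v set set"
  pos :: "'v \<Rightarrow> real^2"
  bond_dim :: nat
  phys_dim :: nat
  tensor :: "'v \<Rightarrow> nat \<Rightarrow> ('v set \<Rightarrow> nat) \<Rightarrow> complex"

definition incident :: "'v peps \<Rightarrow> 'v \<Rightarrow> 'v set set"
  where "incident \<Gamma> v = {e \<in> edges \<Gamma>. v \<in> e}"

definition is_norm :: "(real^2 \<Rightarrow> real) \<Rightarrow> bool"
  where "is_norm N \<longleftrightarrow> (\<forall>p. N p = 0 \<longleftrightarrow> p = 0) \<and> (\<forall>p q. N (p + q) \<le> N p + N q) \<and>
    (\<forall>c p. N (c *\<^sub>R p) = \<bar>c\<bar> * N p)"

text \<open>
  The embedding is isometric in the sense that every edge is mapped to a segment of length 1.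
  The norm of the plane is left open: the graph metric of the square lattice, for instance,
  is the restriction of the \<open>l\<^sup>1\<close> metric and not of the Euclidean one. An embedding that preserves
  all graph distances for some norm is a special case.
\<close>

definition is_peps :: "'v peps \<Rightarrow> bool"
  where "is_peps \<Gamma> \<longleftrightarrow>
    infinite (verts \<Gamma>) \<and>
    (\<forall>e\<in>edges \<Gamma>. e \<subseteq> verts \<Gamma> \<and> card e = 2) \<and>
    (\<forall>v\<in>verts \<Gamma>. finite (incident \<Gamma> v)) \<and>
    inj_on (pos \<Gamma>) (verts \<Gamma>) \<and>
    (\<exists>N. is_norm N \<and> (\<forall>u v. {u, v} \<in> edges \<Gamma> \<longrightarrow> N (pos \<Gamma> u - pos \<Gamma> v) = 1)) \<and>
    bond_dim \<Gamma> \<ge> 1 \<and> phys_dim \<Gamma> \<ge> 1"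

definition inner_edges :: "'v peps \<Rightarrow> 'v set \<Rightarrow> 'v set set"
  where "inner_edges \<Gamma> \<Lambda> = {e \<in> edges \<Gamma>. e \<subseteq> \<Lambda>}"

definition bdry :: "'v peps \<Rightarrow> 'v set \<Rightarrow> 'v set set"
  where "bdry \<Gamma> \<Lambda> = {e \<in> edges \<Gamma>. e \<inter> \<Lambda> \<noteq> {} \<and> \<not> e \<subseteq> \<Lambda>}"

abbreviation phys_configs :: "'v peps \<Rightarrow> 'v set \<Rightarrow> ('v \<Rightarrow> nat) set"
  where "phys_configs \<Gamma> \<Lambda> \<equiv> configs (phys_dim \<Gamma>) \<Lambda>"

abbreviation bond_configs :: "'v peps \<Rightarrow> 'v set set \<Rightarrow> ('v set \<Rightarrow> nat) set"
  where "bond_configs \<Gamma> F \<equiv> configs (bond_dim \<Gamma>) F"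

text \<open>
  The vector \<open>|\<omega>\<^sub>e\<rangle> = D\<^sup>-\<^sup>1\<^sup>/\<^sup>2 \<Sum>\<^sub>j |j,j\<rangle>\<close>; the argument \<open>k\<close> assigns a basis index to each endpoint
  of \<open>e\<close>.
\<close>

definition max_entangled :: "nat \<Rightarrow> 'v set \<Rightarrow> ('v \<Rightarrow> nat) \<Rightarrow> complex"
  where "max_entangled D e k =
    1 / complex_of_real (sqrt (real D)) * (\<Sum>j<D. \<Prod>v\<in>e. of_bool (k v = j))"

definition half_edges :: "'v peps \<Rightarrow> 'v set \<Rightarrow> ('v \<times> 'v set) set"
  where "half_edges \<Gamma> \<Lambda> = {(v, e). e \<in> inner_edges \<Gamma> \<Lambda> \<union> bdry \<Gamma> \<Lambda> \<and> v \<in> e}"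

text \<open>
  The matrix element \<open>\<langle>s| V\<^sub>\<Lambda> |x\<rangle>\<close>. There is one factor \<open>\<complex>\<^sup>D\<close> for each half-edge, and the sum over
  \<open>h\<close> contracts them all: those at vertices of \<open>\<Lambda>\<close> with the tensors, those at outer
  endpoints with the boundary vector.
\<close>

definition peps_map :: "'v peps \<Rightarrow> 'v set \<Rightarrow> ('v \<Rightarrow> nat) \<Rightarrow> ('v set \<Rightarrow> nat) \<Rightarrow> complex"
  where "peps_map \<Gamma> \<Lambda> s x =
    (\<Sum>h\<in>configs (bond_dim \<Gamma>) (half_edges \<Gamma> \<Lambda>).
      (\<Prod>e\<in>bdry \<Gamma> \<Lambda>. \<Prod>v\<in>e - \<Lambda>. of_bool (x e = h (v, e))) *
      (\<Prod>v\<in>\<Lambda>. tensor \<Gamma> v (s v) (\<lambda>e\<in>incident \<Gamma> v. h (v, e))) *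
      (\<Prod>e\<in>inner_edges \<Gamma> \<Lambda> \<union> bdry \<Gamma> \<Lambda>. max_entangled (bond_dim \<Gamma>) e (\<lambda>v\<in>e. h (v, e))))"

abbreviation peps_op :: "'v peps \<Rightarrow> 'v set \<Rightarrow> (('v set \<Rightarrow> nat) \<Rightarrow> complex) \<Rightarrow> ('v \<Rightarrow> nat) \<Rightarrow> complex"
  where "peps_op \<Gamma> \<Lambda> \<equiv>
    mat_app (phys_configs \<Gamma> \<Lambda>) (bond_configs \<Gamma> (bdry \<Gamma> \<Lambda>)) (peps_map \<Gamma> \<Lambda>)"

definition injective_peps :: "'v peps \<Rightarrow> bool"
  where "injective_peps \<Gamma> \<longleftrightarrow> (\<forall>\<Lambda>. finite \<Lambda> \<and> \<Lambda> \<subseteq> verts \<Gamma> \<longrightarrow>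
    inj_on (peps_op \<Gamma> \<Lambda>) (extensional (bond_configs \<Gamma> (bdry \<Gamma> \<Lambda>))))"

definition bdry_state :: "'v peps \<Rightarrow> 'v set \<Rightarrow> ('v set \<Rightarrow> nat) \<Rightarrow> ('v set \<Rightarrow> nat) \<Rightarrow> complex"
  where "bdry_state \<Gamma> \<Lambda> =
    mat_mul (phys_configs \<Gamma> \<Lambda>) (mat_adj (peps_map \<Gamma> \<Lambda>)) (peps_map \<Gamma> \<Lambda>)"

text \<open>
  The projector onto the image of \<open>V\<^sub>X\<close>, tensored with the identity on \<open>R - X\<close>.
\<close>

definition ground_projector ::
    "'v peps \<Rightarrow> 'v set \<Rightarrow> 'v set \<Rightarrow> ('v \<Rightarrow> nat) \<Rightarrow> ('v \<Rightarrow> nat) \<Rightarrow> complex"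
  where "ground_projector \<Gamma> R X = extend_op X R
    (orth_projector (phys_configs \<Gamma> X)
      (peps_op \<Gamma> X ` extensional (bond_configs \<Gamma> (bdry \<Gamma> X))))"


section \<open>Three adjacent rectangles\<close>

text \<open>
  The rectangles are half-open in the horizontal direction, so that a vertex on a common side
  belongs to exactly one of them.
\<close>

definition rectangle :: "'v peps \<Rightarrow> real \<Rightarrow> real \<Rightarrow> real \<Rightarrow> real \<Rightarrow> 'v set"
  where "rectangle \<Gamma> x0 x1 y0 y1 =
    {v \<in> verts \<Gamma>. x0 \<le> pos \<Gamma> v $ 1 \<and> pos \<Gamma> v $ 1 < x1 \<and> y0 \<le> pos \<Gamma> v $ 2 \<and> pos \<Gamma> v $ 2 \<le> y1}"

text \<open>
  The vertical lines at abscissae \<open>s\<close> and \<open>t\<close> cut \<open>B\<close> into three pieces of width at least \<open>len\<close>,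
  and accordingly the edges from \<open>B\<close> to the outside of \<open>A \<union> B \<union> C\<close> are split by the
  position of their endpoint in \<open>B\<close>; edges attached exactly on a cut may go to either side.
\<close>

definition three_rectangles ::
    "'v peps \<Rightarrow> real \<Rightarrow> 'v set \<Rightarrow> 'v set \<Rightarrow> 'v set \<Rightarrow> 'v set set \<Rightarrow> 'v set set \<Rightarrow> 'v set set \<Rightarrow> bool"
  where "three_rectangles \<Gamma> len A B C B\<^sub>L z B\<^sub>R \<longleftrightarrow>
    finite (A \<union> B \<union> C) \<and>
    (\<forall>u\<in>A. \<forall>w\<in>C. {u, w} \<notin> edges \<Gamma>) \<and>
    B\<^sub>L \<union> z \<union> B\<^sub>R = bdry \<Gamma> B \<inter> bdry \<Gamma> (A \<union> B \<union> C) \<and>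
    B\<^sub>L \<inter> z = {} \<and> z \<inter> B\<^sub>R = {} \<and> B\<^sub>L \<inter> B\<^sub>R = {} \<and>
    (\<exists>x0 x1 x2 x3 y0 y1 s t.
      x0 < x1 \<and> x1 < x2 \<and> x2 < x3 \<and> y0 < y1 \<and>
      A = rectangle \<Gamma> x0 x1 y0 y1 \<and>
      B = rectangle \<Gamma> x1 x2 y0 y1 \<and>
      C = rectangle \<Gamma> x2 x3 y0 y1 \<and>
      0 < len \<and> 3 * len \<le> x2 - x1 \<and>
      len \<le> s - x1 \<and> len \<le> t - s \<and> len \<le> x2 - t \<and>
      (\<forall>e\<in>B\<^sub>L. \<forall>v\<in>e \<inter> B. pos \<Gamma> v $ 1 \<le> s) \<and>
      (\<forall>e\<in>z. \<forall>v\<in>e \<inter> B. s \<le> pos \<Gamma> v $ 1 \<and> pos \<Gamma> v $ 1 \<le> t) \<and>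
      (\<forall>e\<in>B\<^sub>R. \<forall>v\<in>e \<inter> B. t \<le> pos \<Gamma> v $ 1))"

text \<open>
  \<open>\<parallel>\<rho>\<^sup>1\<^sup>/\<^sup>2 \<sigma>\<^sup>-\<^sup>1 \<rho>\<^sup>1\<^sup>/\<^sup>2 - 1\<parallel> \<le> \<epsilon>\<close> and \<open>\<parallel>\<rho>\<^sup>-\<^sup>1\<^sup>/\<^sup>2 \<sigma> \<rho>\<^sup>-\<^sup>1\<^sup>/\<^sup>2 - 1\<parallel> \<le> \<epsilon>\<close>, respectively,
  for operators on \<open>\<complex>\<^sup>I\<close>.
\<close>

definition inverse_approx ::
    "'i set \<Rightarrow> real \<Rightarrow> ('i \<Rightarrow> 'i \<Rightarrow> complex) \<Rightarrow> ('i \<Rightarrow> 'i \<Rightarrow> complex) \<Rightarrow> bool"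
  where "inverse_approx I \<epsilon> \<rho> \<sigma> \<longleftrightarrow>
    op_norm I (mat_diff
      (mat_mul I (mat_mul I (op_sqrt I \<rho>) (op_inv I \<sigma>)) (op_sqrt I \<rho>)) mat_id) \<le> \<epsilon>"

definition direct_approx ::
    "'i set \<Rightarrow> real \<Rightarrow> ('i \<Rightarrow> 'i \<Rightarrow> complex) \<Rightarrow> ('i \<Rightarrow> 'i \<Rightarrow> complex) \<Rightarrow> bool"
  where "direct_approx I \<epsilon> \<rho> \<sigma> \<longleftrightarrow>
    op_norm I (mat_diff
      (mat_mul I (mat_mul I (op_inv I (op_sqrt I \<rho>)) \<sigma>) (op_inv I (op_sqrt I \<rho>))) mat_id) \<le> \<epsilon>"

definition approx_factorizable ::
    "'v peps \<Rightarrow> real \<Rightarrow> 'v set \<Rightarrow> 'v set \<Rightarrow> 'v set \<Rightarrow> 'v set set \<Rightarrow> 'v set set \<Rightarrow> 'v set set \<Rightarrow> bool"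
  where "approx_factorizable \<Gamma> \<epsilon> A B C B\<^sub>L z B\<^sub>R \<longleftrightarrow>
    (let a = (bdry \<Gamma> A \<inter> bdry \<Gamma> (A \<union> B \<union> C)) \<union> B\<^sub>L;
         d = (bdry \<Gamma> A \<inter> bdry \<Gamma> B) \<union> B\<^sub>L;
         b = (bdry \<Gamma> C \<inter> bdry \<Gamma> (A \<union> B \<union> C)) \<union> B\<^sub>R;
         c = (bdry \<Gamma> B \<inter> bdry \<Gamma> C) \<union> B\<^sub>R;
         approx = (\<lambda>P \<Lambda> S K S' K'.
           let bd = bdry \<Gamma> \<Lambda>; I = bond_configs \<Gamma> bd
           in P I \<epsilon> (bdry_state \<Gamma> \<Lambda>) (mat_mul I (extend_op S bd K) (extend_op S' bd K')))
     in \<exists>\<Delta>az \<Delta>zb \<Omega>dz \<Omega>zc.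
       invertible_op (bond_configs \<Gamma> (a \<union> z)) \<Delta>az \<and>
       invertible_op (bond_configs \<Gamma> (z \<union> b)) \<Delta>zb \<and>
       invertible_op (bond_configs \<Gamma> (d \<union> z)) \<Omega>dz \<and>
       invertible_op (bond_configs \<Gamma> (z \<union> c)) \<Omega>zc \<and>
       approx inverse_approx (A \<union> B \<union> C) (z \<union> b) \<Delta>zb (a \<union> z) \<Delta>az \<and>
       approx inverse_approx (A \<union> B) (z \<union> c) \<Omega>zc (a \<union> z) \<Delta>az \<and>
       approx inverse_approx (B \<union> C) (z \<union> b) \<Delta>zb (d \<union> z) \<Omega>dz \<and>
       approx direct_approx B (z \<union> c) \<Omega>zc (d \<union> z) \<Omega>dz)"

end

theory Submission
  imports Defs
begin

text \<open>
  Write \<open>Q\<^sub>X = V\<^sub>X \<sigma>\<^sub>X\<^sup>-\<^sup>1 V\<^sub>X\<^sup>\<dagger>\<close>. Since \<open>V\<^sub>X \<rho>\<^sub>X\<^sup>-\<^sup>1\<^sup>/\<^sup>2\<close> is an isometry onto the image of \<open>V\<^sub>X\<close>, the hypotheses say that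
  \<open>Q\<^sub>X\<close> is \<open>\<epsilon>\<close>-close to \<open>P\<^sub>X\<close> for \<open>X = AB, BC, ABC\<close>, and that \<open>G = L\<^sup>\<dagger> \<sigma>\<^sub>B L\<close>, with the left inverse
  \<open>L = \<rho>\<^sub>B\<^sup>-\<^sup>1 V\<^sub>B\<^sup>\<dagger>\<close> of \<open>V\<^sub>B\<close>, is \<open>\<epsilon>\<close>-close to \<open>P\<^sub>B\<close>. Contracting the tensors of \<open>A\<close> and \<open>C\<close> gives maps with
  \<open>V\<^sub>A\<^sub>B = V\<^sub>B A'\<close>, \<open>V\<^sub>B\<^sub>C = V\<^sub>B C'\<close> and \<open>V\<^sub>A\<^sub>B\<^sub>C = V\<^sub>A\<^sub>B C' = V\<^sub>B\<^sub>C A'\<close>. Operators on disjoint sets of tensor factors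
  commute, so in \<open>Q\<^sub>A\<^sub>B G Q\<^sub>B\<^sub>C\<close> the factors \<open>\<Omega>\<close> cancel and \<open>Q\<^sub>A\<^sub>B G Q\<^sub>B\<^sub>C = Q\<^sub>A\<^sub>B\<^sub>C\<close>, while \<open>P\<^sub>B Q\<^sub>B\<^sub>C = Q\<^sub>B\<^sub>C\<close>. Hence
  \<open>P\<^sub>A\<^sub>B P\<^sub>B\<^sub>C - P\<^sub>A\<^sub>B\<^sub>C = (Q\<^sub>A\<^sub>B\<^sub>C - P\<^sub>A\<^sub>B\<^sub>C) - Q\<^sub>A\<^sub>B (G - P\<^sub>B) Q\<^sub>B\<^sub>C - (Q\<^sub>A\<^sub>B - P\<^sub>A\<^sub>B) Q\<^sub>B\<^sub>C - P\<^sub>A\<^sub>B (Q\<^sub>B\<^sub>C - P\<^sub>B\<^sub>C)\<close>,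
  whose norm is at most \<open>\<epsilon> + 4\<epsilon> + 2\<epsilon> + \<epsilon>\<close>.
\<close>

section \<open>Matrices over finite index sets\<close>

text \<open>The cancellation rests on \<open>L V\<^sub>B = 1\<close>. It turns the junction
  \<open>V\<^sub>A\<^sub>B\<^sup>\<dagger> L\<^sup>\<dagger>\<close> between
  \<open>Q\<^sub>A\<^sub>B\<close> and \<open>G\<close> into the adjoint of \<open>A'\<close>, and
  the junction \<open>L V\<^sub>B\<^sub>C\<close> between \<open>G\<close> and
  \<open>Q\<^sub>B\<^sub>C\<close> into \<open>C'\<close>. The former involves only sites and edges
  at \<open>A\<close>, the latter only those at \<open>C\<close>; so \<open>\<Omega>zc\<close>
  passes the former to the left, \<open>\<Omega>dz\<close> passes the latter to the right, and each
  meets its inverse. Two obstacles shape the formalization. These maps change the set of tensor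
  factors, and one kernel occurs beside different spectators, for instance on the boundary of
  \<open>B\<close> and on that of \<open>AB\<close>. Hence physical and bond factors become sites of
  one index type, and every operator is a kernel between sets of sites, tensored with an identity.
  Moreover, root, inverse and projector are defined by choice, so nothing is known about them before
  existence is proved. The root of \<open>\<rho>\<close> comes from a contraction rather than from
  diagonalization, and its invertibility from a Neumann inverse.\<close>

lemma mat_mul_assoc: "mat_mul J (mat_mul K M N) L = mat_mul K M (mat_mul J N L)"
  unfolding mat_mul_def sum_distrib_left sum_distrib_right mult.assoc
  by (intro ext) (rule sum.swap)

lemma mat_adj_mul: "mat_adj (mat_mul J M N) = mat_mul J (mat_adj N) (mat_adj M)"
  by (simp add: mat_mul_def mat_adj_def mult.commute)

lemma mat_adj_adj [simp]: "mat_adj (mat_adj M) = M"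
  by (simp add: mat_adj_def)

lemma mat_mul_diff_left: "mat_mul J (mat_diff M N) K = mat_diff (mat_mul J M K) (mat_mul J N K)"
  by (simp add: mat_mul_def mat_diff_def algebra_simps sum_subtractf)

lemma mat_mul_diff_right: "mat_mul J K (mat_diff M N) = mat_diff (mat_mul J K M) (mat_mul J K N)"
  by (simp add: mat_mul_def mat_diff_def algebra_simps sum_subtractf)

section \<open>Matrices vanishing outside given index sets\<close>

definition supp_on :: "'i set \<Rightarrow> 'j set \<Rightarrow> ('i \<Rightarrow> 'j \<Rightarrow> complex) \<Rightarrow> bool"
  where "supp_on I J M \<longleftrightarrow> (\<forall>i j. M i j \<noteq> 0 \<longrightarrow> i \<in> I \<and> j \<in> J)"

text \<open>Entries outside the relevant index sets are arbitrary, in particular for objects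
  obtained by choice. Setting them to zero turns agreement on the index sets into equality of
  functions, so that operator identities can be used for rewriting.\<close>

definition clip :: "'i set \<Rightarrow> 'j set \<Rightarrow> ('i \<Rightarrow> 'j \<Rightarrow> complex) \<Rightarrow> 'i \<Rightarrow> 'j \<Rightarrow> complex"
  where "clip I J M = (\<lambda>i j. if i \<in> I \<and> j \<in> J then M i j else 0)"

definition id_on :: "'i set \<Rightarrow> 'i \<Rightarrow> 'i \<Rightarrow> complex"
  where "id_on I = clip I I mat_id"

lemma supp_on_clip [simp]: "supp_on I J (clip I J M)"
  by (auto simp: supp_on_def clip_def)

lemma supp_on_id_on [simp]: "supp_on I I (id_on I)"
  by (simp add: id_on_def)

lemma clip_supp_on: "supp_on I J M \<Longrightarrow> clip I J M = M"
  by (auto simp: supp_on_def clip_def fun_eq_iff)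

lemma supp_on_adj: "supp_on I J M \<Longrightarrow> supp_on J I (mat_adj M)"
  by (auto simp: supp_on_def mat_adj_def)

lemma supp_on_mul:
  assumes "supp_on I J M" "supp_on K L N"
  shows "supp_on I L (mat_mul X M N)"
  unfolding supp_on_def
proof (intro allI impI)
  fix i j assume "mat_mul X M N i j \<noteq> 0"
  then obtain k where "M i k * N k j \<noteq> 0"
    unfolding mat_mul_def by (rule sum.not_neutral_contains_not_neutral)
  then show "i \<in> I \<and> j \<in> L"
    using assms by (auto simp: supp_on_def)
qed

lemma supp_on_diff:
  assumes "supp_on I J M" "supp_on I J N"
  shows "supp_on I J (mat_diff M N)"
  unfolding supp_on_def
proof (intro allI impI)
  fix i j assume "mat_diff M N i j \<noteq> 0"
  then have "M i j \<noteq> 0 \<or> N i j \<noteq> 0"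
    by (auto simp: mat_diff_def)
  then show "i \<in> I \<and> j \<in> J"
    using assms by (auto simp: supp_on_def)
qed

lemma supp_on_eqI:
  assumes "supp_on I J M" "supp_on I J N" "\<And>i j. i \<in> I \<Longrightarrow> j \<in> J \<Longrightarrow> M i j = N i j"
  shows "M = N"
proof (intro ext)
  fix i j
  show "M i j = N i j"
  proof (cases "i \<in> I \<and> j \<in> J")
    case False
    then have "M i j = 0" "N i j = 0"
      using assms(1,2) unfolding supp_on_def by blast+
    then show ?thesis by simp
  qed (use assms(3) in simp)
qed

lemma mat_mul_id_left:
  assumes "finite I" "supp_on I J M"
  shows "mat_mul I (id_on I) M = M"
proof (intro ext)
  fix i j
  have "mat_mul I (id_on I) M i j = (\<Sum>k\<in>I. if k = i then M k j else 0)"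
    unfolding mat_mul_def id_on_def clip_def mat_id_def by (rule sum.cong) auto
  also have "\<dots> = M i j"
    using assms by (auto simp: supp_on_def)
  finally show "mat_mul I (id_on I) M i j = M i j" .
qed

lemma mat_mul_id_right:
  assumes "finite J" "supp_on I J M"
  shows "mat_mul J M (id_on J) = M"
proof (intro ext)
  fix i j
  have "mat_mul J M (id_on J) i j = (\<Sum>k\<in>J. if k = j then M i k else 0)"
    unfolding mat_mul_def id_on_def clip_def mat_id_def by (rule sum.cong) auto
  also have "\<dots> = M i j"
    using assms by (auto simp: supp_on_def)
  finally show "mat_mul J M (id_on J) i j = M i j" .
qed

lemma mat_adj_id_on [simp]: "mat_adj (id_on I) = id_on I"
  by (auto simp: mat_adj_def id_on_def clip_def mat_id_def fun_eq_iff)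

lemma mat_adj_clip: "mat_adj (clip I J M) = clip J I (mat_adj M)"
  by (auto simp: mat_adj_def clip_def fun_eq_iff)

lemma mat_mul_clip: "mat_mul J (clip I J M) (clip J K N) = clip I K (mat_mul J M N)"
  by (auto simp: mat_mul_def clip_def fun_eq_iff intro!: sum.neutral)

lemma mat_eq_on_iff_clip: "mat_eq_on I M N \<longleftrightarrow> clip I I M = clip I I N"
  by (auto simp: mat_eq_on_def clip_def fun_eq_iff)

section \<open>Norm bounds\<close>

lemma vec_norm_nonneg [simp]: "0 \<le> vec_norm I x"
  by (simp add: vec_norm_def)

lemma vec_norm_cong: "(\<And>i. i \<in> I \<Longrightarrow> x i = y i) \<Longrightarrow> vec_norm I x = vec_norm I y"
  by (auto simp: vec_norm_def intro: L2_set_cong)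

lemma vec_norm_power2: "(vec_norm I x)\<^sup>2 = (\<Sum>i\<in>I. (cmod (x i))\<^sup>2)"
  by (simp add: vec_norm_def L2_set_def sum_nonneg)

lemma vec_norm_zero: "(\<And>i. i \<in> I \<Longrightarrow> x i = 0) \<Longrightarrow> vec_norm I x = 0"
  by (auto simp: vec_norm_def intro: L2_set_0')

lemma vec_norm_eq_0_iff: "finite I \<Longrightarrow> vec_norm I x = 0 \<longleftrightarrow> (\<forall>i\<in>I. x i = 0)"
  by (simp add: vec_norm_def L2_set_eq_0_iff)

lemma vec_norm_add: "vec_norm I (\<lambda>i. x i + y i) \<le> vec_norm I x + vec_norm I y"
proof -
  have "vec_norm I (\<lambda>i. x i + y i) \<le> L2_set (\<lambda>i. cmod (x i) + cmod (y i)) I"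
    unfolding vec_norm_def by (rule L2_set_mono) (auto intro: norm_triangle_ineq)
  also have "\<dots> \<le> vec_norm I x + vec_norm I y"
    unfolding vec_norm_def by (rule L2_set_triangle_ineq)
  finally show ?thesis .
qed

lemma vec_norm_scale: "vec_norm I (\<lambda>i. c * x i) = cmod c * vec_norm I x"
  by (simp add: vec_norm_def norm_mult L2_set_right_distrib)

lemma vec_norm_diff: "vec_norm I (\<lambda>i. x i - y i) \<le> vec_norm I x + vec_norm I y"
  using vec_norm_add[of I x "\<lambda>i. (-1) * y i"] vec_norm_scale[of I "-1" y] by simp

lemma vec_inner_self: "vec_inner I x x = of_real ((vec_norm I x)\<^sup>2)"
  by (simp add: vec_norm_power2 vec_inner_def complex_norm_square[symmetric] mult.commute
      flip: of_real_power)

lemma vec_inner_Cauchy_Schwarz: "cmod (vec_inner I x y) \<le> vec_norm I x * vec_norm I y"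
proof -
  have "cmod (vec_inner I x y) \<le> (\<Sum>i\<in>I. \<bar>cmod (x i)\<bar> * \<bar>cmod (y i)\<bar>)"
    unfolding vec_inner_def by (rule order_trans[OF norm_sum]) (simp add: norm_mult)
  also have "\<dots> \<le> vec_norm I x * vec_norm I y"
    unfolding vec_norm_def by (rule L2_set_mult_ineq)
  finally show ?thesis .
qed

lemma vec_inner_cnj: "cnj (vec_inner I x y) = vec_inner I y x"
  by (simp add: vec_inner_def mult.commute)

lemma vec_inner_adj: "vec_inner J (mat_app J I (mat_adj M) y) x = vec_inner I y (mat_app I J M x)"
proof -
  have "vec_inner J (mat_app J I (mat_adj M) y) x = (\<Sum>j\<in>J. \<Sum>i\<in>I. cnj (y i) * (M i j * x j))"
    by (simp add: vec_inner_def mat_app_def mat_adj_def sum_distrib_right sum_distrib_left mult_ac)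
  also have "\<dots> = (\<Sum>i\<in>I. \<Sum>j\<in>J. cnj (y i) * (M i j * x j))"
    by (rule sum.swap)
  also have "\<dots> = vec_inner I y (mat_app I J M x)"
    by (simp add: vec_inner_def mat_app_def sum_distrib_left)
  finally show ?thesis .
qed

lemma mat_app_mul: "mat_app I J (mat_mul K M N) x = mat_app I K M (mat_app K J N x)"
proof -
  have "(\<Sum>j\<in>J. mat_mul K M N i j * x j) = (\<Sum>k\<in>K. M i k * mat_app K J N x k)" for i
  proof -
    have "(\<Sum>j\<in>J. mat_mul K M N i j * x j) = (\<Sum>j\<in>J. \<Sum>k\<in>K. M i k * (N k j * x j))"
      by (simp add: mat_mul_def sum_distrib_right mult.assoc)
    also have "\<dots> = (\<Sum>k\<in>K. \<Sum>j\<in>J. M i k * (N k j * x j))"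
      by (rule sum.swap)
    finally show ?thesis by (simp add: mat_app_def sum_distrib_left)
  qed
  then show ?thesis by (simp add: mat_app_def)
qed

lemma mat_app_diff: "i \<in> I \<Longrightarrow> mat_app I J (mat_diff M N) x i = mat_app I J M x i - mat_app I J N x i"
  by (simp add: mat_app_def mat_diff_def algebra_simps sum_subtractf)

lemma mat_app_id_on:
  assumes "finite I" "i \<in> I"
  shows "mat_app I I (id_on I) x i = x i"
proof -
  have "mat_app I I (id_on I) x i = (\<Sum>k\<in>I. if k = i then x k else 0)"
    using assms(2) unfolding mat_app_def id_on_def clip_def mat_id_def
    by simp (rule sum.cong, auto)
  also have "\<dots> = x i"
    using assms by simp
  finally show ?thesis .
qed

lemma mat_app_cong:
  "(\<And>i j. i \<in> I \<Longrightarrow> j \<in> J \<Longrightarrow> M i j = N i j) \<Longrightarrow> (\<And>j. j \<in> J \<Longrightarrow> x j = y j)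
    \<Longrightarrow> mat_app I J M x = mat_app I J N y"
  by (auto simp: mat_app_def intro!: restrict_ext sum.cong)

lemma mat_app_clip [simp]: "mat_app I J (clip I J M) x = mat_app I J M x"
  by (rule mat_app_cong) (auto simp: clip_def)

text \<open>Unlike \<open>op_norm\<close>, this applies to rectangular matrices and speaks about all
  functions, extensional or not; \<open>op_bound_iff_op_norm\<close> connects the two in the square
  case.\<close>

definition op_bound :: "'i set \<Rightarrow> 'j set \<Rightarrow> ('i \<Rightarrow> 'j \<Rightarrow> complex) \<Rightarrow> real \<Rightarrow> bool"
  where "op_bound I J M c \<longleftrightarrow> (\<forall>x. vec_norm I (mat_app I J M x) \<le> c * vec_norm J x)"

lemma op_boundD: "op_bound I J M c \<Longrightarrow> vec_norm I (mat_app I J M x) \<le> c * vec_norm J x"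
  by (simp add: op_bound_def)

lemma op_bound_mono: "op_bound I J M c \<Longrightarrow> c \<le> d \<Longrightarrow> op_bound I J M d"
  unfolding op_bound_def by (meson mult_right_mono order_trans vec_norm_nonneg)

lemma op_bound_mul:
  assumes "op_bound I K M c" "op_bound K J N d" "0 \<le> c"
  shows "op_bound I J (mat_mul K M N) (c * d)"
  unfolding op_bound_def
proof
  fix x
  have "vec_norm I (mat_app I J (mat_mul K M N) x) \<le> c * vec_norm K (mat_app K J N x)"
    using assms(1) by (simp add: mat_app_mul op_bound_def)
  also have "\<dots> \<le> c * (d * vec_norm J x)"
    using assms by (intro mult_left_mono) (auto simp: op_bound_def)
  finally show "vec_norm I (mat_app I J (mat_mul K M N) x) \<le> c * d * vec_norm J x"
    by (simp add: mult.assoc)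
qed

lemma op_bound_diff:
  assumes "op_bound I J M c" "op_bound I J N d"
  shows "op_bound I J (mat_diff M N) (c + d)"
  unfolding op_bound_def
proof
  fix x
  have "vec_norm I (mat_app I J (mat_diff M N) x)
      = vec_norm I (\<lambda>i. mat_app I J M x i - mat_app I J N x i)"
    by (rule vec_norm_cong) (rule mat_app_diff)
  also have "\<dots> \<le> vec_norm I (mat_app I J M x) + vec_norm I (mat_app I J N x)"
    by (rule vec_norm_diff)
  also have "\<dots> \<le> (c + d) * vec_norm J x"
    using op_boundD[OF assms(1), of x] op_boundD[OF assms(2), of x] by (simp add: algebra_simps)
  finally show "vec_norm I (mat_app I J (mat_diff M N) x) \<le> (c + d) * vec_norm J x" .
qed

text \<open>\<open>\<parallel>M\<^sup>\<dagger>y\<parallel>\<^sup>2 = \<langle>y, M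
  M\<^sup>\<dagger>y\<rangle> \<le> c \<parallel>y\<parallel>
  \<parallel>M\<^sup>\<dagger>y\<parallel>\<close>, and one factor cancels.\<close>

lemma op_bound_adj:
  assumes "op_bound I J M c" "0 \<le> c"
  shows "op_bound J I (mat_adj M) c"
  unfolding op_bound_def
proof
  fix y
  let ?z = "mat_app J I (mat_adj M) y"
  have "(vec_norm J ?z)\<^sup>2 = cmod (vec_inner J ?z ?z)"
    by (simp add: vec_inner_self norm_of_real del: of_real_power)
  also have "\<dots> = cmod (vec_inner I y (mat_app I J M ?z))"
    by (simp add: vec_inner_adj)
  also have "\<dots> \<le> vec_norm I y * vec_norm I (mat_app I J M ?z)"
    by (rule vec_inner_Cauchy_Schwarz)
  also have "\<dots> \<le> vec_norm I y * (c * vec_norm J ?z)"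
    by (intro mult_left_mono op_boundD assms) simp
  finally have "vec_norm J ?z * vec_norm J ?z \<le> (c * vec_norm I y) * vec_norm J ?z"
    by (simp add: power2_eq_square mult_ac)
  then show "vec_norm J ?z \<le> c * vec_norm I y"
    using assms(2) by (cases "vec_norm J ?z = 0") (auto simp: mult_le_cancel_right order.not_eq_order_implies_strict)
qed

lemma op_bound_isometry:
  assumes "finite J" "mat_mul I (mat_adj W) W = id_on J"
  shows "op_bound I J W 1"
  unfolding op_bound_def
proof
  fix x
  have "complex_of_real ((vec_norm I (mat_app I J W x))\<^sup>2) = vec_inner J x (mat_app J J (id_on J) x)"
    unfolding vec_inner_self[symmetric] assms(2)[symmetric] mat_app_mul
    by (metis vec_inner_adj mat_adj_adj)
  also have "\<dots> = vec_inner J x x"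
    unfolding vec_inner_def by (intro sum.cong refl) (simp add: mat_app_id_on assms(1))
  also have "\<dots> = complex_of_real ((vec_norm J x)\<^sup>2)"
    by (rule vec_inner_self)
  finally show "vec_norm I (mat_app I J W x) \<le> 1 * vec_norm J x"
    by (simp only: of_real_eq_iff) (simp add: power2_eq_iff_nonneg)
qed

text \<open>A crude bound by the sum of all entries; among other things it shows that the supremum
  in \<open>op_norm\<close> is taken over a bounded set.\<close>

lemma op_bound_exists:
  assumes "finite I" "finite J"
  obtains c where "0 \<le> c" "op_bound I J M c"
proof
  let ?c = "\<Sum>i\<in>I. \<Sum>j\<in>J. cmod (M i j)"
  show "0 \<le> ?c" by (simp add: sum_nonneg)
  show "op_bound I J M ?c"
    unfolding op_bound_def
  proof
    fix x
    have "vec_norm I (mat_app I J M x) \<le> (\<Sum>i\<in>I. cmod (mat_app I J M x i))"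
      unfolding vec_norm_def by (rule L2_set_le_sum) simp
    also have "\<dots> \<le> (\<Sum>i\<in>I. \<Sum>j\<in>J. cmod (M i j) * vec_norm J x)"
    proof (rule sum_mono)
      fix i assume "i \<in> I"
      then have "cmod (mat_app I J M x i) \<le> (\<Sum>j\<in>J. cmod (M i j * x j))"
        by (simp add: mat_app_def norm_sum)
      also have "\<dots> \<le> (\<Sum>j\<in>J. cmod (M i j) * vec_norm J x)"
        unfolding norm_mult vec_norm_def
        by (intro sum_mono mult_left_mono member_le_L2_set assms) auto
      finally show "cmod (mat_app I J M x i) \<le> (\<Sum>j\<in>J. cmod (M i j) * vec_norm J x)" .
    qed
    finally show "vec_norm I (mat_app I J M x) \<le> ?c * vec_norm J x"
      by (simp add: sum_distrib_right)
  qed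
qed

lemma op_norm_bdd_above:
  assumes "finite I"
  shows "bdd_above ((\<lambda>x. vec_norm I (mat_app I I M x)) ` {x \<in> extensional I. vec_norm I x \<le> 1})"
proof -
  obtain c where c: "0 \<le> c" "op_bound I I M c"
    using op_bound_exists[OF assms assms] by blast
  have "vec_norm I (mat_app I I M x) \<le> c" if "vec_norm I x \<le> 1" for x
    using op_boundD[OF c(2), of x] mult_left_mono[OF that c(1)] by simp
  then show ?thesis by (auto intro!: bdd_aboveI)
qed

lemma op_norm_le:
  assumes "finite I" "0 \<le> c" "op_bound I I M c"
  shows "op_norm I M \<le> c"
  unfolding op_norm_def
proof (rule cSUP_least)
  show "{x \<in> extensional I. vec_norm I x \<le> 1} \<noteq> {}"
    using vec_norm_zero[of I "\<lambda>i\<in>I. 0"] by (auto intro!: exI[of _ "\<lambda>i\<in>I. 0"])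
  show "vec_norm I (mat_app I I M x) \<le> c" if "x \<in> {x \<in> extensional I. vec_norm I x \<le> 1}" for x
    using op_boundD[OF assms(3), of x] mult_left_mono[OF _ assms(2), of "vec_norm I x" 1] that by simp
qed

lemma op_bound_op_norm:
  assumes "finite I"
  shows "op_bound I I M (op_norm I M)"
  unfolding op_bound_def
proof
  fix x
  show "vec_norm I (mat_app I I M x) \<le> op_norm I M * vec_norm I x"
  proof (cases "vec_norm I x = 0")
    case True
    obtain c where "op_bound I I M c"
      using op_bound_exists[OF assms assms] by blast
    from op_boundD[OF this, of x] True show ?thesis by simp
  next
    case False
    define t where "t = vec_norm I x"
    have t: "t > 0" using False by (simp add: t_def order.not_eq_order_implies_strict)
    \<comment> \<open>The supremum ranges over extensional vectors, hence the restriction of the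
      normalized vector.\<close>
    let ?y = "\<lambda>i\<in>I. of_real (1 / t) * x i"
    have y: "vec_norm I ?y = 1"
      using t vec_norm_scale[of I "of_real (1 / t)" x]
      by (subst vec_norm_cong[where y = "\<lambda>i. of_real (1 / t) * x i"]) (auto simp: norm_divide t_def)
    have "vec_norm I (mat_app I I M ?y) = vec_norm I (\<lambda>i. of_real (1 / t) * mat_app I I M x i)"
      by (rule vec_norm_cong) (simp add: mat_app_def sum_distrib_left mult_ac sum_divide_distrib)
    also have "\<dots> = vec_norm I (mat_app I I M x) / t"
      using t by (subst vec_norm_scale) (simp add: norm_divide)
    finally have "vec_norm I (mat_app I I M x) / t = vec_norm I (mat_app I I M ?y)" by simp
    also have "\<dots> \<le> op_norm I M"
      unfolding op_norm_def
      by (rule cSUP_upper[OF _ op_norm_bdd_above[OF assms]]) (use y in auto)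
    finally show ?thesis using t by (simp add: t_def field_simps)
  qed
qed

lemma op_norm_nonneg: "finite I \<Longrightarrow> 0 \<le> op_norm I M"
  using op_norm_bdd_above[of I M] vec_norm_zero[of I "\<lambda>i\<in>I. 0"]
  unfolding op_norm_def by (intro cSUP_upper2[where x = "\<lambda>i\<in>I. 0"]) auto

lemma op_bound_iff_op_norm: "finite I \<Longrightarrow> 0 \<le> c \<Longrightarrow> op_bound I I M c \<longleftrightarrow> op_norm I M \<le> c"
  using op_bound_mono op_bound_op_norm op_norm_le by blast

lemma op_norm_cong:
  "(\<And>i j. i \<in> I \<Longrightarrow> j \<in> I \<Longrightarrow> M i j = N i j) \<Longrightarrow> op_norm I M = op_norm I N"
  unfolding op_norm_def by (intro SUP_cong refl) (simp cong: mat_app_cong)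

text \<open>Seen by applying \<open>M\<close> to the basis vector at \<open>j\<close>. It turns
  estimates in norm into estimates of entries, where completeness of the complex numbers is
  available.\<close>

lemma cmod_entry_le:
  assumes "finite I" "op_bound I I M c" "i \<in> I" "j \<in> I"
  shows "cmod (M i j) \<le> c"
proof -
  let ?e = "\<lambda>k. of_bool (k = j)"
  have "vec_norm I ?e = sqrt (\<Sum>k\<in>I. if k = j then 1 else 0)"
    unfolding vec_norm_def L2_set_def by (rule arg_cong[where f = sqrt], rule sum.cong) auto
  then have e: "vec_norm I ?e = 1"
    using assms by simp
  have "cmod (M i j) = cmod (mat_app I I M ?e i)"
    using assms by (simp add: mat_app_def of_bool_def if_distrib[of "(*) _"] cong: if_cong)
  also have "\<dots> \<le> vec_norm I (mat_app I I M ?e)"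
    unfolding vec_norm_def by (rule member_le_L2_set[where f = "\<lambda>i. cmod (mat_app I I M ?e i)"]) (use assms in auto)
  also have "\<dots> \<le> c" using op_boundD[OF assms(2), of ?e] e by simp
  finally show ?thesis .
qed

section \<open>Inverse and square root\<close>

lemma tendsto_vec_norm_mat_app:
  assumes "finite I" "finite J" "\<And>i j. i \<in> I \<Longrightarrow> j \<in> J \<Longrightarrow> (\<lambda>n. Ms n i j) \<longlonglongrightarrow> M i j"
  shows "(\<lambda>n. vec_norm I (mat_app I J (Ms n) x)) \<longlonglongrightarrow> vec_norm I (mat_app I J M x)"
proof -
  have "(\<lambda>n. mat_app I J (Ms n) x i) \<longlonglongrightarrow> mat_app I J M x i" if "i \<in> I" for i
    using assms that by (auto simp: mat_app_def intro!: tendsto_sum tendsto_mult)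
  then show ?thesis
    unfolding vec_norm_def L2_set_def
    by (intro tendsto_real_sqrt tendsto_sum tendsto_power tendsto_norm)
qed

text \<open>Banach iteration from 0. Matrices are plain functions without a metric, so convergence
  is obtained entry by entry: successive differences are dominated by a geometric series. The limit
  keeps the radius \<open>R\<close> because the norm of the image of a fixed vector is continuous in
  the entries. The result is clipped since \<open>f\<close> matters only on
  \<open>I \<times> I\<close>.\<close>

lemma contraction_fixpoint:
  fixes f :: "('i \<Rightarrow> 'i \<Rightarrow> complex) \<Rightarrow> 'i \<Rightarrow> 'i \<Rightarrow> complex"
  assumes I: "finite I" and r: "0 \<le> r" "r < 1" and R: "0 \<le> R"
    and ball: "\<And>Y. op_norm I Y \<le> R \<Longrightarrow> op_norm I (f Y) \<le> R"
    and contr: "\<And>Y Z. op_norm I Y \<le> R \<Longrightarrow> op_norm I Z \<le> R \<Longrightarrow>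
      op_norm I (mat_diff (f Y) (f Z)) \<le> r * op_norm I (mat_diff Y Z)"
    and cont: "\<And>Ys Y i j. (\<And>i j. i \<in> I \<Longrightarrow> j \<in> I \<Longrightarrow> (\<lambda>n. Ys n i j) \<longlonglongrightarrow> Y i j) \<Longrightarrow>
      i \<in> I \<Longrightarrow> j \<in> I \<Longrightarrow> (\<lambda>n. f (Ys n) i j) \<longlonglongrightarrow> f Y i j"
  obtains Y where "op_norm I Y \<le> R" "clip I I (f Y) = Y"
proof -
  define Y where "Y n = (f ^^ n) (\<lambda>_ _. 0)" for n
  have Y_Suc: "Y (Suc n) = f (Y n)" for n by (simp add: Y_def)
  have norm_Y: "op_norm I (Y n) \<le> R" for n
  proof (induction n)
    case 0
    have "op_bound I I (Y 0) 0"
      by (auto simp: op_bound_def Y_def mat_app_def intro!: eq_refl vec_norm_zero)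
    then show ?case using op_bound_iff_op_norm[OF I] R by fastforce
  qed (simp add: Y_Suc ball)
  define c where "c = op_norm I (mat_diff (Y 1) (Y 0))"
  have step: "op_norm I (mat_diff (Y (Suc n)) (Y n)) \<le> c * r ^ n" for n
  proof (induction n)
    case 0
    then show ?case by (simp add: c_def)
  next
    case (Suc n)
    have "op_norm I (mat_diff (Y (Suc (Suc n))) (Y (Suc n)))
        \<le> r * op_norm I (mat_diff (Y (Suc n)) (Y n))"
      unfolding Y_Suc[of "Suc n"] Y_Suc[of n, THEN arg_cong, of f] Y_Suc[of n]
      using contr[OF norm_Y[of "Suc n"] norm_Y[of n]] by (simp add: Y_Suc)
    also have "\<dots> \<le> r * (c * r ^ n)"
      using Suc r by (intro mult_left_mono)
    finally show ?case by (simp add: mult_ac)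
  qed
  have "convergent (\<lambda>n. Y n i j)" if "i \<in> I" "j \<in> I" for i j
  proof -
    have "summable (\<lambda>n. Y (Suc n) i j - Y n i j)"
    proof (rule summable_comparison_test')
      show "summable (\<lambda>n. c * r ^ n)" using r by (intro summable_mult summable_geometric) simp
      show "norm (Y (Suc n) i j - Y n i j) \<le> c * r ^ n" for n
        using cmod_entry_le[OF I op_bound_op_norm[OF I] that, of "mat_diff (Y (Suc n)) (Y n)"] step[of n]
        by (simp add: mat_diff_def)
    qed
    then have "convergent (\<lambda>n. \<Sum>k<n. Y (Suc k) i j - Y k i j)"
      by (simp add: summable_iff_convergent)
    then have "convergent (\<lambda>n. Y n i j - Y 0 i j)"
      unfolding sum_lessThan_telescope[of "\<lambda>n. Y n i j"] .
    then show ?thesis by (simp add: convergent_diff_const_right_iff)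
  qed
  then obtain L where L: "\<And>i j. i \<in> I \<Longrightarrow> j \<in> I \<Longrightarrow> (\<lambda>n. Y n i j) \<longlonglongrightarrow> L i j"
    unfolding convergent_def by metis
  define Z where "Z = clip I I L"
  have Z: "(\<lambda>n. Y n i j) \<longlonglongrightarrow> Z i j" if "i \<in> I" "j \<in> I" for i j
    using L that by (simp add: Z_def clip_def)
  have "f Z i j = Z i j" if "i \<in> I" "j \<in> I" for i j
  proof (rule LIMSEQ_unique)
    show "(\<lambda>n. Y (Suc n) i j) \<longlonglongrightarrow> f Z i j" unfolding Y_Suc by (rule cont[OF Z that])
    show "(\<lambda>n. Y (Suc n) i j) \<longlonglongrightarrow> Z i j" using Z[OF that] by (rule LIMSEQ_Suc)
  qed
  then have fix_Z: "clip I I (f Z) = Z"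
    by (auto simp: clip_def Z_def fun_eq_iff)
  have "op_bound I I Z R"
    unfolding op_bound_def
  proof
    fix x
    have "vec_norm I (mat_app I I (Y n) x) \<le> R * vec_norm I x" for n
      using norm_Y[of n] op_boundD op_bound_iff_op_norm[OF I R] by blast
    then show "vec_norm I (mat_app I I Z x) \<le> R * vec_norm I x"
      using LIMSEQ_le_const2[OF tendsto_vec_norm_mat_app[where Ms = Y and M = Z, OF I I Z]] by blast
  qed
  then show ?thesis using that fix_Z op_norm_le[OF I R] by blast
qed

lemma op_norm_mul_le:
  assumes "finite I"
  shows "op_norm I (mat_mul I M N) \<le> op_norm I M * op_norm I N"
  using assms by (intro op_norm_le op_bound_mul op_bound_op_norm mult_nonneg_nonneg op_norm_nonneg)

lemma op_norm_diff_le: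
  assumes "finite I"
  shows "op_norm I (mat_diff M N) \<le> op_norm I M + op_norm I N"
  using assms by (intro op_norm_le op_bound_diff op_bound_op_norm add_nonneg_nonneg op_norm_nonneg)

lemma op_norm_scale:
  assumes "finite I"
  shows "op_norm I (\<lambda>i j. a * M i j) \<le> cmod a * op_norm I M"
proof (rule op_norm_le)
  show "op_bound I I (\<lambda>i j. a * M i j) (cmod a * op_norm I M)"
    unfolding op_bound_def
  proof
    fix x
    have "vec_norm I (mat_app I I (\<lambda>i j. a * M i j) x) = vec_norm I (\<lambda>i. a * mat_app I I M x i)"
      by (rule vec_norm_cong) (simp add: mat_app_def sum_distrib_left mult_ac)
    also have "\<dots> \<le> cmod a * (op_norm I M * vec_norm I x)"
      unfolding vec_norm_scale by (intro mult_left_mono op_boundD op_bound_op_norm assms) simp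
    finally show "vec_norm I (mat_app I I (\<lambda>i j. a * M i j) x) \<le> cmod a * op_norm I M * vec_norm I x"
      by (simp add: mult_ac)
  qed
qed (simp_all add: assms op_norm_nonneg)

lemma op_norm_clip [simp]: "op_norm I (clip I I M) = op_norm I M"
  by (rule op_norm_cong) (simp add: clip_def)

lemma op_norm_adj_le: "finite I \<Longrightarrow> op_norm I (mat_adj M) \<le> op_norm I M"
  by (intro op_norm_le op_bound_adj op_bound_op_norm op_norm_nonneg)

lemma op_norm_id_on: "finite I \<Longrightarrow> op_norm I (id_on I) \<le> 1"
  by (rule op_norm_le) (auto simp: op_bound_def mat_app_id_on intro!: eq_refl vec_norm_cong)

text \<open>A right and a left inverse of \<open>1 - X\<close> are fixed points of
  \<open>Z \<mapsto> 1 + X Z\<close> and \<open>Z \<mapsto> 1 + Z X\<close>, both contractions with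
  constant \<open>r\<close>; the two inverses then coincide.\<close>

lemma Neumann_inverse:
  assumes I: "finite I" and X: "supp_on I I X" "op_norm I X \<le> r" "r < 1"
  obtains Z where "supp_on I I Z"
    "mat_mul I (mat_diff (id_on I) X) Z = id_on I" "mat_mul I Z (mat_diff (id_on I) X) = id_on I"
proof -
  have r: "0 \<le> r" using X(2) op_norm_nonneg[OF I, of X] by linarith
  \<comment> \<open>The solution of \<open>1 + r * R = R\<close>, so that the maps send the ball of
    radius \<open>R\<close> into itself.\<close>
  define R where "R = 1 / (1 - r)"
  have R: "0 \<le> R" "1 + r * R = R" using X(3) by (auto simp: R_def field_simps)
  \<comment> \<open>\<open>mul\<close> stands for multiplication by \<open>X\<close> from one side,
    so that one argument covers both equations.\<close>
  have sol: "\<exists>Z. supp_on I I Z \<and> mat_diff Z (mul Z) = id_on I"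
    if mul: "\<And>Y. op_norm I (mul Y) \<le> r * op_norm I Y" "\<And>Y Z. mat_diff (mul Y) (mul Z) = mul (mat_diff Y Z)"
      "\<And>Y. supp_on I I Y \<Longrightarrow> supp_on I I (mul Y)"
      and mul_cont: "\<And>Ys Y i j. (\<And>i j. i \<in> I \<Longrightarrow> j \<in> I \<Longrightarrow> (\<lambda>n. Ys n i j) \<longlonglongrightarrow> Y i j) \<Longrightarrow>
      i \<in> I \<Longrightarrow> j \<in> I \<Longrightarrow> (\<lambda>n. mul (Ys n) i j) \<longlonglongrightarrow> mul Y i j"
    for mul :: "('a \<Rightarrow> 'a \<Rightarrow> complex) \<Rightarrow> 'a \<Rightarrow> 'a \<Rightarrow> complex"
  proof -
    have mul_neg: "op_norm I (mul Y) \<le> r * t" if "op_norm I Y \<le> t" for Y t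
      using mul(1)[of Y] mult_left_mono[OF that r] by linarith
    \<comment> \<open>This is \<open>Y \<mapsto> 1 + mul Y\<close>, with the sum written as the
      difference of a negative.\<close>
    let ?f = "\<lambda>Y. mat_diff (id_on I) (\<lambda>i j. - 1 * mul Y i j)"
    obtain Z where Z: "clip I I (?f Z) = Z"
    proof (rule contraction_fixpoint[OF I r X(3) R(1), of ?f])
      show "op_norm I (?f Y) \<le> R" if "op_norm I Y \<le> R" for Y
        using op_norm_diff_le[OF I, of "id_on I" "\<lambda>i j. - 1 * mul Y i j"]
          op_norm_scale[OF I, of "- 1" "mul Y"] mul_neg[OF that] op_norm_id_on[OF I] R(2) by simp
      show "op_norm I (mat_diff (?f Y) (?f Z)) \<le> r * op_norm I (mat_diff Y Z)" for Y Z
      proof -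
        have "mat_diff (?f Y) (?f Z) = mul (mat_diff Y Z)"
          unfolding mul(2)[symmetric] by (simp add: mat_diff_def)
        then show ?thesis using mul(1) by simp
      qed
      show "(\<lambda>n. ?f (Ys n) i j) \<longlonglongrightarrow> ?f Y i j"
        if "\<And>i j. i \<in> I \<Longrightarrow> j \<in> I \<Longrightarrow> (\<lambda>n. Ys n i j) \<longlonglongrightarrow> Y i j" "i \<in> I" "j \<in> I" for Ys Y i j
        unfolding mat_diff_def by (intro tendsto_intros mul_cont that)
    qed
    have s: "supp_on I I Z" by (metis Z supp_on_clip)
    have "supp_on I I (?f Z)"
      by (intro supp_on_diff supp_on_id_on) (use mul(3)[OF s] in \<open>auto simp: supp_on_def\<close>)
    then have "?f Z = Z" using Z clip_supp_on by metis
    then have "mat_diff Z (mul Z) = mat_diff (?f Z) (mul Z)" by simp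
    also have "\<dots> = id_on I" by (simp add: mat_diff_def fun_eq_iff)
    finally show ?thesis using s by blast
  qed
  have "\<exists>Z. supp_on I I Z \<and> mat_diff Z (mat_mul I X Z) = id_on I"
  proof (rule sol)
    show "op_norm I (mat_mul I X Y) \<le> r * op_norm I Y" for Y
      using op_norm_mul_le[OF I, of X Y] mult_right_mono[OF X(2) op_norm_nonneg[OF I, of Y]] by linarith
    show "(\<lambda>n. mat_mul I X (Ys n) i j) \<longlonglongrightarrow> mat_mul I X Y i j"
      if "\<And>i j. i \<in> I \<Longrightarrow> j \<in> I \<Longrightarrow> (\<lambda>n. Ys n i j) \<longlonglongrightarrow> Y i j" "i \<in> I" "j \<in> I" for Ys Y i j
      unfolding mat_mul_def by (intro tendsto_intros that)
  qed (auto simp: mat_mul_diff_right intro: supp_on_mul X)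
  then obtain Z where Z: "supp_on I I Z" "mat_diff Z (mat_mul I X Z) = id_on I" by blast
  have "\<exists>Z. supp_on I I Z \<and> mat_diff Z (mat_mul I Z X) = id_on I"
  proof (rule sol)
    show "op_norm I (mat_mul I Y X) \<le> r * op_norm I Y" for Y
      using op_norm_mul_le[OF I, of Y X] mult_right_mono[OF X(2) op_norm_nonneg[OF I, of Y]]
      by (simp add: mult.commute)
    show "(\<lambda>n. mat_mul I (Ys n) X i j) \<longlonglongrightarrow> mat_mul I Y X i j"
      if "\<And>i j. i \<in> I \<Longrightarrow> j \<in> I \<Longrightarrow> (\<lambda>n. Ys n i j) \<longlonglongrightarrow> Y i j" "i \<in> I" "j \<in> I" for Ys Y i j
      unfolding mat_mul_def by (intro tendsto_intros that)
  qed (auto simp: mat_mul_diff_left intro: supp_on_mul X)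
  then obtain Z' where Z': "supp_on I I Z'" "mat_diff Z' (mat_mul I Z' X) = id_on I" by blast
  let ?N = "mat_diff (id_on I) X"
  have 1: "mat_mul I ?N Z = id_on I"
    using Z by (simp add: mat_mul_diff_left mat_mul_id_left[OF I])
  have 2: "mat_mul I Z' ?N = id_on I"
    using Z' by (simp add: mat_mul_diff_right mat_mul_id_right[OF I])
  have "Z' = mat_mul I Z' (mat_mul I ?N Z)" using 1 Z'(1) by (simp add: mat_mul_id_right[OF I])
  also have "\<dots> = Z" unfolding mat_mul_assoc[symmetric] 2 using Z(1) by (simp add: mat_mul_id_left[OF I])
  finally show ?thesis using that Z(1) 1 2 by blast
qed

text \<open>On the compact unit sphere the continuous function
  \<open>\<parallel>Vx\<parallel>\<close> attains its minimum, which is positive by injectivity;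
  homogeneity extends the bound to all vectors.\<close>

lemma injective_bounded_below:
  assumes H: "finite H" and I: "finite I"
    and inj: "\<And>x. (\<And>s. s \<in> H \<Longrightarrow> mat_app H I V x s = 0) \<Longrightarrow> (\<And>i. i \<in> I \<Longrightarrow> x i = 0)"
  obtains \<delta> where "\<delta> > 0" "\<And>x. \<delta> * vec_norm I x \<le> vec_norm H (mat_app H I V x)"
proof -
  let ?nV = "\<lambda>x. vec_norm H (mat_app H I V x)"
  \<comment> \<open>Coordinates outside \<open>I\<close> are pinned to 0, so that the polydisc is a
    compact product over the whole index type.\<close>
  define K where "K = PiE UNIV (\<lambda>i. if i \<in> I then cball 0 1 else {0::complex})"
  have "compactin (product_topology (\<lambda>i. euclidean) UNIV) K"
    unfolding K_def by (rule compactin_PiE[THEN iffD2]) auto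
  then have cK: "compact K"
    by (simp add: euclidean_product_topology)
  have cont_coord: "continuous_on S (\<lambda>x. x i)" for S and i :: 'b and x :: "'b \<Rightarrow> complex"
    by (rule continuous_on_subset[OF continuous_on_product_coordinates]) simp
  have cont_norm: "continuous_on S (\<lambda>x. vec_norm I x)" for S
    unfolding vec_norm_def L2_set_def by (intro continuous_intros cont_coord)
  have cont: "continuous_on S ?nV" for S
  proof -
    have "?nV = (\<lambda>x. sqrt (\<Sum>s\<in>H. (cmod (\<Sum>i\<in>I. V s i * x i))\<^sup>2))"
      by (simp add: vec_norm_def L2_set_def mat_app_def)
    then show ?thesis by (simp only:) (intro continuous_intros cont_coord)
  qed
  define U where "U = {x \<in> K. vec_norm I x = 1}"
  have "U = K \<inter> {x. vec_norm I x = 1}" by (auto simp: U_def)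
  moreover have "closed {x. vec_norm I x = 1}"
    by (intro closed_Collect_eq cont_norm continuous_on_const)
  ultimately have cU: "compact U"
    using cK by (simp add: compact_Int_closed)
  have scale: "\<exists>y\<in>U. ?nV x = vec_norm I x * ?nV y" if "vec_norm I x \<noteq> 0" for x
  proof -
    define t where "t = vec_norm I x"
    have t: "t > 0" using that by (simp add: t_def order.not_eq_order_implies_strict)
    define y where "y i = (if i \<in> I then of_real (1 / t) * x i else 0)" for i
    have "vec_norm I y = vec_norm I (\<lambda>i. of_real (1 / t) * x i)"
      by (rule vec_norm_cong) (simp add: y_def)
    then have 1: "vec_norm I y = 1"
      using t by (simp only: vec_norm_scale) (simp add: norm_divide t_def)
    have "cmod (y i) \<le> 1" if "i \<in> I" for i
      using member_le_L2_set[OF I that, of "\<lambda>i. cmod (y i)"] 1 by (simp add: vec_norm_def)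
    then have "y \<in> U" using 1 by (auto simp: U_def K_def PiE_iff y_def dist_norm)
    moreover have "?nV x = vec_norm H (\<lambda>s. of_real t * mat_app H I V y s)"
      using t by (intro vec_norm_cong) (auto simp: mat_app_def y_def sum_distrib_left intro!: sum.cong)
    ultimately show ?thesis
      using t by (simp only: vec_norm_scale) (auto simp: t_def)
  qed
  show ?thesis
  proof (cases "U = {}")
    \<comment> \<open>Without unit vectors every norm over \<open>I\<close> is 0 and any constant
      serves.\<close>
    case True
    then have "1 * vec_norm I x \<le> ?nV x" for x
      using scale[of x] by (cases "vec_norm I x = 0") auto
    then show ?thesis using that[of 1] by simp
  next
    case False
    then obtain u where u: "u \<in> U" "\<And>y. y \<in> U \<Longrightarrow> ?nV u \<le> ?nV y"
      using continuous_attains_inf[OF cU _ cont[of U]] by blast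
    have "?nV u \<noteq> 0"
    proof
      assume "?nV u = 0"
      then have "\<And>i. i \<in> I \<Longrightarrow> u i = 0"
        using vec_norm_eq_0_iff[OF H] inj[of u] by blast
      then show False using u(1) vec_norm_zero[of I u] by (simp add: U_def)
    qed
    then have "?nV u > 0" by (simp add: order.not_eq_order_implies_strict)
    moreover have "?nV u * vec_norm I x \<le> ?nV x" for x
    proof (cases "vec_norm I x = 0")
      case False
      then obtain y where "y \<in> U" "?nV x = vec_norm I x * ?nV y" using scale by blast
      then show ?thesis using u(2)[of y] by (simp add: mult.commute mult_left_mono)
    qed simp
    ultimately show ?thesis using that by blast
  qed
qed

text \<open>
  With \<open>X = 1 - t V\<^sup>\<dagger>V\<close> of norm less than \<open>1\<close>, the root of \<open>1 - X\<close> is \<open>1 - Y\<close>, where \<open>Y\<close> is the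
  fixed point of the contraction \<open>Y \<mapsto> (X + Y\<^sup>2) / 2\<close>.
\<close>

lemma gram_sqrt:
  assumes H: "finite H" and I: "finite I" and V: "supp_on H I V"
    and inj: "\<And>x. (\<And>s. s \<in> H \<Longrightarrow> mat_app H I V x s = 0) \<Longrightarrow> (\<And>i. i \<in> I \<Longrightarrow> x i = 0)"
  obtains S T where "supp_on I I S" "supp_on I I T" "mat_adj S = S"
    "\<And>x. 0 \<le> Re (vec_inner I x (mat_app I I S x))"
    "mat_mul I S S = mat_mul H (mat_adj V) V" "mat_mul I S T = id_on I" "mat_mul I T S = id_on I"
proof -
  let ?nV = "\<lambda>x. vec_norm H (mat_app H I V x)"
  define \<rho> where "\<rho> = mat_mul H (mat_adj V) V"
  have supp_\<rho>: "supp_on I I \<rho>" unfolding \<rho>_def by (rule supp_on_mul[OF supp_on_adj[OF V] V])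
  obtain \<delta> where \<delta>: "\<delta> > 0" "\<And>x. \<delta> * vec_norm I x \<le> ?nV x"
    by (rule injective_bounded_below[where V = V, OF H I]) (use inj in blast)+
  obtain m0 where m0: "0 \<le> m0" "op_bound H I V m0" using op_bound_exists[OF H I] by blast
  \<comment> \<open>The maximum guarantees \<open>\<delta> \<le> m\<close>, which makes
    \<open>q\<close> nonnegative below, and \<open>m > 0\<close>.\<close>
  define m where "m = max m0 \<delta>"
  have m: "0 < m" "\<delta> \<le> m" "op_bound H I V m"
    using \<delta> op_bound_mono[OF m0(2), of m] by (auto simp: m_def)
  define t where "t = 1 / m\<^sup>2"
  have t: "0 < t" "t * m\<^sup>2 = 1" using m by (auto simp: t_def)
  define X where "X = mat_diff (id_on I) (\<lambda>i j. of_real t * \<rho> i j)"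
  have supp_X: "supp_on I I X"
    unfolding X_def by (intro supp_on_diff supp_on_id_on) (use supp_\<rho> in \<open>auto simp: supp_on_def\<close>)
  have adj_X: "mat_adj X = X"
  proof -
    have "mat_adj \<rho> = \<rho>" by (simp add: \<rho>_def mat_adj_mul)
    then have "mat_diff (mat_adj (id_on I)) (\<lambda>i j. of_real t * mat_adj \<rho> i j) = X"
      by (simp add: X_def)
    moreover have "mat_adj X = mat_diff (mat_adj (id_on I)) (\<lambda>i j. of_real t * mat_adj \<rho> i j)"
      by (simp add: X_def mat_adj_def mat_diff_def)
    ultimately show ?thesis by simp
  qed
  define q where "q = 1 - t * \<delta>\<^sup>2"
  have q: "0 \<le> q" "q < 1"
  proof -
    have "t * \<delta>\<^sup>2 \<le> t * m\<^sup>2"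
      using m \<delta> t by (intro mult_left_mono power_mono) auto
    then show "0 \<le> q" "q < 1" using t \<delta> by (auto simp: q_def)
  qed
  define r where "r = sqrt q"
  have r: "0 \<le> r" "r < 1" using q by (auto simp: r_def)
  \<comment> \<open>\<open>\<parallel>Xx\<parallel>\<^sup>2 = \<parallel>x\<parallel>\<^sup>2 -
    2t\<parallel>Vx\<parallel>\<^sup>2 + t\<^sup>2\<parallel>\<rho>x\<parallel>\<^sup>2\<close>. As
    \<open>\<parallel>\<rho>x\<parallel> \<le> m\<parallel>Vx\<parallel>\<close> and
    \<open>t * m\<^sup>2 = 1\<close>, the last term cancels half of the middle one; the lower bound
    \<open>\<delta>\<close> then leaves the factor \<open>q\<close>, the square of
    \<open>r\<close>.\<close>
  have "op_bound I I X r"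
    unfolding op_bound_def
  proof
    fix x
    let ?y = "mat_app I I \<rho> x"
    let ?a = "vec_norm I x" and ?b = "vec_norm I ?y"
    have \<rho>_app: "?y = mat_app I H (mat_adj V) (mat_app H I V x)"
      by (simp add: \<rho>_def mat_app_mul)
    have b: "?b \<le> m * ?nV x"
      unfolding \<rho>_app using m by (intro op_boundD op_bound_adj) auto
    have inner: "vec_inner I ?y x = of_real ((?nV x)\<^sup>2)"
      unfolding \<rho>_app vec_inner_adj by (rule vec_inner_self)
    then have inner': "vec_inner I x ?y = of_real ((?nV x)\<^sup>2)"
      by (metis vec_inner_cnj complex_cnj_complex_of_real)
    have X_app: "mat_app I I X x i = x i - of_real t * ?y i" if "i \<in> I" for i
      using that I unfolding X_def
      by (simp only: mat_app_diff mat_app_id_on) (simp add: mat_app_def sum_distrib_left mult.assoc)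
    have "complex_of_real ((vec_norm I (mat_app I I X x))\<^sup>2)
        = vec_inner I (\<lambda>i. x i - of_real t * ?y i) (\<lambda>i. x i - of_real t * ?y i)"
      unfolding vec_inner_self[symmetric] vec_inner_def by (intro sum.cong refl) (simp add: X_app)
    also have "\<dots> = vec_inner I x x - of_real t * vec_inner I x ?y - of_real t * vec_inner I ?y x
        + of_real (t\<^sup>2) * vec_inner I ?y ?y"
      by (simp add: vec_inner_def sum_distrib_left sum_subtractf[symmetric] sum.distrib[symmetric]
          algebra_simps power2_eq_square)
    also have "\<dots> = of_real (?a\<^sup>2 - 2 * t * (?nV x)\<^sup>2 + t\<^sup>2 * ?b\<^sup>2)"
      unfolding inner inner' vec_inner_self by simp
    finally have "(vec_norm I (mat_app I I X x))\<^sup>2 = ?a\<^sup>2 - 2 * t * (?nV x)\<^sup>2 + t\<^sup>2 * ?b\<^sup>2"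
      unfolding of_real_eq_iff .
    also have "\<dots> \<le> ?a\<^sup>2 - 2 * t * (?nV x)\<^sup>2 + t\<^sup>2 * (m * ?nV x)\<^sup>2"
      using b by (intro add_left_mono mult_left_mono power_mono) auto
    also have "\<dots> = ?a\<^sup>2 - t * (?nV x)\<^sup>2"
      using t(2) by (simp add: power_mult_distrib power2_eq_square algebra_simps)
    also have "\<dots> \<le> ?a\<^sup>2 - t * (\<delta> * ?a)\<^sup>2"
      using \<delta> t by (intro diff_left_mono mult_left_mono power_mono) (auto simp: less_imp_le)
    also have "\<dots> = (r * ?a)\<^sup>2"
      using q by (simp add: r_def q_def power_mult_distrib algebra_simps)
    finally show "vec_norm I (mat_app I I X x) \<le> r * ?a"
      using r by (simp add: power2_le_iff_abs_le abs_of_nonneg)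
  qed
  then have X: "op_norm I X \<le> r" using op_norm_le[OF I r(1)] by blast
  let ?f = "\<lambda>Y i j. (1 / 2) * mat_diff X (\<lambda>i j. - 1 * mat_mul I Y Y i j) i j"
  \<comment> \<open>The difference of the squares is \<open>Y (Y - Z) + (Y - Z) Z\<close>, of norm
    at most \<open>2r\<close> times that of \<open>Y - Z\<close>; the factor 1/2 leaves the constant
    \<open>r\<close>.\<close>
  have contr: "op_norm I (mat_diff (?f Y) (?f Z)) \<le> r * op_norm I (mat_diff Y Z)"
    if "op_norm I Y \<le> r" "op_norm I Z \<le> r" for Y Z
  proof -
    let ?D = "mat_diff Y Z"
    have "mat_diff (?f Y) (?f Z)
        = (\<lambda>i j. (1 / 2) * mat_diff (mat_mul I Y ?D) (\<lambda>i j. - 1 * mat_mul I ?D Z i j) i j)"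
      unfolding mat_mul_diff_left mat_mul_diff_right by (simp add: mat_diff_def fun_eq_iff field_simps)
    then have "op_norm I (mat_diff (?f Y) (?f Z))
        \<le> 1 / 2 * op_norm I (mat_diff (mat_mul I Y ?D) (\<lambda>i j. - 1 * mat_mul I ?D Z i j))"
      using op_norm_scale[OF I, of "1/2"] by (simp add: norm_divide)
    also have "\<dots> \<le> 1 / 2 * (op_norm I (mat_mul I Y ?D) + op_norm I (mat_mul I ?D Z))"
      using op_norm_diff_le[OF I, of "mat_mul I Y ?D" "\<lambda>i j. - 1 * mat_mul I ?D Z i j"]
        op_norm_scale[OF I, of "-1" "mat_mul I ?D Z"] by simp
    also have "\<dots> \<le> 1 / 2 * (r * op_norm I ?D + op_norm I ?D * r)"
    proof -
      have "op_norm I (mat_mul I Y ?D) \<le> r * op_norm I ?D"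
        using op_norm_mul_le[OF I, of Y ?D] mult_right_mono[OF that(1) op_norm_nonneg[OF I, of ?D]]
        by linarith
      moreover have "op_norm I (mat_mul I ?D Z) \<le> op_norm I ?D * r"
        using op_norm_mul_le[OF I, of ?D Z] mult_left_mono[OF that(2) op_norm_nonneg[OF I, of ?D]]
        by linarith
      ultimately show ?thesis by (intro mult_left_mono add_mono) auto
    qed
    finally show ?thesis by (simp add: mult.commute)
  qed
  obtain Y where Y: "op_norm I Y \<le> r" "clip I I (?f Y) = Y"
  proof (rule contraction_fixpoint[OF I r r(1), of ?f])
    \<comment> \<open>The ball of radius \<open>r\<close> is preserved because
      \<open>(r + r\<^sup>2) / 2 \<le> r\<close>.\<close>
    show "op_norm I (?f Y) \<le> r" if "op_norm I Y \<le> r" for Y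
    proof -
      have "op_norm I (mat_mul I Y Y) \<le> r * r"
        using op_norm_mul_le[OF I, of Y Y] mult_mono[OF that that r(1) op_norm_nonneg[OF I]] by linarith
      also have "\<dots> \<le> 1 * r" using r by (intro mult_right_mono) auto
      finally have "op_norm I (mat_mul I Y Y) \<le> r" by simp
      moreover have "op_norm I (?f Y) \<le> 1 / 2 * op_norm I (mat_diff X (\<lambda>i j. - 1 * mat_mul I Y Y i j))"
        using op_norm_scale[OF I, of "1/2"] by (simp add: norm_divide)
      moreover have "op_norm I (mat_diff X (\<lambda>i j. - 1 * mat_mul I Y Y i j))
          \<le> op_norm I X + op_norm I (mat_mul I Y Y)"
        using op_norm_diff_le[OF I, of X "\<lambda>i j. - 1 * mat_mul I Y Y i j"]
          op_norm_scale[OF I, of "-1" "mat_mul I Y Y"] by simp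
      ultimately show ?thesis using X by argo
    qed
    show "(\<lambda>n. ?f (Ys n) i j) \<longlonglongrightarrow> ?f Y i j"
      if "\<And>i j. i \<in> I \<Longrightarrow> j \<in> I \<Longrightarrow> (\<lambda>n. Ys n i j) \<longlonglongrightarrow> Y i j" "i \<in> I" "j \<in> I" for Ys Y i j
      unfolding mat_diff_def mat_mul_def by (intro tendsto_intros that)
  qed (rule contr)
  have supp_Y: "supp_on I I Y" by (metis Y(2) supp_on_clip)
  have supp_f: "supp_on I I (?f Z)" if "supp_on I I Z" for Z
  proof -
    have "supp_on I I (mat_diff X (\<lambda>i j. - 1 * mat_mul I Z Z i j))"
      by (intro supp_on_diff supp_X) (use supp_on_mul[OF that that, of I] in \<open>auto simp: supp_on_def\<close>)
    then show ?thesis by (auto simp: supp_on_def)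
  qed
  have fix_Y: "?f Y = Y" using Y(2) clip_supp_on[OF supp_f[OF supp_Y]] by simp
  have "mat_adj (?f Y) = ?f (mat_adj Y)"
  proof -
    have "mat_adj (?f Y) = (\<lambda>i j. (1 / 2) * mat_diff (mat_adj X) (\<lambda>i j. - 1 * mat_adj (mat_mul I Y Y) i j) i j)"
      by (simp add: mat_adj_def mat_diff_def)
    then show ?thesis by (simp add: adj_X mat_adj_mul)
  qed
  then have fix_adj: "?f (mat_adj Y) = mat_adj Y" using fix_Y by simp
  \<comment> \<open>\<open>Y\<close> and its adjoint are fixed points in the same ball, so the
    contraction identifies them.\<close>
  have adj_Y: "mat_adj Y = Y"
  proof -
    let ?D = "mat_diff (mat_adj Y) Y"
    have "op_norm I ?D \<le> r * op_norm I ?D"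
      using contr[OF order_trans[OF op_norm_adj_le[OF I] Y(1)] Y(1)] fix_Y fix_adj by simp
    then have "op_norm I ?D \<le> 0"
      using r op_norm_nonneg[OF I, of ?D] by (metis linorder_not_less mult_less_cancel_right2 order_less_le)
    then have "op_bound I I ?D 0" using op_bound_iff_op_norm[OF I] by blast
    then have "?D i j = 0" if "i \<in> I" "j \<in> I" for i j
      using cmod_entry_le[OF I _ that] by fastforce
    then show ?thesis
      by (intro supp_on_eqI[OF supp_on_adj[OF supp_Y] supp_Y]) (auto simp: mat_diff_def)
  qed
  obtain Z where Z: "supp_on I I Z" "mat_mul I (mat_diff (id_on I) Y) Z = id_on I"
    "mat_mul I Z (mat_diff (id_on I) Y) = id_on I"
    using Neumann_inverse[OF I supp_Y Y(1) r(2)] by blast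
  \<comment> \<open>From the fixed point equation, the square of \<open>1 - Y\<close> is
    \<open>1 - X\<close>, which is \<open>\<rho>\<close> divided by the square of \<open>m\<close>;
    hence the factor \<open>m\<close>.\<close>
  define S where "S i j = of_real m * mat_diff (id_on I) Y i j" for i j
  define T where "T i j = of_real (1 / m) * Z i j" for i j
  have S_mul: "mat_mul I S M = (\<lambda>i j. of_real m * mat_mul I (mat_diff (id_on I) Y) M i j)"
    and mul_S: "mat_mul I M S = (\<lambda>i j. of_real m * mat_mul I M (mat_diff (id_on I) Y) i j)" for M
    by (simp_all add: S_def mat_mul_def sum_distrib_left mult_ac)
  have T_mul: "mat_mul I T M = (\<lambda>i j. of_real (1 / m) * mat_mul I Z M i j)"
    and mul_T: "mat_mul I M T = (\<lambda>i j. of_real (1 / m) * mat_mul I M Z i j)" for M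
    by (simp_all add: T_def mat_mul_def sum_distrib_left mult_ac sum_divide_distrib)
  show ?thesis
  proof (rule that)
    have "supp_on I I (mat_diff (id_on I) Y)" by (intro supp_on_diff supp_on_id_on supp_Y)
    then show "supp_on I I S" by (auto simp: supp_on_def S_def)
    show "supp_on I I T" using Z by (auto simp: supp_on_def T_def)
    have "mat_adj S = (\<lambda>i j. of_real m * mat_diff (mat_adj (id_on I)) (mat_adj Y) i j)"
      by (simp add: S_def mat_adj_def mat_diff_def)
    then show "mat_adj S = S" by (simp add: adj_Y S_def fun_eq_iff)
    show "mat_mul I S T = id_on I" using m Z by (simp add: S_mul mul_T fun_eq_iff)
    show "mat_mul I T S = id_on I" using m Z by (simp add: T_mul mul_S fun_eq_iff)
    \<comment> \<open>Positivity: \<open>Y\<close> has norm at most \<open>r < 1\<close>, so the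
      real part of \<open>\<langle>x, Yx\<rangle>\<close> does not exceed
      \<open>\<parallel>x\<parallel>\<^sup>2\<close>.\<close>
    show "0 \<le> Re (vec_inner I x (mat_app I I S x))" for x
    proof -
      have S_app: "mat_app I I S x i = of_real m * (x i - mat_app I I Y x i)" if "i \<in> I" for i
      proof -
        have "mat_app I I S x i = of_real m * mat_app I I (mat_diff (id_on I) Y) x i"
          using that by (simp add: S_def mat_app_def sum_distrib_left mult.assoc)
        then show ?thesis using that I by (simp add: mat_app_diff mat_app_id_on)
      qed
      have "vec_inner I x (mat_app I I S x) = of_real m * (vec_inner I x x - vec_inner I x (mat_app I I Y x))"
        unfolding vec_inner_def sum_subtractf[symmetric] sum_distrib_left
        by (intro sum.cong refl) (simp add: S_app algebra_simps)
      then have "Re (vec_inner I x (mat_app I I S x))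
          = m * ((vec_norm I x)\<^sup>2 - Re (vec_inner I x (mat_app I I Y x)))"
        by (simp add: vec_inner_self)
      moreover have "Re (vec_inner I x (mat_app I I Y x)) \<le> (vec_norm I x)\<^sup>2"
      proof -
        have "Re (vec_inner I x (mat_app I I Y x)) \<le> vec_norm I x * vec_norm I (mat_app I I Y x)"
          using complex_Re_le_cmod vec_inner_Cauchy_Schwarz order_trans by blast
        also have "\<dots> \<le> vec_norm I x * (r * vec_norm I x)"
          using Y(1) op_bound_iff_op_norm[OF I r(1)] by (intro mult_left_mono op_boundD) auto
        also have "\<dots> \<le> vec_norm I x * (1 * vec_norm I x)"
          using r by (intro mult_left_mono mult_right_mono) auto
        finally show ?thesis by (simp add: power2_eq_square)
      qed
      ultimately show ?thesis using m by simp
    qed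
    have "mat_mul I (mat_diff (id_on I) Y) (mat_diff (id_on I) Y) i j
        = id_on I i j - 2 * Y i j + mat_mul I Y Y i j" for i j
      unfolding mat_mul_diff_left mat_mul_diff_right
      using mat_mul_id_left[OF I supp_Y] mat_mul_id_right[OF I supp_Y] mat_mul_id_left[OF I supp_on_id_on]
      by (simp add: mat_diff_def)
    moreover have "2 * Y i j = X i j + mat_mul I Y Y i j" for i j
      using fun_cong[OF fun_cong[OF fix_Y, of i], of j] by (simp add: mat_diff_def field_simps)
    ultimately have "mat_mul I (mat_diff (id_on I) Y) (mat_diff (id_on I) Y) i j = of_real t * \<rho> i j" for i j
      by (simp add: X_def mat_diff_def)
    then show "mat_mul I S S = mat_mul H (mat_adj V) V"
      unfolding S_mul mul_S \<rho>_def[symmetric] using t(2) m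
      by (simp add: fun_eq_iff t_def power2_eq_square)
  qed
qed

section \<open>Polar decomposition of an injective map\<close>

lemma clip_diff: "clip I J (mat_diff M N) = mat_diff (clip I J M) (clip I J N)"
  by (auto simp: clip_def mat_diff_def fun_eq_iff)

lemma is_mat_inverse_iff_clip:
  "is_mat_inverse I M N \<longleftrightarrow> mat_mul I (clip I I M) (clip I I N) = id_on I \<and>
    mat_mul I (clip I I N) (clip I I M) = id_on I"
  by (simp add: is_mat_inverse_def mat_eq_on_iff_clip mat_mul_clip id_on_def)

lemma mat_inverse_unique:
  assumes "finite I" "supp_on I I N" "supp_on I I N'"
    and "mat_mul I N M = id_on I" "mat_mul I M N' = id_on I"
  shows "N = N'"
proof -
  have "N = mat_mul I N (mat_mul I M N')"
    using assms by (simp add: mat_mul_id_right)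
  also have "\<dots> = N'"
    unfolding mat_mul_assoc[symmetric] using assms by (simp add: mat_mul_id_left)
  finally show ?thesis .
qed

text \<open>Exhibiting any inverse determines the chosen one on \<open>I \<times> I\<close>.\<close>

lemma clip_op_inv:
  assumes I: "finite I" and N: "supp_on I I N"
    "mat_mul I (clip I I M) N = id_on I" "mat_mul I N (clip I I M) = id_on I"
  shows "clip I I (op_inv I M) = N"
proof -
  have "is_mat_inverse I M N"
    using N by (simp add: is_mat_inverse_iff_clip clip_supp_on)
  then have "is_mat_inverse I M (op_inv I M)"
    unfolding op_inv_def by (rule someI[where P = "is_mat_inverse I M"])
  then show ?thesis
    by (intro mat_inverse_unique[OF I _ N(1) _ N(2)]) (auto simp: is_mat_inverse_iff_clip)
qed

lemma mat_adj_inverse: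
  assumes I: "finite I" and "supp_on I I T" "mat_adj S = S"
    "mat_mul I S T = id_on I" "mat_mul I T S = id_on I"
  shows "mat_adj T = T"
proof (rule mat_inverse_unique[OF I _ assms(2) _ assms(4)])
  show "supp_on I I (mat_adj T)" by (rule supp_on_adj) (rule assms)
  show "mat_mul I (mat_adj T) S = id_on I"
    using arg_cong[OF assms(4), of mat_adj] by (simp add: mat_adj_mul assms(3))
qed

text \<open>\<open>gram_sqrt\<close> shows that the choice in \<open>op_sqrt\<close> succeeds. The
  chosen \<open>S\<close> has the same square as the constructed \<open>S0\<close>, so the square of
  \<open>T0\<close> inverts the square of \<open>S\<close>; multiplied by \<open>S\<close> it
  inverts \<open>S\<close> itself.\<close>

lemma op_sqrt_gram:
  fixes V :: "'h \<Rightarrow> 'i \<Rightarrow> complex"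
  assumes H: "finite H" and I: "finite I" and inj: "inj_on (mat_app H I V) (extensional I)"
  defines "S \<equiv> clip I I (op_sqrt I (mat_mul H (mat_adj V) V))"
  defines "T \<equiv> clip I I (op_inv I (op_sqrt I (mat_mul H (mat_adj V) V)))"
  shows "mat_adj S = S" "mat_adj T = T" "mat_mul I S T = id_on I" "mat_mul I T S = id_on I"
    "mat_mul I S S = mat_mul H (mat_adj (clip H I V)) (clip H I V)"
proof -
  let ?\<rho> = "mat_mul H (mat_adj V) V" and ?V = "clip H I V"
  let ?S = "op_sqrt I ?\<rho>"
  have \<rho>: "clip I I ?\<rho> = mat_mul H (mat_adj ?V) ?V"
    by (simp add: mat_adj_clip mat_mul_clip)
  have kernel: "x i = 0" if "\<And>s. s \<in> H \<Longrightarrow> mat_app H I ?V x s = 0" "i \<in> I" for x i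
  proof -
    \<comment> \<open>Injectivity is given on extensional vectors, so the kernel is compared with
      the extensional zero.\<close>
    let ?o = "\<lambda>i\<in>I. 0"
    have "mat_app H I V (restrict x I) = mat_app H I ?V x"
      by (rule mat_app_cong) (auto simp: clip_def)
    also have "\<dots> = mat_app H I V ?o"
      using that(1) by (intro ext) (auto simp: mat_app_def)
    finally have "restrict x I = ?o"
      using inj by (elim inj_onD) auto
    then show ?thesis using that(2) by (metis restrict_apply)
  qed
  obtain S0 T0 where 0: "supp_on I I S0" "supp_on I I T0" "mat_adj S0 = S0"
    "\<And>x. 0 \<le> Re (vec_inner I x (mat_app I I S0 x))"
    "mat_mul I S0 S0 = mat_mul H (mat_adj ?V) ?V" "mat_mul I S0 T0 = id_on I" "mat_mul I T0 S0 = id_on I"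
    by (rule gram_sqrt[where V = ?V, OF H I]) (use kernel in \<open>simp | blast\<close>)+
  have "clip I I ?\<rho> = clip I I (mat_mul I S0 S0)"
    using 0(5) \<rho> clip_supp_on[OF supp_on_mul[OF 0(1) 0(1)]] by metis
  then have "positive_op I S0 \<and> mat_eq_on I (mat_mul I S0 S0) ?\<rho>"
    using 0(3,4) by (simp add: positive_op_def mat_eq_on_iff_clip)
  then have S: "positive_op I ?S \<and> mat_eq_on I (mat_mul I ?S ?S) ?\<rho>"
    unfolding op_sqrt_def
    by (rule someI[where P = "\<lambda>S. positive_op I S \<and> mat_eq_on I (mat_mul I S S) ?\<rho>"])
  then show adj_S: "mat_adj S = S"
    by (simp add: positive_op_def mat_eq_on_iff_clip S_def mat_adj_clip)
  have SS: "mat_mul I S S = mat_mul I S0 S0"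
    using S by (simp add: S_def mat_mul_clip mat_eq_on_iff_clip \<rho> 0)
  then show "mat_mul I S S = mat_mul H (mat_adj ?V) ?V" by (simp add: 0)
  \<comment> \<open>The inverse of \<open>\<rho>\<close>.\<close>
  let ?R = "mat_mul I T0 T0"
  have R: "mat_mul I (mat_mul I S S) ?R = id_on I" "mat_mul I ?R (mat_mul I S S) = id_on I"
  proof -
    have "mat_mul I (mat_mul I S S) ?R = mat_mul I S0 (mat_mul I (mat_mul I S0 T0) T0)"
      unfolding SS by (simp only: mat_mul_assoc)
    then show "mat_mul I (mat_mul I S S) ?R = id_on I"
      using 0 by (simp add: mat_mul_id_left[OF I])
    have "mat_mul I ?R (mat_mul I S S) = mat_mul I T0 (mat_mul I (mat_mul I T0 S0) S0)"
      unfolding SS by (simp only: mat_mul_assoc)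
    then show "mat_mul I ?R (mat_mul I S S) = id_on I"
      using 0 by (simp add: mat_mul_id_left[OF I])
  qed
  have S_supp: "supp_on I I S" by (simp add: S_def)
  let ?T = "mat_mul I S ?R"
  have supp_T: "supp_on I I ?T" "supp_on I I (mat_mul I ?R S)"
    using S_supp 0(2) by (auto intro: supp_on_mul)
  have ST: "mat_mul I S ?T = id_on I" using R by (simp add: mat_mul_assoc)
  have "mat_mul I (mat_mul I ?R S) S = id_on I" using R by (simp add: mat_mul_assoc)
  then have "mat_mul I ?R S = ?T"
    using mat_inverse_unique[OF I supp_T(2) supp_T(1) _ ST] by simp
  then have TS: "mat_mul I ?T S = id_on I" using R by (metis mat_mul_assoc)
  have T_eq: "T = ?T"
    unfolding T_def using ST TS supp_T by (intro clip_op_inv[OF I]) (simp_all add: S_def)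
  show "mat_mul I S T = id_on I" "mat_mul I T S = id_on I"
    using ST TS T_eq by simp_all
  then show "mat_adj T = T"
    using mat_adj_inverse[OF I _ adj_S] supp_T(1) T_eq by metis
qed

text \<open>Pins down the projector obtained by choice. For two candidates with images
  \<open>p\<close> and \<open>q\<close> of \<open>x\<close>, the vector \<open>q - p\<close> is
  orthogonal to all of \<open>W\<close>, in particular to \<open>p\<close> and to \<open>q\<close>,
  hence to itself. Testing against \<open>p\<close> and \<open>q\<close> separately fits a
  \<open>W\<close> that is just a set.\<close>

lemma orth_projector_eqI:
  assumes H: "finite H" and P: "supp_on H H P"
    and range: "\<And>x. x \<in> extensional H \<Longrightarrow> mat_app H H P x \<in> W"
    and orth: "\<And>x w. x \<in> extensional H \<Longrightarrow> w \<in> W \<Longrightarrow> vec_inner H w (\<lambda>i. x i - mat_app H H P x i) = 0"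
  shows "clip H H (orth_projector H W) = P"
proof -
  let ?Q = "orth_projector H W"
  have Q: "\<forall>x\<in>extensional H. mat_app H H ?Q x \<in> W \<and>
      (\<forall>w\<in>W. vec_inner H w (\<lambda>i. x i - mat_app H H ?Q x i) = 0)"
    unfolding orth_projector_def by (rule someI[of _ P]) (use range orth in blast)
  have app_eq: "mat_app H H ?Q x i = mat_app H H P x i" if x: "x \<in> extensional H" and i: "i \<in> H" for x i
  proof -
    let ?p = "mat_app H H P x" and ?q = "mat_app H H ?Q x"
    have "vec_inner H w (\<lambda>i. ?q i - ?p i) = 0" if "w \<in> W" for w
    proof -
      have "vec_inner H w (\<lambda>i. ?q i - ?p i)
          = vec_inner H w (\<lambda>i. x i - ?p i) - vec_inner H w (\<lambda>i. x i - ?q i)"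
        by (simp add: vec_inner_def sum_subtractf[symmetric] algebra_simps)
      then show ?thesis using orth[OF x that] Q x that by simp
    qed
    then have "vec_inner H ?q (\<lambda>i. ?q i - ?p i) = 0" "vec_inner H ?p (\<lambda>i. ?q i - ?p i) = 0"
      using range[OF x] Q x by blast+
    moreover have "vec_inner H (\<lambda>i. ?q i - ?p i) (\<lambda>i. ?q i - ?p i)
        = vec_inner H ?q (\<lambda>i. ?q i - ?p i) - vec_inner H ?p (\<lambda>i. ?q i - ?p i)"
      by (simp add: vec_inner_def sum_subtractf[symmetric] algebra_simps)
    ultimately have "vec_norm H (\<lambda>i. ?q i - ?p i) = 0"
      by (simp add: vec_inner_self)
    then show ?thesis using vec_norm_eq_0_iff[OF H] i by fastforce
  qed
  have "?Q i j = P i j" if "i \<in> H" "j \<in> H" for i j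
  proof -
    let ?e = "\<lambda>k\<in>H. of_bool (k = j)"
    have "mat_app H H M ?e i = M i j" for M
    proof -
      have "mat_app H H M ?e i = (\<Sum>k\<in>H. if k = j then M i k else 0)"
        using that by (simp add: mat_app_def) (rule sum.cong, auto)
      then show ?thesis using H that by simp
    qed
    then show ?thesis using app_eq[of ?e i] that by simp
  qed
  then show ?thesis
    using P by (intro supp_on_eqI[OF supp_on_clip P]) (simp add: clip_def)
qed

text \<open>\<open>W W\<^sup>\<dagger> = V T W\<^sup>\<dagger>\<close> maps into the image of
  \<open>V\<close>, and \<open>V\<^sup>\<dagger> W W\<^sup>\<dagger> = V\<^sup>\<dagger>\<close>
  makes the remainder orthogonal to it.\<close>

lemma orth_projector_isometry:
  fixes V :: "'h \<Rightarrow> 'i \<Rightarrow> complex"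
  assumes H: "finite H" and I: "finite I"
    and supp: "supp_on H I W" "supp_on I I S" "supp_on I I T"
    and iso: "mat_mul H (mat_adj W) W = id_on I"
    and V: "clip H I V = mat_mul I W S" and T: "mat_mul I S T = id_on I"
  shows "clip H H (orth_projector H (mat_app H I V ` extensional I)) = mat_mul I W (mat_adj W)"
proof (rule orth_projector_eqI[OF H])
  let ?P = "mat_mul I W (mat_adj W)"
  show "supp_on H H ?P" by (rule supp_on_mul[OF supp(1) supp_on_adj[OF supp(1)]])
  have "mat_mul I (mat_mul I W S) (mat_mul I T (mat_adj W)) = mat_mul I W (mat_mul I (mat_mul I S T) (mat_adj W))"
    by (simp only: mat_mul_assoc)
  then have P: "?P = mat_mul I (clip H I V) (mat_mul I T (mat_adj W))"
    by (simp add: V T mat_mul_id_left[OF I supp_on_adj[OF supp(1)]])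
  show "mat_app H H ?P x \<in> mat_app H I V ` extensional I" for x
    unfolding P mat_app_mul mat_app_clip by (intro imageI) (simp add: mat_app_def extensional_def)
  have "mat_mul H (mat_adj (clip H I V)) ?P = mat_mul I (mat_adj S) (mat_mul I (mat_mul H (mat_adj W) W) (mat_adj W))"
    unfolding V mat_adj_mul by (simp only: mat_mul_assoc)
  then have *: "mat_mul H (mat_adj (clip H I V)) ?P = mat_adj (clip H I V)"
    by (simp add: V mat_adj_mul iso mat_mul_id_left[OF I supp_on_adj[OF supp(1)]])
  show "vec_inner H w (\<lambda>i. x i - mat_app H H ?P x i) = 0"
    if "w \<in> mat_app H I V ` extensional I" for x w
  proof -
    obtain y where y: "w = mat_app H I (clip H I V) y" using \<open>w \<in> _\<close> by auto
    have "vec_inner H w (\<lambda>i. x i - mat_app H H ?P x i) = vec_inner H w x - vec_inner H w (mat_app H H ?P x)"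
      by (simp add: vec_inner_def sum_subtractf[symmetric] algebra_simps)
    also have "vec_inner H w (mat_app H H ?P x) = vec_inner I y (mat_app I H (mat_mul H (mat_adj (clip H I V)) ?P) x)"
      unfolding y mat_app_mul by (metis vec_inner_adj mat_adj_adj)
    also have "\<dots> = vec_inner H w x"
      unfolding * y by (metis vec_inner_adj mat_adj_adj)
    finally show ?thesis by simp
  qed
qed

text \<open>\<open>S\<close> is the root of \<open>\<rho>\<close> and \<open>T\<close> its inverse;
  \<open>W\<close> is an isometry because \<open>T \<rho> T = 1\<close>.\<close>

lemma polar_decomposition:
  fixes V :: "'h \<Rightarrow> 'i \<Rightarrow> complex"
  assumes H: "finite H" and I: "finite I" and inj: "inj_on (mat_app H I V) (extensional I)"
  defines "S \<equiv> clip I I (op_sqrt I (mat_mul H (mat_adj V) V))"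
  defines "T \<equiv> clip I I (op_inv I (op_sqrt I (mat_mul H (mat_adj V) V)))"
  defines "W \<equiv> mat_mul I (clip H I V) T"
  shows "supp_on H I W" "mat_mul H (mat_adj W) W = id_on I" "mat_mul I W S = clip H I V"
    "mat_mul I W (mat_adj W) = clip H H (orth_projector H (mat_app H I V ` extensional I))"
proof -
  note ST = op_sqrt_gram[OF H I inj, folded S_def T_def]
  have supp: "supp_on I I S" "supp_on I I T" by (simp_all add: S_def T_def)
  show W: "supp_on H I W" by (simp add: W_def supp_on_mul[OF supp_on_clip supp(2)])
  have "mat_mul H (mat_adj W) W = mat_mul I T (mat_mul I (mat_mul H (mat_adj (clip H I V)) (clip H I V)) T)"
    unfolding W_def mat_adj_mul ST by (simp only: mat_mul_assoc)
  also have "\<dots> = mat_mul I (mat_mul I T S) (mat_mul I S T)"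
    unfolding ST(5)[symmetric] by (simp only: mat_mul_assoc)
  finally show iso: "mat_mul H (mat_adj W) W = id_on I"
    by (simp add: ST mat_mul_id_left[OF I supp_on_id_on])
  show WS: "mat_mul I W S = clip H I V"
    by (simp add: W_def mat_mul_assoc ST mat_mul_id_right[OF I supp_on_clip])
  show "mat_mul I W (mat_adj W) = clip H H (orth_projector H (mat_app H I V ` extensional I))"
    using orth_projector_isometry[OF H I W supp iso WS[symmetric] ST(3)] by simp
qed

lemma op_norm_isometry_conj:
  assumes "finite H" "finite I" "mat_mul H (mat_adj W) W = id_on I"
  shows "op_norm H (mat_mul I W (mat_mul I E (mat_adj W))) \<le> op_norm I E"
proof (rule op_norm_le)
  have W: "op_bound H I W 1" using assms by (intro op_bound_isometry)
  show "op_bound H H (mat_mul I W (mat_mul I E (mat_adj W))) (op_norm I E)"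
    using op_bound_mul[OF W op_bound_mul[OF op_bound_op_norm[OF assms(2), of E]
        op_bound_adj[OF W] op_norm_nonneg[OF assms(2)]]] by simp
qed (simp_all add: assms op_norm_nonneg)

text \<open>Here \<open>\<tau>\<close> is the inverse of \<open>\<sigma>\<close>. Since
  \<open>W S = V\<close>, conjugating \<open>S \<tau> S - 1\<close> by the isometry \<open>W\<close>
  gives \<open>V \<tau> V\<^sup>\<dagger>\<close> minus the projector, without increasing the
  norm.\<close>

lemma inverse_approx_projector:
  fixes V :: "'h \<Rightarrow> 'i \<Rightarrow> complex"
  assumes H: "finite H" and I: "finite I" and inj: "inj_on (mat_app H I V) (extensional I)"
    and approx: "inverse_approx I \<epsilon> (mat_mul H (mat_adj V) V) \<sigma>"
    and \<tau>: "supp_on I I \<tau>" "mat_mul I (clip I I \<sigma>) \<tau> = id_on I" "mat_mul I \<tau> (clip I I \<sigma>) = id_on I"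
  shows "op_norm H (mat_diff (mat_mul I (clip H I V) (mat_mul I \<tau> (mat_adj (clip H I V))))
    (orth_projector H (mat_app H I V ` extensional I))) \<le> \<epsilon>"
proof -
  let ?\<rho> = "mat_mul H (mat_adj V) V" and ?V = "clip H I V"
  let ?P = "orth_projector H (mat_app H I V ` extensional I)"
  define S where "S = clip I I (op_sqrt I ?\<rho>)"
  define W where "W = mat_mul I ?V (clip I I (op_inv I (op_sqrt I ?\<rho>)))"
  note W = polar_decomposition[OF H I inj, folded S_def W_def]
  have S: "mat_adj S = S" unfolding S_def by (rule op_sqrt_gram(1)[OF H I inj])
  let ?E = "mat_diff (mat_mul I (mat_mul I S \<tau>) S) (id_on I)"
  have "?E = clip I I (mat_diff (mat_mul I (mat_mul I (op_sqrt I ?\<rho>) (op_inv I \<sigma>)) (op_sqrt I ?\<rho>)) mat_id)"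
    using clip_op_inv[OF I \<tau>]
    by (simp add: clip_diff id_on_def S_def flip: mat_mul_clip)
  then have E: "op_norm I ?E \<le> \<epsilon>"
    using approx by (simp add: inverse_approx_def)
  have "mat_mul I W (mat_mul I ?E (mat_adj W))
      = mat_diff (mat_mul I ?V (mat_mul I \<tau> (mat_adj ?V))) (clip H H ?P)"
    unfolding W(3,4)[symmetric] mat_adj_mul S mat_mul_diff_left mat_mul_diff_right
    using mat_mul_id_left[OF I supp_on_adj[OF W(1)]] by (simp add: mat_mul_assoc)
  then have "op_norm H (mat_diff (mat_mul I ?V (mat_mul I \<tau> (mat_adj ?V))) (clip H H ?P)) \<le> \<epsilon>"
    using op_norm_isometry_conj[OF H I W(2), of ?E] E by simp
  moreover have "op_norm H (mat_diff (mat_mul I ?V (mat_mul I \<tau> (mat_adj ?V))) (clip H H ?P))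
      = op_norm H (mat_diff (mat_mul I ?V (mat_mul I \<tau> (mat_adj ?V))) ?P)"
    by (rule op_norm_cong) (simp add: mat_diff_def clip_def)
  ultimately show ?thesis by simp
qed

lemma op_norm_orth_projector:
  fixes V :: "'h \<Rightarrow> 'i \<Rightarrow> complex"
  assumes H: "finite H" and I: "finite I" and inj: "inj_on (mat_app H I V) (extensional I)"
  shows "op_norm H (orth_projector H (mat_app H I V ` extensional I)) \<le> 1"
proof -
  note W = polar_decomposition[OF H I inj]
  note bd = op_bound_isometry[OF I W(2)]
  have "op_norm H (clip H H (orth_projector H (mat_app H I V ` extensional I))) \<le> 1"
    using op_bound_mul[OF bd op_bound_adj[OF bd]] unfolding W(4) by (intro op_norm_le[OF H]) auto
  then show ?thesis by simp
qed

text \<open>The witness \<open>T W\<^sup>\<dagger>\<close> is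
  \<open>\<rho>\<^sup>-\<^sup>1 V\<^sup>\<dagger>\<close>. Conjugating
  \<open>T \<sigma> T - 1\<close> by the isometry \<open>W\<close> gives
  \<open>L\<^sup>\<dagger> \<sigma> L\<close> minus the projector.\<close>

lemma direct_approx_projector:
  fixes V :: "'h \<Rightarrow> 'i \<Rightarrow> complex"
  assumes H: "finite H" and I: "finite I" and inj: "inj_on (mat_app H I V) (extensional I)"
    and approx: "direct_approx I \<epsilon> (mat_mul H (mat_adj V) V) \<sigma>"
  obtains L where "supp_on I H L" "mat_mul H L (clip H I V) = id_on I"
    "mat_mul I (clip H I V) L = clip H H (orth_projector H (mat_app H I V ` extensional I))"
    "op_norm H (mat_diff (mat_mul I (mat_adj L) (mat_mul I (clip I I \<sigma>) L))
      (orth_projector H (mat_app H I V ` extensional I))) \<le> \<epsilon>"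
proof -
  let ?\<rho> = "mat_mul H (mat_adj V) V" and ?V = "clip H I V"
  let ?P = "orth_projector H (mat_app H I V ` extensional I)"
  define S where "S = clip I I (op_sqrt I ?\<rho>)"
  define T where "T = clip I I (op_inv I (op_sqrt I ?\<rho>))"
  define W where "W = mat_mul I ?V T"
  note W = polar_decomposition[OF H I inj, folded S_def T_def, folded W_def]
  note ST = op_sqrt_gram[OF H I inj, folded S_def T_def]
  define L where "L = mat_mul I T (mat_adj W)"
  let ?E = "mat_diff (mat_mul I (mat_mul I T (clip I I \<sigma>)) T) (id_on I)"
  have "?E = clip I I (mat_diff (mat_mul I (mat_mul I (op_inv I (op_sqrt I ?\<rho>)) \<sigma>) (op_inv I (op_sqrt I ?\<rho>))) mat_id)"
    by (simp add: clip_diff id_on_def T_def flip: mat_mul_clip)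
  then have E: "op_norm I ?E \<le> \<epsilon>"
    using approx by (simp add: direct_approx_def)
  have "mat_mul I W (mat_mul I ?E (mat_adj W))
      = mat_diff (mat_mul I (mat_adj L) (mat_mul I (clip I I \<sigma>) L)) (clip H H ?P)"
    unfolding W(4)[symmetric] L_def mat_adj_mul ST mat_adj_adj mat_mul_diff_left mat_mul_diff_right
    using mat_mul_id_left[OF I supp_on_adj[OF W(1)]] by (simp add: mat_mul_assoc)
  then have F: "op_norm H (mat_diff (mat_mul I (mat_adj L) (mat_mul I (clip I I \<sigma>) L)) (clip H H ?P)) \<le> \<epsilon>"
    using op_norm_isometry_conj[OF H I W(2), of ?E] E by simp
  show ?thesis
  proof (rule that)
    show "supp_on I H L"
      unfolding L_def T_def by (rule supp_on_mul[OF supp_on_clip supp_on_adj[OF W(1)]])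
    have "mat_mul H L ?V = mat_mul I T (mat_mul I (mat_mul H (mat_adj W) W) S)"
      unfolding L_def W(3)[symmetric] by (simp only: mat_mul_assoc)
    moreover have "supp_on I I S" by (simp add: S_def)
    ultimately show "mat_mul H L ?V = id_on I"
      using mat_mul_id_left[OF I, of I S] by (simp add: W(2) ST)
    have "mat_mul I ?V L = mat_mul I W (mat_mul I (mat_mul I S T) (mat_adj W))"
      unfolding L_def W(3)[symmetric] by (simp only: mat_mul_assoc)
    then show "mat_mul I ?V L = clip H H ?P"
      using mat_mul_id_left[OF I supp_on_adj[OF W(1)]] by (simp add: ST W(4))
    have "op_norm H (mat_diff (mat_mul I (mat_adj L) (mat_mul I (clip I I \<sigma>) L)) ?P)
      = op_norm H (mat_diff (mat_mul I (mat_adj L) (mat_mul I (clip I I \<sigma>) L)) (clip H H ?P))"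
      by (rule op_norm_cong) (simp add: mat_diff_def clip_def)
    then show "op_norm H (mat_diff (mat_mul I (mat_adj L) (mat_mul I (clip I I \<sigma>) L)) ?P) \<le> \<epsilon>"
      using F by simp
  qed
qed

section \<open>Operators acting on part of the tensor factors\<close>

lemma finite_configs: "finite S \<Longrightarrow> finite (configs N S)"
  by (auto simp: configs_def intro: finite_PiE)

text \<open>Fixing a configuration \<open>w\<close> of the spectators decomposes the space into
  orthogonal blocks, on each of which the operator acts as \<open>K\<close>; squared norms add up
  over the blocks.\<close>

lemma op_norm_extend_op:
  assumes R: "finite R" and SR: "S \<subseteq> R"
  shows "op_norm (configs N R) (extend_op S R K) \<le> op_norm (configs N S) K"
proof -
  let ?C = "configs N R" and ?I = "configs N S" and ?J = "configs N (R - S)"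
  have S: "finite S" using R SR by (rule rev_finite_subset)
  have fin: "finite ?C" "finite ?I" "finite ?J"
    using R S by (auto simp: configs_def intro!: finite_PiE)
  \<comment> \<open>Joins a spectator configuration \<open>w\<close> and a configuration
    \<open>u\<close> of the factors acted upon.\<close>
  define g where "g w u = (\<lambda>s\<in>R. if s \<in> S then u s else w s)" for w u :: "'a \<Rightarrow> nat"
  have g: "g w u \<in> ?C" "restrict (g w u) S = u" "restrict (g w u) (R - S) = w"
    if "w \<in> ?J" "u \<in> ?I" for w u
    using that SR by (auto simp: g_def configs_def PiE_iff fun_eq_iff restrict_def extensional_def)
  have g_surj: "x = g (restrict x (R - S)) (restrict x S)" if "x \<in> ?C" for x
    using that SR by (auto simp: g_def configs_def PiE_iff fun_eq_iff restrict_def extensional_def)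
  have sum_C: "(\<Sum>x\<in>?C. F x) = (\<Sum>w\<in>?J. \<Sum>u\<in>?I. F (g w u))" for F :: "('a \<Rightarrow> nat) \<Rightarrow> 'b::comm_monoid_add"
  proof -
    have "(\<Sum>(w, u)\<in>?J \<times> ?I. F (g w u)) = (\<Sum>x\<in>?C. F x)"
    proof (rule sum.reindex_bij_witness[where i = "\<lambda>x. (restrict x (R - S), restrict x S)"
          and j = "\<lambda>(w, u). g w u"])
      show "(restrict x (R - S), restrict x S) \<in> ?J \<times> ?I" if "x \<in> ?C" for x
        using that SR by (auto simp: configs_def PiE_iff)
    qed (use g g_surj in \<open>auto simp: g_surj[symmetric]\<close>)
    then show ?thesis by (simp add: sum.cartesian_product)
  qed
  let ?c = "op_norm ?I K"
  have c: "0 \<le> ?c" by (rule op_norm_nonneg[OF fin(2)])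
  have "op_bound ?C ?C (extend_op S R K) ?c"
    unfolding op_bound_def
  proof
    fix f
    have app: "mat_app ?C ?C (extend_op S R K) f (g w u) = mat_app ?I ?I K (\<lambda>v. f (g w v)) u"
      if w: "w \<in> ?J" and u: "u \<in> ?I" for w u
    proof -
      have ext: "extend_op S R K (g w u) (g w' v) = K u v * of_bool (w' = w)"
        if w': "w' \<in> ?J" and v: "v \<in> ?I" for w' v
      proof -
        have "(\<forall>s\<in>R - S. g w u s = g w' v s) \<longleftrightarrow> restrict (g w u) (R - S) = restrict (g w' v) (R - S)"
          by (auto simp: fun_eq_iff restrict_def)
        then show ?thesis
          using g[OF w u] g[OF w' v] by (auto simp: extend_op_def)
      qed
      have "mat_app ?C ?C (extend_op S R K) f (g w u)
          = (\<Sum>w'\<in>?J. \<Sum>v\<in>?I. extend_op S R K (g w u) (g w' v) * f (g w' v))"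
        using g(1)[OF w u] by (simp add: mat_app_def sum_C)
      also have "\<dots> = (\<Sum>w'\<in>?J. if w' = w then \<Sum>v\<in>?I. K u v * f (g w v) else 0)"
        by (intro sum.cong refl) (simp add: ext)
      also have "\<dots> = mat_app ?I ?I K (\<lambda>v. f (g w v)) u"
        using w u fin by (simp add: mat_app_def)
      finally show ?thesis .
    qed
    have "(vec_norm ?C (mat_app ?C ?C (extend_op S R K) f))\<^sup>2
        = (\<Sum>w\<in>?J. (vec_norm ?I (mat_app ?I ?I K (\<lambda>v. f (g w v))))\<^sup>2)"
      by (simp add: vec_norm_power2 sum_C app)
    also have "\<dots> \<le> (\<Sum>w\<in>?J. (?c * vec_norm ?I (\<lambda>v. f (g w v)))\<^sup>2)"
      by (intro sum_mono power_mono op_boundD op_bound_op_norm fin) simp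
    also have "\<dots> = ?c\<^sup>2 * (\<Sum>w\<in>?J. (vec_norm ?I (\<lambda>v. f (g w v)))\<^sup>2)"
      by (simp add: power_mult_distrib sum_distrib_left)
    also have "\<dots> = (?c * vec_norm ?C f)\<^sup>2"
      by (simp add: vec_norm_power2 sum_C power_mult_distrib)
    finally show "vec_norm ?C (mat_app ?C ?C (extend_op S R K) f) \<le> ?c * vec_norm ?C f"
      using c by (simp add: power2_le_iff_abs_le)
  qed
  then show ?thesis using op_norm_le[OF fin(1) c] by blast
qed

section \<open>Kernels between different sets of tensor factors, with site-dependent
  dimensions\<close>

definition cfg :: "('s \<Rightarrow> nat) \<Rightarrow> 's set \<Rightarrow> ('s \<Rightarrow> nat) set"
  where "cfg n S = (\<Pi>\<^sub>E s\<in>S. {..<n s})"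

text \<open>
  A kernel \<open>K\<close> mapping the factors in \<open>S\<close> to those in \<open>T\<close>, tensored with the identity on \<open>R\<close>.
\<close>

definition local_op :: "('s \<Rightarrow> nat) \<Rightarrow> 's set \<Rightarrow> 's set \<Rightarrow> 's set
    \<Rightarrow> (('s \<Rightarrow> nat) \<Rightarrow> ('s \<Rightarrow> nat) \<Rightarrow> complex) \<Rightarrow> ('s \<Rightarrow> nat) \<Rightarrow> ('s \<Rightarrow> nat) \<Rightarrow> complex"
  where "local_op n T S R K = (\<lambda>x y.
    if x \<in> cfg n (T \<union> R) \<and> y \<in> cfg n (S \<union> R) \<and> (\<forall>r\<in>R. x r = y r)
    then K (restrict x T) (restrict y S) else 0)"

lemma finite_cfg [simp]: "finite S \<Longrightarrow> finite (cfg n S)"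
  by (auto simp: cfg_def intro: finite_PiE)

lemma cfg_empty [simp]: "cfg n {} = {\<lambda>_. undefined}"
  by (simp add: cfg_def)

lemma restrict_cfg: "x \<in> cfg n S \<Longrightarrow> T \<subseteq> S \<Longrightarrow> restrict x T \<in> cfg n T"
  by (auto simp: cfg_def PiE_iff)

lemma restrict_cfg_id [simp]: "x \<in> cfg n S \<Longrightarrow> restrict x S = x"
  by (auto simp: cfg_def PiE_iff extensional_restrict)

lemma supp_on_local_op: "supp_on (cfg n (T \<union> R)) (cfg n (S \<union> R)) (local_op n T S R K)"
  by (auto simp: supp_on_def local_op_def)

lemma local_op_cong:
  assumes "\<And>x y. x \<in> cfg n T \<Longrightarrow> y \<in> cfg n S \<Longrightarrow> K x y = M x y"
  shows "local_op n T S R K = local_op n T S R M"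
proof (intro ext)
  fix x y
  show "local_op n T S R K x y = local_op n T S R M x y"
    using assms restrict_cfg[of x n "T \<union> R" T] restrict_cfg[of y n "S \<union> R" S]
    by (simp add: local_op_def)
qed

lemma local_op_nest: "local_op n (T \<union> R') (S \<union> R') R (local_op n T S R' K) = local_op n T S (R' \<union> R) K"
proof (intro ext)
  fix x y
  have *: "x \<in> cfg n (T \<union> R' \<union> R) \<Longrightarrow> restrict x (T \<union> R') \<in> cfg n (T \<union> R')"
    "y \<in> cfg n (S \<union> R' \<union> R) \<Longrightarrow> restrict y (S \<union> R') \<in> cfg n (S \<union> R')"
    by (auto intro: restrict_cfg)
  have **: "restrict (restrict x (T \<union> R')) T = restrict x T" "restrict (restrict y (S \<union> R')) S = restrict y S"
    by (auto simp: restrict_def)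
  show "local_op n (T \<union> R') (S \<union> R') R (local_op n T S R' K) x y = local_op n T S (R' \<union> R) K x y"
    using * ** by (auto simp: local_op_def Un_assoc)
qed

lemma mat_adj_local_op: "mat_adj (local_op n T S R K) = local_op n S T R (mat_adj K)"
  by (auto simp: mat_adj_def local_op_def fun_eq_iff)

lemma local_op_id: "local_op n S S R (id_on (cfg n S)) = id_on (cfg n (S \<union> R))"
proof (intro ext)
  fix x y
  have "restrict x S = restrict y S \<and> (\<forall>r\<in>R. x r = y r) \<longleftrightarrow> x = y"
    if "x \<in> cfg n (S \<union> R)" "y \<in> cfg n (S \<union> R)"
  proof
    assume *: "restrict x S = restrict y S \<and> (\<forall>r\<in>R. x r = y r)"
    have "x s = y s" for s
    proof -
      consider "s \<in> S" | "s \<in> R" | "s \<notin> S \<union> R" by blast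
      then show ?thesis
      proof cases
        case 1
        then show ?thesis using * by (metis restrict_apply')
      next
        case 3
        then show ?thesis using that by (auto simp: cfg_def PiE_iff extensional_def)
      qed (use * in blast)
    qed
    then show "x = y" by blast
  qed auto
  moreover have "x \<in> cfg n (S \<union> R) \<Longrightarrow> restrict x S \<in> cfg n S" for x
    by (auto intro: restrict_cfg)
  ultimately show "local_op n S S R (id_on (cfg n S)) x y = id_on (cfg n (S \<union> R)) x y"
    by (auto simp: local_op_def id_on_def clip_def mat_id_def)
qed

text \<open>An intermediate configuration must copy \<open>x\<close> on \<open>R1\<close> and
  \<open>y\<close> on \<open>R2\<close>, so only its part on \<open>S \<inter> T'\<close> is free.
  Later products are special cases: in \<open>local_op_mul\<close> everything between the kernels is
  contracted, in \<open>local_op_commute\<close> nothing, and in the gluing of regions exactly the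
  common bonds.\<close>

lemma local_op_mul_apply:
  assumes fin: "finite (S \<union> R1)"
    and disj: "S \<inter> R1 = {}" "T' \<inter> R2 = {}" and mid: "S \<union> R1 = T' \<union> R2"
    and x: "x \<in> cfg n (T \<union> R1)" and y: "y \<in> cfg n (S' \<union> R2)"
  shows "mat_mul (cfg n (S \<union> R1)) (local_op n T S R1 K) (local_op n T' S' R2 M) x y =
    (if \<forall>r\<in>R1 \<inter> R2. x r = y r then
      (\<Sum>m\<in>cfg n (S \<inter> T'). K (restrict x T) (\<lambda>s\<in>S. if s \<in> T' then m s else y s) *
        M (\<lambda>s\<in>T'. if s \<in> S then m s else x s) (restrict y S')) else 0)"
proof -
  let ?F = "\<lambda>w. local_op n T S R1 K x w * local_op n T' S' R2 M w y"
  have F: "?F w = (if (\<forall>r\<in>R1. x r = w r) \<and> (\<forall>r\<in>R2. w r = y r)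
      then K (restrict x T) (restrict w S) * M (restrict w T') (restrict y S') else 0)"
    if "w \<in> cfg n (S \<union> R1)" for w
    using x y that mid by (simp add: local_op_def)
  show ?thesis
  proof (cases "\<forall>r\<in>R1 \<inter> R2. x r = y r")
    case False
    then have "?F w = 0" if "w \<in> cfg n (S \<union> R1)" for w
      using F[OF that] by auto
    then have "mat_mul (cfg n (S \<union> R1)) (local_op n T S R1 K) (local_op n T' S' R2 M) x y = 0"
      unfolding mat_mul_def by (rule sum.neutral[OF ballI])
    then show ?thesis unfolding if_not_P[OF False] .
  next
    case True
    \<comment> \<open>The only intermediate configuration that extends \<open>m\<close> and gives a
      possibly nonzero summand.\<close>
    define g where "g m = (\<lambda>s\<in>S \<union> R1. if s \<in> S \<inter> T' then m s else if s \<in> R1 then x s else y s)" for m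
    have S_diff: "s \<in> R2" if "s \<in> S" "s \<notin> T'" for s using that mid by blast
    have g_cfg: "g m \<in> cfg n (S \<union> R1)" if "m \<in> cfg n (S \<inter> T')" for m
      using that x y S_diff by (auto simp: g_def cfg_def PiE_iff)
    have g_restrict: "restrict (g m) (S \<inter> T') = m" if "m \<in> cfg n (S \<inter> T')" for m
      using that by (auto simp: g_def cfg_def PiE_iff fun_eq_iff extensional_def)
    have g_surj: "w = g (restrict w (S \<inter> T'))"
      if "w \<in> cfg n (S \<union> R1)" "\<forall>r\<in>R1. x r = w r" "\<forall>r\<in>R2. w r = y r" for w
      using that S_diff by (auto simp: g_def cfg_def PiE_iff fun_eq_iff extensional_def)
    have "mat_mul (cfg n (S \<union> R1)) (local_op n T S R1 K) (local_op n T' S' R2 M) x y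
        = (\<Sum>w\<in>g ` cfg n (S \<inter> T'). ?F w)"
      unfolding mat_mul_def
    proof (rule sum.mono_neutral_right)
      show "\<forall>w\<in>cfg n (S \<union> R1) - g ` cfg n (S \<inter> T'). ?F w = 0"
      proof
        fix w assume w: "w \<in> cfg n (S \<union> R1) - g ` cfg n (S \<inter> T')"
        have "restrict w (S \<inter> T') \<in> cfg n (S \<inter> T')"
          using w by (intro restrict_cfg[of w n "S \<union> R1"]) auto
        then have "\<not> ((\<forall>r\<in>R1. x r = w r) \<and> (\<forall>r\<in>R2. w r = y r))"
          using g_surj w by blast
        then show "?F w = 0" using F w by auto
      qed
    qed (use fin g_cfg in auto)
    also have "\<dots> = (\<Sum>m\<in>cfg n (S \<inter> T'). ?F (g m))"
      by (rule sum.reindex_cong[of g]) (auto intro: inj_on_inverseI g_restrict)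
    also have "\<dots> = (\<Sum>m\<in>cfg n (S \<inter> T'). K (restrict x T) (\<lambda>s\<in>S. if s \<in> T' then m s else y s) *
        M (\<lambda>s\<in>T'. if s \<in> S then m s else x s) (restrict y S'))"
    proof (rule sum.cong)
      fix m assume m: "m \<in> cfg n (S \<inter> T')"
      have "\<forall>r\<in>R1. x r = g m r" "\<forall>r\<in>R2. g m r = y r"
        using disj mid True by (auto simp: g_def)
      moreover have "restrict (g m) S = (\<lambda>s\<in>S. if s \<in> T' then m s else y s)"
        using disj by (auto simp: g_def fun_eq_iff restrict_def)
      moreover have "restrict (g m) T' = (\<lambda>s\<in>T'. if s \<in> S then m s else x s)"
        using disj mid by (auto simp: g_def fun_eq_iff restrict_def)
      ultimately show "?F (g m) = K (restrict x T) (\<lambda>s\<in>S. if s \<in> T' then m s else y s) *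
          M (\<lambda>s\<in>T'. if s \<in> S then m s else x s) (restrict y S')"
        using F[OF g_cfg[OF m]] by simp
    qed simp
    finally show ?thesis using True by simp
  qed
qed

lemma local_op_mul:
  assumes "finite S" "finite R" "S \<inter> R = {}"
  shows "mat_mul (cfg n (S \<union> R)) (local_op n T S R K) (local_op n S S' R M)
    = local_op n T S' R (mat_mul (cfg n S) K M)"
proof (rule supp_on_eqI[OF supp_on_mul[OF supp_on_local_op supp_on_local_op] supp_on_local_op])
  fix x y assume xy: "x \<in> cfg n (T \<union> R)" "y \<in> cfg n (S' \<union> R)"
  have *: "(\<lambda>s\<in>S. if s \<in> S then m s else z s) = m" if "m \<in> cfg n S" for m z :: "'a \<Rightarrow> nat"
    using that by (auto simp: fun_eq_iff cfg_def PiE_iff extensional_def)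
  show "mat_mul (cfg n (S \<union> R)) (local_op n T S R K) (local_op n S S' R M) x y
      = local_op n T S' R (mat_mul (cfg n S) K M) x y"
    using assms xy by (subst local_op_mul_apply) (auto simp: * local_op_def mat_mul_def)
qed

text \<open>Neither kernel reads what the other one writes, so in both orders the contraction runs
  over the single configuration of the empty set and gives the product of the two kernel entries.
  Each kernel may change the set of factors, so the operators on the two sides differ in their
  identity parts.\<close>

lemma local_op_commute:
  assumes fin: "finite S" "finite T" "finite S'" "finite T'" "finite R"
    and disj: "S \<inter> R = {}" "T \<inter> R = {}" "S' \<inter> R = {}" "T' \<inter> R = {}" "S \<inter> T' = {}" "T \<inter> S' = {}"
  shows "mat_mul (cfg n (S \<union> (T' \<union> R))) (local_op n T S (T' \<union> R) K) (local_op n T' S' (S \<union> R) M)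
    = mat_mul (cfg n (S' \<union> (T \<union> R))) (local_op n T' S' (T \<union> R) M) (local_op n T S (S' \<union> R) K)"
proof -
  have comm: "T' \<union> (T \<union> R) = T \<union> (T' \<union> R)" "S \<union> (S' \<union> R) = S' \<union> (S \<union> R)" by auto
  note supp = supp_on_mul[OF supp_on_local_op supp_on_local_op]
  have "supp_on (cfg n (T \<union> (T' \<union> R))) (cfg n (S' \<union> (S \<union> R)))
      (mat_mul (cfg n (S' \<union> (T \<union> R))) (local_op n T' S' (T \<union> R) M) (local_op n T S (S' \<union> R) K))"
    unfolding comm[symmetric] by (rule supp)
  then show ?thesis
  proof (rule supp_on_eqI[OF supp])
    fix x y assume xy: "x \<in> cfg n (T \<union> (T' \<union> R))" "y \<in> cfg n (S' \<union> (S \<union> R))"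
    have eqs: "(T' \<union> R) \<inter> (S \<union> R) = R" "(T \<union> R) \<inter> (S' \<union> R) = R"
      using disj by auto
    have disj': "S' \<inter> T = {}" "T' \<inter> S = {}"
      using disj by auto
    have res: "(\<lambda>s\<in>U. if s \<in> U' then m s else z s) = restrict z U" if "U \<inter> U' = {}"
      for U U' and m z :: "'a \<Rightarrow> nat"
      using that by (auto simp: fun_eq_iff)
    have "mat_mul (cfg n (S \<union> (T' \<union> R))) (local_op n T S (T' \<union> R) K) (local_op n T' S' (S \<union> R) M) x y
        = (if \<forall>r\<in>R. x r = y r then K (restrict x T) (restrict y S) * M (restrict x T') (restrict y S') else 0)"
      using disj disj' fin xy
      by (subst local_op_mul_apply) (auto simp: eqs res)
    moreover have "mat_mul (cfg n (S' \<union> (T \<union> R))) (local_op n T' S' (T \<union> R) M) (local_op n T S (S' \<union> R) K) x y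
        = (if \<forall>r\<in>R. x r = y r then M (restrict x T') (restrict y S') * K (restrict x T) (restrict y S) else 0)"
      using disj disj' fin xy
      by (subst local_op_mul_apply) (auto simp: eqs res comm)
    ultimately show "mat_mul (cfg n (S \<union> (T' \<union> R))) (local_op n T S (T' \<union> R) K) (local_op n T' S' (S \<union> R) M) x y
        = mat_mul (cfg n (S' \<union> (T \<union> R))) (local_op n T' S' (T \<union> R) M) (local_op n T S (S' \<union> R) K) x y"
      by simp
  qed
qed

text \<open>Transports an operator to a common site type along the embeddings \<open>i\<close> of
  its row sites and \<open>j\<close> of its column sites.\<close>

definition lift :: "('v \<Rightarrow> 's) \<Rightarrow> ('w \<Rightarrow> 's) \<Rightarrow> (('v \<Rightarrow> nat) \<Rightarrow> ('w \<Rightarrow> nat) \<Rightarrow> complex)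
    \<Rightarrow> ('s \<Rightarrow> nat) \<Rightarrow> ('s \<Rightarrow> nat) \<Rightarrow> complex"
  where "lift i j K = (\<lambda>x y. K (x \<circ> i) (y \<circ> j))"

lemma bij_betw_cfg:
  assumes i: "inj i" and n: "n \<circ> i = (\<lambda>_. N)"
  shows "bij_betw (\<lambda>x. x \<circ> i) (cfg n (i ` S)) (configs N S)"
proof (rule bij_betw_byWitness[where f' = "\<lambda>c. \<lambda>s\<in>i ` S. c (inv i s)"])
  have n': "n (i s) = N" for s using fun_cong[OF n, of s] by simp
  show "\<forall>x\<in>cfg n (i ` S). (\<lambda>s\<in>i ` S. (x \<circ> i) (inv i s)) = x"
    using i by (auto simp: cfg_def PiE_iff fun_eq_iff extensional_def)
  show "\<forall>c\<in>configs N S. (\<lambda>s\<in>i ` S. c (inv i s)) \<circ> i = c"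
    using i by (auto simp: configs_def PiE_iff fun_eq_iff extensional_def inj_image_mem_iff)
  show "(\<lambda>x. x \<circ> i) ` cfg n (i ` S) \<subseteq> configs N S"
    using i n' by (fastforce simp: cfg_def configs_def PiE_iff extensional_def inj_image_mem_iff)
  show "(\<lambda>c. \<lambda>s\<in>i ` S. c (inv i s)) ` configs N S \<subseteq> cfg n (i ` S)"
    using i n' by (auto simp: cfg_def configs_def PiE_iff)
qed

lemma mat_mul_lift:
  assumes "inj j" "n \<circ> j = (\<lambda>_. N)"
  shows "mat_mul (cfg n (j ` S)) (lift i j K) (lift j k M) = lift i k (mat_mul (configs N S) K M)"
proof (intro ext)
  fix x y
  show "mat_mul (cfg n (j ` S)) (lift i j K) (lift j k M) x y = lift i k (mat_mul (configs N S) K M) x y"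
    using sum.reindex_bij_betw[OF bij_betw_cfg[OF assms], of "\<lambda>c. K (x \<circ> i) c * M c (y \<circ> k)"]
    by (simp add: mat_mul_def lift_def)
qed

lemma mat_adj_lift: "mat_adj (lift i j K) = lift j i (mat_adj K)"
  by (simp add: mat_adj_def lift_def)

lemma lift_extend_op:
  assumes i: "inj i" and n: "n \<circ> i = (\<lambda>_. N)" and SR: "S \<subseteq> R"
  shows "clip (cfg n (i ` R)) (cfg n (i ` R)) (lift i i (extend_op S R K))
    = local_op n (i ` S) (i ` S) (i ` (R - S)) (lift i i K)"
proof -
  have "i ` S \<union> i ` (R - S) = i ` R" using SR by auto
  moreover have "restrict x (i ` S) \<circ> i = restrict (x \<circ> i) S" for x :: "'b \<Rightarrow> nat"
    using i by (auto simp: fun_eq_iff restrict_def inj_image_mem_iff)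
  ultimately show ?thesis
    by (intro ext) (auto simp: clip_def lift_def local_op_def extend_op_def)
qed

text \<open>The way back: an identity between transported operators yields one between the original
  entries.\<close>

lemma lift_clip_inject:
  assumes "clip (cfg n (i ` S)) (cfg n (i ` S)) (lift i i K) = clip (cfg n (i ` S)) (cfg n (i ` S)) (lift i i M)"
    and "inj i" "n \<circ> i = (\<lambda>_. N)" and "x \<in> configs N S" "y \<in> configs N S"
  shows "K x y = M x y"
proof -
  have surj: "\<exists>u\<in>cfg n (i ` S). u \<circ> i = w" if "w \<in> configs N S" for w
    using bij_betw_imp_surj_on[OF bij_betw_cfg[OF assms(2,3), of S], symmetric] that by auto
  obtain u w where "u \<in> cfg n (i ` S)" "w \<in> cfg n (i ` S)" "u \<circ> i = x" "w \<circ> i = y"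
    using surj assms(4,5) by blast
  then show ?thesis
    using fun_cong[OF fun_cong[OF assms(1), of u], of w] by (simp add: clip_def lift_def)
qed

lemma lift_id_on:
  assumes "inj i" "n \<circ> i = (\<lambda>_. N)" "x \<in> cfg n (i ` S)" "y \<in> cfg n (i ` S)"
  shows "lift i i mat_id x y = id_on (cfg n (i ` S)) x y"
  using bij_betw_imp_inj_on[OF bij_betw_cfg[OF assms(1,2), of S]] assms(3,4)
  by (auto simp: lift_def mat_id_def id_on_def clip_def dest: inj_onD)

lemma cfg_comp:
  assumes "inj i" "n \<circ> i = (\<lambda>_. N)" "x \<in> cfg n (i ` S)"
  shows "x \<circ> i \<in> configs N S"
  using bij_betw_imp_surj_on[OF bij_betw_cfg[OF assms(1,2), of S]] assms(3) by blast

lemma local_op_lift_cong: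
  assumes i: "inj i" "n \<circ> i = (\<lambda>_. N)" and j: "inj j" "n \<circ> j = (\<lambda>_. N')"
    and "\<And>x y. x \<in> configs N S \<Longrightarrow> y \<in> configs N' F \<Longrightarrow> K x y = M x y"
  shows "local_op n (i ` S) (j ` F) R (lift i j K) = local_op n (i ` S) (j ` F) R (lift i j M)"
proof (rule local_op_cong)
  fix x y assume "x \<in> cfg n (i ` S)" "y \<in> cfg n (j ` F)"
  then show "lift i j K x y = lift i j M x y"
    using cfg_comp[OF i] cfg_comp[OF j] assms(5) by (simp add: lift_def)
qed

lemma local_op_lift_mul:
  assumes j: "inj j" "n \<circ> j = (\<lambda>_. N)" and fin: "finite F" "finite R" and disj: "j ` F \<inter> R = {}"
  shows "mat_mul (cfg n (j ` F \<union> R)) (local_op n T (j ` F) R (lift i j K)) (local_op n (j ` F) S R (lift j k M))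
    = local_op n T S R (lift i k (mat_mul (configs N F) K M))"
  by (subst local_op_mul) (use fin disj in \<open>auto simp: mat_mul_lift[OF j]\<close>)

lemma local_op_lift_inverse:
  assumes i: "inj i" "n \<circ> i = (\<lambda>_. N)" and j: "inj j" "n \<circ> j = (\<lambda>_. N')"
    and fin: "finite F" "finite R" and disj: "j ` F \<inter> R = {}"
    and inv: "\<And>x y. x \<in> configs N S \<Longrightarrow> y \<in> configs N S \<Longrightarrow> mat_mul (configs N' F) K M x y = mat_id x y"
  shows "mat_mul (cfg n (j ` F \<union> R)) (local_op n (i ` S) (j ` F) R (lift i j K))
      (local_op n (j ` F) (i ` S) R (lift j i M)) = id_on (cfg n (i ` S \<union> R))"
proof -
  have "mat_mul (cfg n (j ` F \<union> R)) (local_op n (i ` S) (j ` F) R (lift i j K))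
      (local_op n (j ` F) (i ` S) R (lift j i M))
    = local_op n (i ` S) (i ` S) R (lift i i (mat_mul (configs N' F) K M))"
    by (rule local_op_lift_mul) (use j fin disj in auto)
  also have "\<dots> = local_op n (i ` S) (i ` S) R (lift i i mat_id)"
    by (rule local_op_lift_cong) (use i inv in auto)
  also have "\<dots> = local_op n (i ` S) (i ` S) R (id_on (cfg n (i ` S)))"
    by (rule local_op_cong) (rule lift_id_on[OF i])
  finally show ?thesis by (simp add: local_op_id)
qed

lemma local_op_lift_extend_op:
  assumes i: "inj i" "n \<circ> i = (\<lambda>_. N)" and SF: "S \<subseteq> F"
  shows "local_op n (i ` F) (i ` F) R (lift i i (extend_op S F K))
    = local_op n (i ` S) (i ` S) (i ` (F - S) \<union> R) (lift i i K)"
proof -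
  have "local_op n (i ` F) (i ` F) R (lift i i (extend_op S F K))
      = local_op n (i ` F) (i ` F) R (clip (cfg n (i ` F)) (cfg n (i ` F)) (lift i i (extend_op S F K)))"
    by (rule local_op_cong) (simp add: clip_def)
  also have "\<dots> = local_op n (i ` F) (i ` F) R (local_op n (i ` S) (i ` S) (i ` (F - S)) (lift i i K))"
    using lift_extend_op[OF i SF] by simp
  also have "\<dots> = local_op n (i ` S) (i ` S) (i ` (F - S) \<union> R) (lift i i K)"
    using local_op_nest[of n "i ` S" "i ` (F - S)" "i ` S" R "lift i i K"] SF
    by (simp add: Un_absorb1 flip: image_Un)
  finally show ?thesis .
qed

text \<open>Rewrites operators of the shape of \<open>Q\<^sub>X\<close> and \<open>G\<close> as
  products of local operators on the common sites, which is the form in which commutation can be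
  applied.\<close>

lemma local_op_lift_sandwich:
  fixes k :: "'w \<Rightarrow> 's" and i :: "'v \<Rightarrow> 's" and V :: "('w \<Rightarrow> nat) \<Rightarrow> ('v \<Rightarrow> nat) \<Rightarrow> complex" and \<Lambda> :: "'w set"
  assumes i: "inj i" "n \<circ> i = (\<lambda>_. N)" and SF: "S \<subseteq> F" "S' \<subseteq> F"
    and fin: "finite F" "finite R" and disj: "i ` F \<inter> R = {}"
  defines "X \<equiv> cfg n (i ` F \<union> R)" and "I \<equiv> configs N F" and "V' \<equiv> local_op n (k ` \<Lambda>) (i ` F) R (lift k i V)"
  shows "local_op n (k ` \<Lambda>) (k ` \<Lambda>) R (lift k k
      (mat_mul I V (mat_mul I (mat_mul I (extend_op S F K) (extend_op S' F K')) (mat_adj V))))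
    = mat_mul X V' (mat_mul X (mat_mul X (local_op n (i ` S) (i ` S) (i ` (F - S) \<union> R) (lift i i K))
        (local_op n (i ` S') (i ` S') (i ` (F - S') \<union> R) (lift i i K'))) (mat_adj V'))"
proof -
  note mul = local_op_lift_mul[OF i fin disj, symmetric]
  have "mat_adj V' = local_op n (i ` F) (k ` \<Lambda>) R (lift i k (mat_adj V))"
    by (simp add: V'_def mat_adj_local_op mat_adj_lift)
  then show ?thesis
    unfolding X_def I_def V'_def
    using local_op_lift_extend_op[OF i SF(1)] local_op_lift_extend_op[OF i SF(2)]
    by (simp only: mul)
qed

lemma extend_op_inverse:
  assumes "finite R" "S \<subseteq> R" "is_mat_inverse (configs N S) K M"
  shows "mat_mul (configs N R) (clip (configs N R) (configs N R) (extend_op S R K))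
    (clip (configs N R) (configs N R) (extend_op S R M)) = id_on (configs N R)"
proof -
  have S: "finite S" using assms by (auto intro: rev_finite_subset)
  have cfg: "configs N T = cfg (\<lambda>_. N) T" for T :: "'a set"
    by (simp add: configs_def cfg_def)
  have R: "R = S \<union> (R - S)" using assms by auto
  have ext: "clip (configs N R) (configs N R) (extend_op S R K) = local_op (\<lambda>_. N) S S (R - S) K" for K
    using lift_extend_op[of id "\<lambda>_. N" N S R K] assms(2) by (simp add: cfg lift_def)
  have "mat_mul (configs N R) (local_op (\<lambda>_. N) S S (R - S) K) (local_op (\<lambda>_. N) S S (R - S) M)
      = local_op (\<lambda>_. N) S S (R - S) (mat_mul (cfg (\<lambda>_. N) S) K M)"
    using local_op_mul[of S "R - S" "\<lambda>_. N" S K S M] R S assms(1) by (simp add: cfg)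
  also have "\<dots> = local_op (\<lambda>_. N) S S (R - S) (id_on (cfg (\<lambda>_. N) S))"
    using assms(3) by (intro local_op_cong) (simp add: is_mat_inverse_def mat_eq_on_def cfg id_on_def clip_def)
  also have "\<dots> = id_on (configs N R)"
    using R by (simp add: local_op_id cfg)
  finally show ?thesis by (simp add: ext)
qed

lemma is_mat_inverse_commute: "is_mat_inverse I M N \<longleftrightarrow> is_mat_inverse I N M"
  by (auto simp: is_mat_inverse_def)

lemma extend_op_product_inverse:
  assumes R: "finite R" and S: "S \<subseteq> R" "is_mat_inverse (configs N S) K M"
    and S': "S' \<subseteq> R" "is_mat_inverse (configs N S') K' M'"
  defines "I \<equiv> configs N R"
  shows "mat_mul I (clip I I (mat_mul I (extend_op S R K) (extend_op S' R K')))
      (clip I I (mat_mul I (extend_op S' R M') (extend_op S R M))) = id_on I"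
proof -
  note inv = extend_op_inverse[OF R S, folded I_def] extend_op_inverse[OF R S', folded I_def]
  have fin: "finite I" unfolding I_def by (rule finite_configs[OF R])
  let ?k = "clip I I (extend_op S R K)" and ?k' = "clip I I (extend_op S' R K')"
    and ?m = "clip I I (extend_op S R M)" and ?m' = "clip I I (extend_op S' R M')"
  have "mat_mul I (mat_mul I ?k ?k') (mat_mul I ?m' ?m) = mat_mul I ?k (mat_mul I (mat_mul I ?k' ?m') ?m)"
    by (simp only: mat_mul_assoc)
  also have "\<dots> = id_on I"
    unfolding inv mat_mul_id_left[OF fin supp_on_clip] ..
  finally show ?thesis by (simp add: mat_mul_clip)
qed

section \<open>Contraction of PEPS tensors\<close>

definition touching :: "'v peps \<Rightarrow> 'v set \<Rightarrow> 'v set set"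
  where "touching \<Gamma> \<Lambda> = inner_edges \<Gamma> \<Lambda> \<union> bdry \<Gamma> \<Lambda>"

lemma peps_edge:
  assumes "is_peps \<Gamma>" "e \<in> edges \<Gamma>"
  shows "e \<subseteq> verts \<Gamma>" "card e = 2" "finite e" "e \<noteq> {}"
  using assms by (auto simp: is_peps_def intro: card_ge_0_finite)

lemma touching_eq: "is_peps \<Gamma> \<Longrightarrow> touching \<Gamma> \<Lambda> = {e \<in> edges \<Gamma>. e \<inter> \<Lambda> \<noteq> {}}"
  using peps_edge(4) by (fastforce simp: touching_def inner_edges_def bdry_def)

lemma finite_touching:
  assumes "is_peps \<Gamma>" "finite \<Lambda>" "\<Lambda> \<subseteq> verts \<Gamma>"
  shows "finite (touching \<Gamma> \<Lambda>)"
proof -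
  have "touching \<Gamma> \<Lambda> \<subseteq> (\<Union>v\<in>\<Lambda>. incident \<Gamma> v)"
    using assms by (auto simp: touching_eq incident_def)
  then show ?thesis
    by (rule finite_subset) (use assms in \<open>auto simp: is_peps_def\<close>)
qed

lemma finite_bdry: "is_peps \<Gamma> \<Longrightarrow> finite \<Lambda> \<Longrightarrow> \<Lambda> \<subseteq> verts \<Gamma> \<Longrightarrow> finite (bdry \<Gamma> \<Lambda>)"
  using finite_touching by (fastforce simp: touching_def)

lemma max_entangled_const:
  assumes "finite e" "e \<noteq> {}" "j < D" "\<And>v. v \<in> e \<Longrightarrow> k v = j"
  shows "max_entangled D e k = 1 / complex_of_real (sqrt (real D))"
proof -
  have "(\<Prod>v\<in>e. of_bool (k v = i)) = (of_bool (i = j) :: complex)" for i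
    using assms by (cases "i = j") (auto intro!: prod.neutral)
  then show ?thesis using assms(3) by (simp add: max_entangled_def)
qed

lemma max_entangled_nonzero:
  assumes "finite e" "max_entangled D e k \<noteq> 0"
  obtains j where "j < D" "\<And>v. v \<in> e \<Longrightarrow> k v = j"
proof -
  have "(\<Sum>j<D. \<Prod>v\<in>e. of_bool (k v = j)) \<noteq> (0 :: complex)"
    using assms(2) by (auto simp: max_entangled_def)
  then obtain j where "j \<in> {..<D}" "(\<Prod>v\<in>e. of_bool (k v = j)) \<noteq> (0 :: complex)"
    by (rule sum.not_neutral_contains_not_neutral)
  then show ?thesis
    using assms(1) that by (auto simp: prod_zero_iff)
qed

text \<open>The entangled vectors force the two half-edges of an edge to carry the same index, and
  the boundary vector fixes that index on boundary edges. What remains is a sum over indices of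
  inner edges, with one factor \<open>D\<^sup>-\<^sup>1\<^sup>/\<^sup>2\<close> per edge.\<close>

lemma peps_map_edge_sum:
  assumes \<Gamma>: "is_peps \<Gamma>" and \<Lambda>: "finite \<Lambda>" "\<Lambda> \<subseteq> verts \<Gamma>" and x: "x \<in> bond_configs \<Gamma> (bdry \<Gamma> \<Lambda>)"
  shows "peps_map \<Gamma> \<Lambda> s x = (1 / complex_of_real (sqrt (real (bond_dim \<Gamma>)))) ^ card (touching \<Gamma> \<Lambda>) *
    (\<Sum>k\<in>bond_configs \<Gamma> (inner_edges \<Gamma> \<Lambda>). \<Prod>v\<in>\<Lambda>.
      tensor \<Gamma> v (s v) (\<lambda>e\<in>incident \<Gamma> v. if e \<in> inner_edges \<Gamma> \<Lambda> then k e else x e))"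
proof -
  let ?D = "bond_dim \<Gamma>" and ?E = "inner_edges \<Gamma> \<Lambda>" and ?c = "1 / complex_of_real (sqrt (real (bond_dim \<Gamma>)))"
  have fin_t: "finite (touching \<Gamma> \<Lambda>)" by (rule finite_touching[OF \<Gamma> \<Lambda>])
  have fin_b: "finite (bdry \<Gamma> \<Lambda>)" by (rule finite_bdry[OF \<Gamma> \<Lambda>])
  have edge: "e \<in> edges \<Gamma>" if "e \<in> touching \<Gamma> \<Lambda>" for e
    using that by (auto simp: touching_def inner_edges_def bdry_def)
  have he: "half_edges \<Gamma> \<Lambda> = {(v, e). e \<in> touching \<Gamma> \<Lambda> \<and> v \<in> e}"
    by (simp add: half_edges_def touching_def)
  have fin_h: "finite (half_edges \<Gamma> \<Lambda>)"
  proof (rule finite_subset)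
    show "half_edges \<Gamma> \<Lambda> \<subseteq> \<Union>(touching \<Gamma> \<Lambda>) \<times> touching \<Gamma> \<Lambda>" by (auto simp: he)
    show "finite (\<Union>(touching \<Gamma> \<Lambda>) \<times> touching \<Gamma> \<Lambda>)"
      using fin_t edge peps_edge(3)[OF \<Gamma>] by blast
  qed
  have bdry_not_inner: "e \<notin> ?E" if "e \<in> bdry \<Gamma> \<Lambda>" for e
    using that by (auto simp: bdry_def inner_edges_def)
  let ?F = "\<lambda>h. (\<Prod>e\<in>bdry \<Gamma> \<Lambda>. \<Prod>v\<in>e - \<Lambda>. of_bool (x e = h (v, e))) *
      (\<Prod>v\<in>\<Lambda>. tensor \<Gamma> v (s v) (\<lambda>e\<in>incident \<Gamma> v. h (v, e))) *
      (\<Prod>e\<in>touching \<Gamma> \<Lambda>. max_entangled ?D e (\<lambda>v\<in>e. h (v, e)))"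
  define val where "val k e = (if e \<in> ?E then k e else x e)" for k e
  define g where "g k = (\<lambda>(v, e)\<in>half_edges \<Gamma> \<Lambda>. val k e)" for k
  have val_less: "val k e < ?D" if "k \<in> bond_configs \<Gamma> ?E" "e \<in> touching \<Gamma> \<Lambda>" for k e
    using that x by (auto simp: val_def touching_def configs_def PiE_iff)
  have g_cfg: "g k \<in> configs ?D (half_edges \<Gamma> \<Lambda>)" if "k \<in> bond_configs \<Gamma> ?E" for k
    using val_less[OF that] by (auto simp: g_def configs_def he)
  have g_apply: "g k (v, e) = val k e" if "e \<in> touching \<Gamma> \<Lambda>" "v \<in> e" for k v e
    using that by (simp add: g_def he)
  \<comment> \<open>Any endpoint serves to read off the index of an edge: labellings that are not
    constant along every edge contribute 0.\<close>
  define some_end where "some_end e = (SOME v. v \<in> e)" for e :: "'a set"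
  have some_end: "some_end e \<in> e" if "e \<in> touching \<Gamma> \<Lambda>" for e
    unfolding some_end_def using peps_edge(4)[OF \<Gamma> edge[OF that]] by (simp add: some_in_eq)
  define k_of where "k_of h = (\<lambda>e\<in>?E. h (some_end e, e))" for h :: "'a \<times> 'a set \<Rightarrow> nat"
  have inner_touch: "e \<in> touching \<Gamma> \<Lambda>" if "e \<in> ?E" for e using that by (simp add: touching_def)
  have k_of_g: "k_of (g k) = k" if "k \<in> bond_configs \<Gamma> ?E" for k
    using that some_end[OF inner_touch] inner_touch
    by (auto simp: k_of_def g_apply val_def fun_eq_iff configs_def PiE_iff extensional_def)
  have inj: "inj_on g (bond_configs \<Gamma> ?E)"
    by (rule inj_on_inverseI[where g = k_of]) (rule k_of_g)
  have zero: "?F h = 0" if h: "h \<in> configs ?D (half_edges \<Gamma> \<Lambda>) - g ` bond_configs \<Gamma> ?E" for h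
  proof (rule ccontr)
    assume nz: "?F h \<noteq> 0"
    have const: "h (v, e) = h (w, e)" if "e \<in> touching \<Gamma> \<Lambda>" "v \<in> e" "w \<in> e" for e v w
    proof -
      have fin_e: "finite e" by (rule peps_edge(3)[OF \<Gamma> edge[OF that(1)]])
      have "max_entangled ?D e (\<lambda>v\<in>e. h (v, e)) \<noteq> 0"
        using nz fin_t that(1) by auto
      then obtain j where "\<And>v. v \<in> e \<Longrightarrow> (\<lambda>v\<in>e. h (v, e)) v = j"
        using max_entangled_nonzero[OF fin_e] by metis
      from this[OF that(2)] this[OF that(3)] that show ?thesis by simp
    qed
    have outer: "h (v, e) = x e" if "e \<in> bdry \<Gamma> \<Lambda>" "v \<in> e - \<Lambda>" for e v
    proof -
      have "finite (e - \<Lambda>)"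
        using peps_edge(3)[OF \<Gamma>] that by (auto simp: bdry_def)
      moreover have "(\<Prod>v\<in>e - \<Lambda>. of_bool (x e = h (v, e))) \<noteq> (0 :: complex)"
        using nz fin_b that(1) by auto
      ultimately show ?thesis using that by auto
    qed
    have "k_of h \<in> bond_configs \<Gamma> ?E"
      using h some_end inner_touch by (auto simp: k_of_def configs_def he PiE_iff)
    moreover have "h = g (k_of h)"
    proof
      fix p :: "'a \<times> 'a set"
      obtain v e where p: "p = (v, e)" by force
      show "h p = g (k_of h) p"
      proof (cases "p \<in> half_edges \<Gamma> \<Lambda>")
        case True
        then have ve: "e \<in> touching \<Gamma> \<Lambda>" "v \<in> e" by (auto simp: he p)
        show ?thesis
        proof (cases "e \<in> ?E")
          case True
          then show ?thesis
            using const[OF ve some_end[OF ve(1)]] by (simp add: p g_apply[OF ve] val_def k_of_def)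
        next
          case False
          then have b: "e \<in> bdry \<Gamma> \<Lambda>" using ve by (simp add: touching_def)
          \<comment> \<open>The endpoint outside the region, where the boundary vector fixes the
            index.\<close>
          then obtain w where w: "w \<in> e - \<Lambda>" by (auto simp: bdry_def)
          then show ?thesis
            using const[OF ve, of w] outer[OF b w] False by (simp add: p g_apply[OF ve] val_def)
        qed
      next
        case False
        then show ?thesis
          using h by (auto simp: p g_def configs_def PiE_iff extensional_def)
      qed
    qed
    ultimately show False using h by blast
  qed
  have F_g: "?F (g k) = ?c ^ card (touching \<Gamma> \<Lambda>) * (\<Prod>v\<in>\<Lambda>. tensor \<Gamma> v (s v) (\<lambda>e\<in>incident \<Gamma> v. val k e))"
    if k: "k \<in> bond_configs \<Gamma> ?E" for k
  proof -
    have "(\<Prod>e\<in>bdry \<Gamma> \<Lambda>. \<Prod>v\<in>e - \<Lambda>. of_bool (x e = g k (v, e))) = (1 :: complex)"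
    proof (intro prod.neutral ballI)
      fix e v assume "e \<in> bdry \<Gamma> \<Lambda>" "v \<in> e - \<Lambda>"
      then show "of_bool (x e = g k (v, e)) = (1 :: complex)"
        using g_apply[of e v k] bdry_not_inner[of e] by (simp add: touching_def val_def)
    qed
    moreover have "(\<lambda>e\<in>incident \<Gamma> v. g k (v, e)) = (\<lambda>e\<in>incident \<Gamma> v. val k e)" if "v \<in> \<Lambda>" for v
      using that by (intro restrict_ext g_apply) (auto simp: touching_eq[OF \<Gamma>] incident_def)
    moreover have "max_entangled ?D e (\<lambda>v\<in>e. g k (v, e)) = ?c" if "e \<in> touching \<Gamma> \<Lambda>" for e
      using peps_edge(3,4)[OF \<Gamma> edge[OF that]] val_less[OF k that]
      by (rule max_entangled_const) (simp add: g_apply that)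
    ultimately show ?thesis by simp
  qed
  have "peps_map \<Gamma> \<Lambda> s x = (\<Sum>h\<in>configs ?D (half_edges \<Gamma> \<Lambda>). ?F h)"
    by (simp add: peps_map_def touching_def)
  also have "\<dots> = (\<Sum>h\<in>g ` bond_configs \<Gamma> ?E. ?F h)"
    by (rule sum.mono_neutral_right) (use zero g_cfg finite_configs[OF fin_h] in auto)
  also have "\<dots> = (\<Sum>k\<in>bond_configs \<Gamma> ?E. ?F (g k))"
    by (rule sum.reindex_cong[OF inj]) auto
  also have "\<dots> = (\<Sum>k\<in>bond_configs \<Gamma> ?E. ?c ^ card (touching \<Gamma> \<Lambda>) *
      (\<Prod>v\<in>\<Lambda>. tensor \<Gamma> v (s v) (\<lambda>e\<in>incident \<Gamma> v. val k e)))"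
    by (rule sum.cong[OF refl F_g])
  finally show ?thesis by (simp add: sum_distrib_left val_def)
qed

section \<open>Gluing disjoint regions along their common bonds\<close>

lemma bdry_Un:
  assumes "is_peps \<Gamma>" "\<Lambda>1 \<inter> \<Lambda>2 = {}"
  shows "bdry \<Gamma> (\<Lambda>1 \<union> \<Lambda>2) = (bdry \<Gamma> \<Lambda>1 - bdry \<Gamma> \<Lambda>2) \<union> (bdry \<Gamma> \<Lambda>2 - bdry \<Gamma> \<Lambda>1)"
    and "inner_edges \<Gamma> (\<Lambda>1 \<union> \<Lambda>2) = inner_edges \<Gamma> \<Lambda>1 \<union> inner_edges \<Gamma> \<Lambda>2 \<union> (bdry \<Gamma> \<Lambda>1 \<inter> bdry \<Gamma> \<Lambda>2)"
proof -
  have edge: "\<exists>u v. e = {u, v}" if "e \<in> edges \<Gamma>" for e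
    using peps_edge(2)[OF assms(1) that] by (auto simp: card_2_iff)
  show "bdry \<Gamma> (\<Lambda>1 \<union> \<Lambda>2) = (bdry \<Gamma> \<Lambda>1 - bdry \<Gamma> \<Lambda>2) \<union> (bdry \<Gamma> \<Lambda>2 - bdry \<Gamma> \<Lambda>1)"
    using assms(2) edge unfolding bdry_def by fastforce
  show "inner_edges \<Gamma> (\<Lambda>1 \<union> \<Lambda>2) = inner_edges \<Gamma> \<Lambda>1 \<union> inner_edges \<Gamma> \<Lambda>2 \<union> (bdry \<Gamma> \<Lambda>1 \<inter> bdry \<Gamma> \<Lambda>2)"
    using assms(2) edge unfolding bdry_def inner_edges_def by fastforce
qed

text \<open>Common bonds are inner edges of the union, so their indices are summed. In the product
  each of them contributes \<open>D\<^sup>-\<^sup>1\<^sup>/\<^sup>2\<close> twice, in the union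
  once; the power of the root of \<open>D\<close> corrects this.\<close>

lemma peps_map_Un:
  assumes \<Gamma>: "is_peps \<Gamma>" and \<Lambda>1: "finite \<Lambda>1" "\<Lambda>1 \<subseteq> verts \<Gamma>" and \<Lambda>2: "finite \<Lambda>2" "\<Lambda>2 \<subseteq> verts \<Gamma>"
    and disj: "\<Lambda>1 \<inter> \<Lambda>2 = {}" and x: "x \<in> bond_configs \<Gamma> (bdry \<Gamma> (\<Lambda>1 \<union> \<Lambda>2))"
  defines "\<gamma> \<equiv> bdry \<Gamma> \<Lambda>1 \<inter> bdry \<Gamma> \<Lambda>2"
  shows "peps_map \<Gamma> (\<Lambda>1 \<union> \<Lambda>2) s x = complex_of_real (sqrt (real (bond_dim \<Gamma>))) ^ card \<gamma> *
    (\<Sum>m\<in>bond_configs \<Gamma> \<gamma>.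
      peps_map \<Gamma> \<Lambda>1 s (\<lambda>e\<in>bdry \<Gamma> \<Lambda>1. if e \<in> \<gamma> then m e else x e) *
      peps_map \<Gamma> \<Lambda>2 s (\<lambda>e\<in>bdry \<Gamma> \<Lambda>2. if e \<in> \<gamma> then m e else x e))"
proof -
  let ?q = "complex_of_real (sqrt (real (bond_dim \<Gamma>)))"
  let ?E1 = "inner_edges \<Gamma> \<Lambda>1" and ?E2 = "inner_edges \<Gamma> \<Lambda>2" and ?E = "inner_edges \<Gamma> (\<Lambda>1 \<union> \<Lambda>2)"
  let ?t1 = "touching \<Gamma> \<Lambda>1" and ?t2 = "touching \<Gamma> \<Lambda>2" and ?t = "touching \<Gamma> (\<Lambda>1 \<union> \<Lambda>2)"
  let ?C = "bond_configs \<Gamma>"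
  have q: "?q \<noteq> 0" using \<Gamma> by (simp add: is_peps_def)
  have \<Lambda>: "finite (\<Lambda>1 \<union> \<Lambda>2)" "\<Lambda>1 \<union> \<Lambda>2 \<subseteq> verts \<Gamma>" using \<Lambda>1 \<Lambda>2 by auto
  have b: "bdry \<Gamma> (\<Lambda>1 \<union> \<Lambda>2) = (bdry \<Gamma> \<Lambda>1 - \<gamma>) \<union> (bdry \<Gamma> \<Lambda>2 - \<gamma>)"
    and E: "?E = ?E1 \<union> ?E2 \<union> \<gamma>"
    using bdry_Un[OF \<Gamma> disj] by (auto simp: \<gamma>_def)
  have E_disj: "?E1 \<inter> ?E2 = {}" "?E1 \<inter> bdry \<Gamma> \<Lambda>1 = {}" "?E2 \<inter> bdry \<Gamma> \<Lambda>2 = {}"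
    using disj peps_edge(4)[OF \<Gamma>] by (fastforce simp: inner_edges_def bdry_def)+
  have E\<gamma>: "?E1 \<inter> \<gamma> = {}" "?E2 \<inter> \<gamma> = {}" using E_disj by (auto simp: \<gamma>_def)
  have E1b2: "?E1 \<inter> bdry \<Gamma> \<Lambda>2 = {}" "?E2 \<inter> bdry \<Gamma> \<Lambda>1 = {}"
    using disj by (auto simp: inner_edges_def bdry_def)
  have t: "?t = ?t1 \<union> ?t2" by (auto simp: touching_eq[OF \<Gamma>])
  have "?t1 \<inter> ?t2 = \<gamma>"
    using E_disj E1b2 by (auto simp: touching_def \<gamma>_def)
  then have card: "card ?t1 + card ?t2 = card ?t + card \<gamma>"
    using card_Un_Int[OF finite_touching[OF \<Gamma> \<Lambda>1] finite_touching[OF \<Gamma> \<Lambda>2]] t by simp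
  have x1: "(\<lambda>e\<in>bdry \<Gamma> \<Lambda>1. if e \<in> \<gamma> then m e else x e) \<in> ?C (bdry \<Gamma> \<Lambda>1)"
    and x2: "(\<lambda>e\<in>bdry \<Gamma> \<Lambda>2. if e \<in> \<gamma> then m e else x e) \<in> ?C (bdry \<Gamma> \<Lambda>2)"
    if "m \<in> ?C \<gamma>" for m
    using that x b by (auto simp: configs_def PiE_iff)
  define w where "w v e m k1 k2 = (if e \<in> \<gamma> then m e else if e \<in> ?E1 then k1 e else if e \<in> ?E2 then k2 e else x e)"
    for v :: 'a and e and m k1 k2 :: "'a set \<Rightarrow> nat"
  let ?T = "\<lambda>v m k1 k2. tensor \<Gamma> v (s v) (\<lambda>e\<in>incident \<Gamma> v. w v e m k1 k2)"
  \<comment> \<open>\<open>?mk\<close> and its inverse \<open>?sp\<close> identify a labelling of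
    the inner edges of the union with three labellings: of the common bonds and of the inner edges
    of either region.\<close>
  let ?mk = "\<lambda>(m, k1, k2). \<lambda>e\<in>?E. if e \<in> \<gamma> then m e else if e \<in> ?E1 then k1 e else k2 e"
  let ?sp = "\<lambda>k. (restrict k \<gamma>, restrict k ?E1, restrict k ?E2)"
  let ?G = "\<lambda>k. \<Prod>v\<in>\<Lambda>1 \<union> \<Lambda>2. tensor \<Gamma> v (s v) (\<lambda>e\<in>incident \<Gamma> v. if e \<in> ?E then k e else x e)"
  have sp_mk: "?sp (?mk p) = p" if "p \<in> ?C \<gamma> \<times> ?C ?E1 \<times> ?C ?E2" for p
    using that E E_disj E\<gamma>
    by (auto simp: configs_def PiE_iff fun_eq_iff restrict_def extensional_def)
  have mk_sp: "?mk (?sp k) = k" if "k \<in> ?C ?E" for k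
    using that E by (auto simp: configs_def PiE_iff fun_eq_iff restrict_def extensional_def)
  have "bij_betw ?mk (?C \<gamma> \<times> ?C ?E1 \<times> ?C ?E2) (?C ?E)"
  proof (rule bij_betw_byWitness[where f' = ?sp])
    show "?mk ` (?C \<gamma> \<times> ?C ?E1 \<times> ?C ?E2) \<subseteq> ?C ?E"
      using E by (auto simp: configs_def PiE_iff)
    show "?sp ` ?C ?E \<subseteq> ?C \<gamma> \<times> ?C ?E1 \<times> ?C ?E2"
      using E by (auto simp: configs_def PiE_iff)
  qed (use sp_mk mk_sp in blast)+
  then have "(\<Sum>k\<in>?C ?E. ?G k) = (\<Sum>p\<in>?C \<gamma> \<times> ?C ?E1 \<times> ?C ?E2. ?G (?mk p))"
    by (rule sum.reindex_bij_betw[symmetric])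
  also have "\<dots> = (\<Sum>(m, k1, k2)\<in>?C \<gamma> \<times> ?C ?E1 \<times> ?C ?E2. (\<Prod>v\<in>\<Lambda>1. ?T v m k1 k2) * (\<Prod>v\<in>\<Lambda>2. ?T v m k1 k2))"
  proof (rule sum.cong[OF refl])
    fix p assume "p \<in> ?C \<gamma> \<times> ?C ?E1 \<times> ?C ?E2"
    obtain m k1 k2 where p: "p = (m, k1, k2)" by (cases p)
    have "?G (?mk p) = (\<Prod>v\<in>\<Lambda>1 \<union> \<Lambda>2. ?T v m k1 k2)"
      using E by (intro prod.cong refl arg_cong[where f = "tensor \<Gamma> _ _"] restrict_ext) (auto simp: p w_def)
    also have "\<dots> = (\<Prod>v\<in>\<Lambda>1. ?T v m k1 k2) * (\<Prod>v\<in>\<Lambda>2. ?T v m k1 k2)"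
      using \<Lambda>1 \<Lambda>2 disj by (intro prod.union_disjoint) auto
    finally show "?G (?mk p) = (case p of (m, k1, k2) \<Rightarrow> (\<Prod>v\<in>\<Lambda>1. ?T v m k1 k2) * (\<Prod>v\<in>\<Lambda>2. ?T v m k1 k2))"
      by (simp add: p)
  qed
  also have "\<dots> = (\<Sum>m\<in>?C \<gamma>. \<Sum>k1\<in>?C ?E1. \<Sum>k2\<in>?C ?E2. (\<Prod>v\<in>\<Lambda>1. ?T v m k1 k2) * (\<Prod>v\<in>\<Lambda>2. ?T v m k1 k2))"
    by (simp add: sum.cartesian_product)
  finally have sum_E: "(\<Sum>k\<in>?C ?E. ?G k)
      = (\<Sum>m\<in>?C \<gamma>. \<Sum>k1\<in>?C ?E1. \<Sum>k2\<in>?C ?E2. (\<Prod>v\<in>\<Lambda>1. ?T v m k1 k2) * (\<Prod>v\<in>\<Lambda>2. ?T v m k1 k2))" .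
  have T1: "(\<lambda>e\<in>incident \<Gamma> v. if e \<in> ?E1 then k1 e else (\<lambda>e\<in>bdry \<Gamma> \<Lambda>1. if e \<in> \<gamma> then m e else x e) e)
      = (\<lambda>e\<in>incident \<Gamma> v. w v e m k1 k2)" if "v \<in> \<Lambda>1" for v m k1 k2
  proof (rule restrict_ext)
    fix e assume "e \<in> incident \<Gamma> v"
    then have "e \<in> ?t1" using that by (auto simp: touching_eq[OF \<Gamma>] incident_def)
    then show "(if e \<in> ?E1 then k1 e else (\<lambda>e\<in>bdry \<Gamma> \<Lambda>1. if e \<in> \<gamma> then m e else x e) e) = w v e m k1 k2"
      using E_disj E1b2 E\<gamma> by (auto simp: touching_def w_def)
  qed
  have T2: "(\<lambda>e\<in>incident \<Gamma> v. if e \<in> ?E2 then k2 e else (\<lambda>e\<in>bdry \<Gamma> \<Lambda>2. if e \<in> \<gamma> then m e else x e) e)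
      = (\<lambda>e\<in>incident \<Gamma> v. w v e m k1 k2)" if "v \<in> \<Lambda>2" for v m k1 k2
  proof (rule restrict_ext)
    fix e assume "e \<in> incident \<Gamma> v"
    then have "e \<in> ?t2" using that by (auto simp: touching_eq[OF \<Gamma>] incident_def)
    then show "(if e \<in> ?E2 then k2 e else (\<lambda>e\<in>bdry \<Gamma> \<Lambda>2. if e \<in> \<gamma> then m e else x e) e) = w v e m k1 k2"
      using E_disj E1b2 E\<gamma> by (auto simp: touching_def w_def)
  qed
  have summand: "peps_map \<Gamma> \<Lambda>1 s (\<lambda>e\<in>bdry \<Gamma> \<Lambda>1. if e \<in> \<gamma> then m e else x e) *
      peps_map \<Gamma> \<Lambda>2 s (\<lambda>e\<in>bdry \<Gamma> \<Lambda>2. if e \<in> \<gamma> then m e else x e)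
    = (1 / ?q) ^ (card ?t1 + card ?t2) *
      (\<Sum>k1\<in>?C ?E1. \<Sum>k2\<in>?C ?E2. (\<Prod>v\<in>\<Lambda>1. ?T v m k1 k2) * (\<Prod>v\<in>\<Lambda>2. ?T v m k1 k2))"
    if m: "m \<in> ?C \<gamma>" for m
  proof -
    let ?k0 = "\<lambda>_. undefined"
    \<comment> \<open>Tensors of one region never read the inner edges of the other, so a dummy
      labelling may stand there; the double sum then splits into a product of sums.\<close>
    have ind1: "?T v m k1 k2 = ?T v m k1 ?k0" if "v \<in> \<Lambda>1" for v k1 k2
      using T1[OF that, of k1 m k2] T1[OF that, of k1 m ?k0] by simp
    have ind2: "?T v m k1 k2 = ?T v m ?k0 k2" if "v \<in> \<Lambda>2" for v k1 k2
      using T2[OF that, of k2 m k1] T2[OF that, of k2 m ?k0] by simp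
    have "peps_map \<Gamma> \<Lambda>1 s (\<lambda>e\<in>bdry \<Gamma> \<Lambda>1. if e \<in> \<gamma> then m e else x e)
        = (1 / ?q) ^ card ?t1 * (\<Sum>k1\<in>?C ?E1. \<Prod>v\<in>\<Lambda>1. ?T v m k1 ?k0)"
      unfolding peps_map_edge_sum[OF \<Gamma> \<Lambda>1 x1[OF m]]
      by (rule arg_cong2[where f = "(*)", OF refl], rule sum.cong[OF refl], rule prod.cong[OF refl])
        (erule T1[THEN arg_cong])
    moreover have "peps_map \<Gamma> \<Lambda>2 s (\<lambda>e\<in>bdry \<Gamma> \<Lambda>2. if e \<in> \<gamma> then m e else x e)
        = (1 / ?q) ^ card ?t2 * (\<Sum>k2\<in>?C ?E2. \<Prod>v\<in>\<Lambda>2. ?T v m ?k0 k2)"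
      unfolding peps_map_edge_sum[OF \<Gamma> \<Lambda>2 x2[OF m]]
      by (rule arg_cong2[where f = "(*)", OF refl], rule sum.cong[OF refl], rule prod.cong[OF refl])
        (erule T2[THEN arg_cong])
    moreover have "(\<Sum>k1\<in>?C ?E1. \<Sum>k2\<in>?C ?E2. (\<Prod>v\<in>\<Lambda>1. ?T v m k1 k2) * (\<Prod>v\<in>\<Lambda>2. ?T v m k1 k2))
        = (\<Sum>k1\<in>?C ?E1. \<Sum>k2\<in>?C ?E2. (\<Prod>v\<in>\<Lambda>1. ?T v m k1 ?k0) * (\<Prod>v\<in>\<Lambda>2. ?T v m ?k0 k2))"
      by (intro sum.cong refl arg_cong2[where f = "(*)"] prod.cong ind1 ind2)
    ultimately show ?thesis
      by (simp only: sum_product power_add mult_ac)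
  qed
  have scal: "(1 / ?q) ^ card ?t = ?q ^ card \<gamma> * (1 / ?q) ^ (card ?t1 + card ?t2)"
    unfolding card power_add using q by (simp add: power_one_over)
  show ?thesis
    unfolding peps_map_edge_sum[OF \<Gamma> \<Lambda> x] sum_E scal
    by (simp add: summand sum_distrib_left mult.assoc)
qed

text \<open>The common site type: \<open>Inl v\<close> is the physical factor of a vertex,
  \<open>Inr e\<close> the bond factor of an edge. Both kinds must coexist because the contraction
  maps send bonds to physical factors together with other bonds.\<close>

definition site_dim :: "'v peps \<Rightarrow> 'v + 'v set \<Rightarrow> nat"
  where "site_dim \<Gamma> = case_sum (\<lambda>_. phys_dim \<Gamma>) (\<lambda>_. bond_dim \<Gamma>)"

lemma site_dim_comp: "site_dim \<Gamma> \<circ> Inl = (\<lambda>_. phys_dim \<Gamma>)" "site_dim \<Gamma> \<circ> Inr = (\<lambda>_. bond_dim \<Gamma>)"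
  by (auto simp: site_dim_def)

text \<open>
  The tensor of \<open>\<Lambda>\<close> with its legs on the bonds \<open>\<gamma>\<close> turned into outputs. The scalar compensates
  for the bonds in \<open>\<gamma>\<close> being counted in two regions.
\<close>

definition glue :: "'v peps \<Rightarrow> 'v set set \<Rightarrow> 'v set \<Rightarrow> ('v + 'v set \<Rightarrow> nat) \<Rightarrow> ('v + 'v set \<Rightarrow> nat) \<Rightarrow> complex"
  where "glue \<Gamma> \<gamma> \<Lambda> x y = complex_of_real (sqrt (real (bond_dim \<Gamma>))) ^ card \<gamma> *
    peps_map \<Gamma> \<Lambda> (x \<circ> Inl) (\<lambda>e\<in>bdry \<Gamma> \<Lambda>. if e \<in> \<gamma> then x (Inr e) else y (Inr e))"

lemma peps_map_cong:
  assumes "\<And>v. v \<in> \<Lambda> \<Longrightarrow> s v = s' v" "\<And>e. e \<in> bdry \<Gamma> \<Lambda> \<Longrightarrow> x e = x' e"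
  shows "peps_map \<Gamma> \<Lambda> s x = peps_map \<Gamma> \<Lambda> s' x'"
  unfolding peps_map_def using assms by (simp cong: prod.cong)

text \<open>The contracted factors are exactly the common bonds \<open>\<gamma>\<close>, so
  \<open>local_op_mul_apply\<close> reduces to \<open>peps_map_Un\<close>. It yields all four
  factorizations of the overview; \<open>\<Lambda>3\<close> is the remaining rectangle, or empty for
  the whole region. The sets enter through equations so that differently written unions
  match.\<close>

lemma local_op_peps_map_Un:
  assumes \<Gamma>: "is_peps \<Gamma>" and \<Lambda>1: "finite \<Lambda>1" "\<Lambda>1 \<subseteq> verts \<Gamma>" and \<Lambda>2: "finite \<Lambda>2" "\<Lambda>2 \<subseteq> verts \<Gamma>"
    and disj: "\<Lambda>1 \<inter> \<Lambda>2 = {}" and \<Lambda>3: "finite \<Lambda>3" "\<Lambda>2 \<inter> \<Lambda>3 = {}"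
    and \<Lambda>: "\<Lambda> = \<Lambda>1 \<union> \<Lambda>2" and \<gamma>: "\<gamma> = bdry \<Gamma> \<Lambda>1 \<inter> bdry \<Gamma> \<Lambda>2"
    and F: "F = bdry \<Gamma> \<Lambda>2 - \<gamma>"
    and R1: "R1 = Inl ` (\<Lambda>2 \<union> \<Lambda>3)" and R2: "R2 = Inl ` \<Lambda>3 \<union> Inr ` (bdry \<Gamma> \<Lambda>1 - \<gamma>)"
    and X: "X = Inr ` bdry \<Gamma> \<Lambda>1 \<union> R1"
  shows "local_op (site_dim \<Gamma>) (Inl ` \<Lambda>) (Inr ` bdry \<Gamma> \<Lambda>) (Inl ` \<Lambda>3) (lift Inl Inr (peps_map \<Gamma> \<Lambda>))
    = mat_mul (cfg (site_dim \<Gamma>) X)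
      (local_op (site_dim \<Gamma>) (Inl ` \<Lambda>1) (Inr ` bdry \<Gamma> \<Lambda>1) R1 (lift Inl Inr (peps_map \<Gamma> \<Lambda>1)))
      (local_op (site_dim \<Gamma>) (Inl ` \<Lambda>2 \<union> Inr ` \<gamma>) (Inr ` F) R2 (glue \<Gamma> \<gamma> \<Lambda>2))"
    (is "?lhs = mat_mul _ ?M1 ?M2")
proof -
  let ?n = "site_dim \<Gamma>" and ?b = "bdry \<Gamma> \<Lambda>" and ?b1 = "bdry \<Gamma> \<Lambda>1" and ?b2 = "bdry \<Gamma> \<Lambda>2"
  let ?S = "Inr ` ?b1 :: ('a + 'a set) set" and ?T' = "Inl ` \<Lambda>2 \<union> Inr ` \<gamma>"
  let ?q = "complex_of_real (sqrt (real (bond_dim \<Gamma>))) ^ card \<gamma>"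
  have b: "?b = (?b1 - \<gamma>) \<union> F"
    using bdry_Un(1)[OF \<Gamma> disj] by (auto simp: \<Lambda> \<gamma> F)
  have rows: "Inl ` \<Lambda>1 \<union> R1 = Inl ` \<Lambda> \<union> Inl ` \<Lambda>3" by (auto simp: R1 \<Lambda>)
  have cols: "Inr ` F \<union> R2 = Inr ` ?b \<union> Inl ` \<Lambda>3" by (auto simp: R2 b)
  have fin: "finite (?S \<union> R1)"
    using \<Lambda>2 \<Lambda>3 finite_bdry[OF \<Gamma> \<Lambda>1] by (simp add: R1)
  have S_disj: "?S \<inter> R1 = {}" "?T' \<inter> R2 = {}" "?S \<union> R1 = ?T' \<union> R2"
    using \<Lambda>3(2) by (auto simp: R1 R2 \<gamma>)
  have RR: "R1 \<inter> R2 = Inl ` \<Lambda>3" "?S \<inter> ?T' = Inr ` \<gamma>"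
    by (auto simp: R1 R2 \<gamma>)
  have supp: "supp_on (cfg ?n (Inl ` \<Lambda> \<union> Inl ` \<Lambda>3)) (cfg ?n (Inr ` ?b \<union> Inl ` \<Lambda>3)) (mat_mul (cfg ?n X) ?M1 ?M2)"
    unfolding rows[symmetric] cols[symmetric] by (rule supp_on_mul[OF supp_on_local_op supp_on_local_op])
  show ?thesis
  proof (rule supp_on_eqI[OF supp_on_local_op supp])
    fix x y
    assume x: "x \<in> cfg ?n (Inl ` \<Lambda> \<union> Inl ` \<Lambda>3)" and y: "y \<in> cfg ?n (Inr ` ?b \<union> Inl ` \<Lambda>3)"
    define ym where "ym m = (\<lambda>s\<in>?S. if s \<in> ?T' then m s else y s)" for m
    define xm where "xm m = (\<lambda>s\<in>?T'. if s \<in> ?S then m s else x s)" for m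
    define c where "c = y \<circ> Inr"
    have c: "c \<in> bond_configs \<Gamma> ?b"
      using y unfolding c_def cfg_def configs_def PiE_iff extensional_def
      by (force simp: site_dim_def)
    have "mat_mul (cfg ?n X) ?M1 ?M2 x y = (if \<forall>r\<in>Inl ` \<Lambda>3. x r = y r then
        (\<Sum>m\<in>cfg ?n (Inr ` \<gamma>). lift Inl Inr (peps_map \<Gamma> \<Lambda>1) (restrict x (Inl ` \<Lambda>1)) (ym m) *
          glue \<Gamma> \<gamma> \<Lambda>2 (xm m) (restrict y (Inr ` F))) else 0)"
      using local_op_mul_apply[OF fin S_disj x[folded rows] y[folded cols],
          of "lift Inl Inr (peps_map \<Gamma> \<Lambda>1)" "glue \<Gamma> \<gamma> \<Lambda>2"]
      by (simp only: X RR ym_def xm_def)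
    moreover have "(\<Sum>m\<in>cfg ?n (Inr ` \<gamma>). lift Inl Inr (peps_map \<Gamma> \<Lambda>1) (restrict x (Inl ` \<Lambda>1)) (ym m) *
          glue \<Gamma> \<gamma> \<Lambda>2 (xm m) (restrict y (Inr ` F)))
        = lift Inl Inr (peps_map \<Gamma> \<Lambda>) (restrict x (Inl ` \<Lambda>)) (restrict y (Inr ` ?b))"
    proof -
      have term1: "lift Inl Inr (peps_map \<Gamma> \<Lambda>1) (restrict x (Inl ` \<Lambda>1)) (ym m)
          = peps_map \<Gamma> \<Lambda>1 (x \<circ> Inl) (\<lambda>e\<in>?b1. if e \<in> \<gamma> then (m \<circ> Inr) e else c e)" for m
        unfolding lift_def by (rule peps_map_cong) (auto simp: ym_def c_def)
      have term2: "glue \<Gamma> \<gamma> \<Lambda>2 (xm m) (restrict y (Inr ` F))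
          = ?q * peps_map \<Gamma> \<Lambda>2 (x \<circ> Inl) (\<lambda>e\<in>?b2. if e \<in> \<gamma> then (m \<circ> Inr) e else c e)" for m
        unfolding glue_def
        by (intro arg_cong2[where f = "(*)"] refl peps_map_cong) (auto simp: xm_def c_def \<gamma> F)
      have "lift Inl Inr (peps_map \<Gamma> \<Lambda>) (restrict x (Inl ` \<Lambda>)) (restrict y (Inr ` ?b))
          = peps_map \<Gamma> (\<Lambda>1 \<union> \<Lambda>2) (x \<circ> Inl) c"
        unfolding lift_def \<Lambda> by (rule peps_map_cong) (auto simp: c_def)
      also have "\<dots> = ?q * (\<Sum>m\<in>bond_configs \<Gamma> \<gamma>.
          peps_map \<Gamma> \<Lambda>1 (x \<circ> Inl) (\<lambda>e\<in>?b1. if e \<in> \<gamma> then m e else c e) *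
          peps_map \<Gamma> \<Lambda>2 (x \<circ> Inl) (\<lambda>e\<in>?b2. if e \<in> \<gamma> then m e else c e))"
        unfolding \<gamma> by (rule peps_map_Un[OF \<Gamma> \<Lambda>1 \<Lambda>2 disj c[unfolded \<Lambda>]])
      also have "\<dots> = ?q * (\<Sum>m\<in>cfg ?n (Inr ` \<gamma>).
          peps_map \<Gamma> \<Lambda>1 (x \<circ> Inl) (\<lambda>e\<in>?b1. if e \<in> \<gamma> then (m \<circ> Inr) e else c e) *
          peps_map \<Gamma> \<Lambda>2 (x \<circ> Inl) (\<lambda>e\<in>?b2. if e \<in> \<gamma> then (m \<circ> Inr) e else c e))"
        by (subst sum.reindex_bij_betw[OF bij_betw_cfg[OF inj_Inr site_dim_comp(2)], symmetric]) simp
      finally show ?thesis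
        unfolding term1 term2 sum_distrib_left by (simp add: mult_ac)
    qed
    moreover have "?lhs x y = (if \<forall>r\<in>Inl ` \<Lambda>3. x r = y r then
        lift Inl Inr (peps_map \<Gamma> \<Lambda>) (restrict x (Inl ` \<Lambda>)) (restrict y (Inr ` ?b)) else 0)"
      using x y by (simp add: local_op_def)
    ultimately show "?lhs x y = mat_mul (cfg ?n X) ?M1 ?M2 x y"
      by simp
  qed
qed

text \<open>The unions become variables with equations as premises, so that the rule applies to
  operators whose site sets are written differently.\<close>

lemma local_op_commute':
  assumes "finite S" "finite T" "finite S'" "finite T'" "finite R"
    and "S \<inter> R = {}" "T \<inter> R = {}" "S' \<inter> R = {}" "T' \<inter> R = {}" "S \<inter> T' = {}" "T \<inter> S' = {}"
    and "U1 = T' \<union> R" "U2 = S \<union> R" "U3 = T \<union> R" "U4 = S' \<union> R" "X = S \<union> U1" "X' = S' \<union> U3"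
  shows "mat_mul (cfg n X) (local_op n T S U1 K) (local_op n T' S' U2 M)
    = mat_mul (cfg n X') (local_op n T' S' U3 M) (local_op n T S U4 K)"
  using local_op_commute[OF assms(1-11), of n K M] by (simp only: assms(12-))

text \<open>As no edge joins \<open>A\<close> to \<open>C\<close>, an edge is classified by where
  its two endpoints lie: \<open>a\<close>, \<open>m\<close>, \<open>b\<close> lead from
  \<open>A\<close>, \<open>B\<close>, \<open>C\<close> to the outside, while \<open>\<alpha>\<close>
  and \<open>\<gamma>\<close> join \<open>B\<close> to \<open>A\<close> and to
  \<open>C\<close>.\<close>

lemma three_regions_bdry:
  assumes \<Gamma>: "is_peps \<Gamma>" and disj: "A \<inter> B = {}" "B \<inter> C = {}" "A \<inter> C = {}"
    and AC: "\<forall>u\<in>A. \<forall>w\<in>C. {u, w} \<notin> edges \<Gamma>"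
  defines "\<alpha> \<equiv> bdry \<Gamma> A \<inter> bdry \<Gamma> B" and "\<gamma> \<equiv> bdry \<Gamma> B \<inter> bdry \<Gamma> C"
    and "a \<equiv> bdry \<Gamma> A \<inter> bdry \<Gamma> (A \<union> B \<union> C)" and "b \<equiv> bdry \<Gamma> C \<inter> bdry \<Gamma> (A \<union> B \<union> C)"
    and "m \<equiv> bdry \<Gamma> B \<inter> bdry \<Gamma> (A \<union> B \<union> C)"
  shows "bdry \<Gamma> A = a \<union> \<alpha>" "bdry \<Gamma> B = \<alpha> \<union> m \<union> \<gamma>" "bdry \<Gamma> C = b \<union> \<gamma>"
    "bdry \<Gamma> (A \<union> B) = a \<union> m \<union> \<gamma>" "bdry \<Gamma> (B \<union> C) = \<alpha> \<union> m \<union> b"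
    "bdry \<Gamma> (A \<union> B \<union> C) = a \<union> m \<union> b"
    "a \<inter> \<alpha> = {}" "a \<inter> m = {}" "a \<inter> \<gamma> = {}" "a \<inter> b = {}" "\<alpha> \<inter> m = {}" "\<alpha> \<inter> \<gamma> = {}" "\<alpha> \<inter> b = {}"
    "m \<inter> \<gamma> = {}" "m \<inter> b = {}" "\<gamma> \<inter> b = {}"
proof -
  have kind: "w \<in> A \<and> w \<notin> B \<and> w \<notin> C \<or> w \<notin> A \<and> w \<in> B \<and> w \<notin> C \<or> w \<notin> A \<and> w \<notin> B \<and> w \<in> C \<or>
      w \<notin> A \<and> w \<notin> B \<and> w \<notin> C" for w
    using disj by blast
  have key: "(e \<in> bdry \<Gamma> A \<longleftrightarrow> e \<in> a \<or> e \<in> \<alpha>) \<and> (e \<in> bdry \<Gamma> B \<longleftrightarrow> e \<in> \<alpha> \<or> e \<in> m \<or> e \<in> \<gamma>) \<and>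
      (e \<in> bdry \<Gamma> C \<longleftrightarrow> e \<in> b \<or> e \<in> \<gamma>) \<and> (e \<in> bdry \<Gamma> (A \<union> B) \<longleftrightarrow> e \<in> a \<or> e \<in> m \<or> e \<in> \<gamma>) \<and>
      (e \<in> bdry \<Gamma> (B \<union> C) \<longleftrightarrow> e \<in> \<alpha> \<or> e \<in> m \<or> e \<in> b) \<and>
      (e \<in> bdry \<Gamma> (A \<union> B \<union> C) \<longleftrightarrow> e \<in> a \<or> e \<in> m \<or> e \<in> b) \<and>
      (e \<in> a \<longrightarrow> e \<notin> \<alpha> \<and> e \<notin> m \<and> e \<notin> \<gamma> \<and> e \<notin> b) \<and> (e \<in> \<alpha> \<longrightarrow> e \<notin> m \<and> e \<notin> \<gamma> \<and> e \<notin> b) \<and>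
      (e \<in> m \<longrightarrow> e \<notin> \<gamma> \<and> e \<notin> b) \<and> (e \<in> \<gamma> \<longrightarrow> e \<notin> b)" if e: "e \<in> edges \<Gamma>" for e
  proof -
    have "card e = 2" by (rule peps_edge(2)[OF \<Gamma> e])
    then obtain u v where uv: "e = {u, v}" "u \<noteq> v"
      by (auto simp: card_2_iff)
    have no_AC: "\<not> (u \<in> A \<and> v \<in> C)" "\<not> (v \<in> A \<and> u \<in> C)"
      using AC e by (auto simp: uv insert_commute)
    have iff: "e \<in> bdry \<Gamma> \<Lambda> \<longleftrightarrow> (u \<in> \<Lambda>) \<noteq> (v \<in> \<Lambda>)" for \<Lambda>
      using e uv by (auto simp: bdry_def)
    show ?thesis
      unfolding \<alpha>_def \<gamma>_def a_def b_def m_def Int_iff iff Un_iff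
      using kind[of u] kind[of v] no_AC by (elim disjE conjE) simp_all
  qed
  have edges: "bdry \<Gamma> \<Lambda> \<subseteq> edges \<Gamma>" for \<Lambda> by (auto simp: bdry_def)
  have eqI: "X = Y" if "X \<subseteq> edges \<Gamma>" "Y \<subseteq> edges \<Gamma>" "\<And>e. e \<in> edges \<Gamma> \<Longrightarrow> e \<in> X \<longleftrightarrow> e \<in> Y" for X Y
    using that by blast
  have sub: "a \<subseteq> edges \<Gamma>" "\<alpha> \<subseteq> edges \<Gamma>" "m \<subseteq> edges \<Gamma>" "\<gamma> \<subseteq> edges \<Gamma>" "b \<subseteq> edges \<Gamma>"
    unfolding \<alpha>_def \<gamma>_def a_def b_def m_def using edges by blast+
  show "bdry \<Gamma> A = a \<union> \<alpha>" "bdry \<Gamma> B = \<alpha> \<union> m \<union> \<gamma>" "bdry \<Gamma> C = b \<union> \<gamma>"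
    "bdry \<Gamma> (A \<union> B) = a \<union> m \<union> \<gamma>" "bdry \<Gamma> (B \<union> C) = \<alpha> \<union> m \<union> b"
    "bdry \<Gamma> (A \<union> B \<union> C) = a \<union> m \<union> b"
    by ((rule eqI, rule edges, use sub in simp), drule key, simp)+
  show "a \<inter> \<alpha> = {}" "a \<inter> m = {}" "a \<inter> \<gamma> = {}" "a \<inter> b = {}" "\<alpha> \<inter> m = {}" "\<alpha> \<inter> \<gamma> = {}" "\<alpha> \<inter> b = {}"
    "m \<inter> \<gamma> = {}" "m \<inter> b = {}" "\<gamma> \<inter> b = {}"
    using key sub by blast+
qed

lemma mat_mul_assoc_eq: "mat_mul I M N = R \<Longrightarrow> mat_mul I M (mat_mul J N Z) = mat_mul J R Z"
  unfolding mat_mul_assoc[symmetric] by simp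

text \<open>\<open>At\<close> and \<open>Ct\<close> are the maps \<open>A'\<close> and
  \<open>C'\<close> of the overview, \<open>Oc\<close> and \<open>Od\<close> are
  \<open>\<Omega>zc\<close> and \<open>\<Omega>dz\<close> with inverses \<open>Oi\<close> and
  \<open>Odi\<close>, and \<open>Da\<close>, \<open>Db\<close> are the inverses of
  \<open>\<Delta>az\<close> and \<open>\<Delta>zb\<close>. A prime marks the same kernel beside
  other spectators, as left by a commutation. The second conclusion holds because \<open>L\<close>
  recovers \<open>Ct\<close> from \<open>VBC\<close>.\<close>

lemma factorization_algebra:
  fixes VAB VBC VABC VB :: "'h \<Rightarrow> 'x \<Rightarrow> complex" and At Ct :: "'x \<Rightarrow> 'x \<Rightarrow> complex"
  assumes fin: "finite XA" "finite XB" "finite XC"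
    and supp: "supp_on XB XA At" "supp_on XB XC Ct" "supp_on XC XC Db"
    and AB: "VAB = mat_mul XB VB At" and BC: "VBC = mat_mul XB VB Ct"
    and ABC: "VABC = mat_mul XA VAB Ct'" "VABC = mat_mul XC VBC At'"
    and L: "mat_mul H L VB = id_on XB"
    and comm: "mat_mul XB (mat_adj At) Oc = mat_mul XA Oc' (mat_adj At)"
      "mat_mul XB Od Ct = mat_mul XC Ct Od'"
      "mat_mul XB (mat_adj At) Ct = mat_mul Y Ct' (mat_adj At')"
      "mat_mul XA Da Ct' = mat_mul Y Ct' Da'"
      "mat_mul XC (mat_adj At') Db = mat_mul Y Db' (mat_adj At')"
    and inv: "mat_mul XA Oi Oc' = id_on XA" "mat_mul XC Od' Odi = id_on XC"
  defines "QAB \<equiv> mat_mul XA VAB (mat_mul XA (mat_mul XA Da Oi) (mat_adj VAB))"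
    and "QBC \<equiv> mat_mul XC VBC (mat_mul XC (mat_mul XC Odi Db) (mat_adj VBC))"
  shows "mat_mul H (mat_mul H QAB (mat_mul XB (mat_adj L) (mat_mul XB (mat_mul XB Oc Od) L))) QBC
      = mat_mul Y VABC (mat_mul Y (mat_mul Y Da' Db') (mat_adj VABC))"
    and "mat_mul H (mat_mul XB VB L) QBC = QBC"
proof -
  note assoc = mat_mul_assoc
  have L_AB: "mat_mul H L VAB = At" and L_BC: "mat_mul H L VBC = Ct"
    by (simp_all add: AB BC mat_mul_assoc_eq[OF L] mat_mul_id_left[OF fin(2) supp(1)]
        mat_mul_id_left[OF fin(2) supp(2)])
  have AB_L: "mat_mul H (mat_adj VAB) (mat_adj L) = mat_adj At"
    using arg_cong[OF L_AB, of mat_adj] by (simp add: mat_adj_mul)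
  have ABC_adj: "mat_mul XC (mat_adj At') (mat_adj VBC) = mat_adj VABC"
    by (simp add: ABC(2) mat_adj_mul)
  have inv1: "mat_mul XA Oi (mat_mul XA Oc' (mat_mul XB (mat_adj At) Z)) = mat_mul XB (mat_adj At) Z" for Z :: "'x \<Rightarrow> 'h \<Rightarrow> complex"
    using mat_mul_assoc_eq[OF mat_mul_id_left[OF fin(1) supp_on_adj[OF supp(1)]]]
    by (simp add: mat_mul_assoc_eq[OF inv(1)])
  have inv2: "mat_mul XC Od' (mat_mul XC Odi (mat_mul XC Db Z)) = mat_mul XC Db Z" for Z :: "'x \<Rightarrow> 'h \<Rightarrow> complex"
    using mat_mul_assoc_eq[OF mat_mul_id_left[OF fin(3) supp(3)]]
    by (simp add: mat_mul_assoc_eq[OF inv(2)])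
  have "mat_mul H (mat_mul H QAB (mat_mul XB (mat_adj L) (mat_mul XB (mat_mul XB Oc Od) L))) QBC
    = mat_mul XA VAB (mat_mul XA Da (mat_mul XA Oi (mat_mul XB (mat_adj At) (mat_mul XB Oc (mat_mul XB Od
      (mat_mul XC Ct (mat_mul XC Odi (mat_mul XC Db (mat_adj VBC)))))))))"
    unfolding QAB_def QBC_def assoc mat_mul_assoc_eq[OF AB_L] mat_mul_assoc_eq[OF L_BC] ..
  also have "\<dots> = mat_mul XA VAB (mat_mul XA Da (mat_mul XB (mat_adj At)
      (mat_mul XC Ct (mat_mul XC Db (mat_adj VBC)))))"
    unfolding mat_mul_assoc_eq[OF comm(1)] mat_mul_assoc_eq[OF comm(2)] assoc inv1 inv2 ..
  \<comment> \<open>The adjoint of \<open>At\<close> passes \<open>Ct\<close> and then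
    \<open>Db\<close>, and \<open>Ct\<close> passes \<open>Da\<close>; at the two ends they complete
    \<open>VAB\<close> and the adjoint of \<open>VBC\<close> to \<open>VABC\<close> and its
    adjoint.\<close>
  also have "\<dots> = mat_mul Y VABC (mat_mul Y (mat_mul Y Da' Db') (mat_adj VABC))"
    unfolding mat_mul_assoc_eq[OF comm(3)] assoc mat_mul_assoc_eq[OF comm(4)]
      mat_mul_assoc_eq[OF comm(5)] mat_mul_assoc_eq[OF ABC(1)[symmetric]] ABC_adj ..
  finally show "mat_mul H (mat_mul H QAB (mat_mul XB (mat_adj L) (mat_mul XB (mat_mul XB Oc Od) L))) QBC
      = mat_mul Y VABC (mat_mul Y (mat_mul Y Da' Db') (mat_adj VABC))" .
  have "mat_mul H (mat_mul XB VB L) VBC = VBC"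
    using L_BC BC by (simp add: assoc)
  then show "mat_mul H (mat_mul XB VB L) QBC = QBC"
    unfolding QBC_def by (rule mat_mul_assoc_eq[of H _ VBC VBC])
qed

definition sandwich :: "'v peps \<Rightarrow> 'v set \<Rightarrow> (('v set \<Rightarrow> nat) \<Rightarrow> ('v set \<Rightarrow> nat) \<Rightarrow> complex)
    \<Rightarrow> ('v \<Rightarrow> nat) \<Rightarrow> ('v \<Rightarrow> nat) \<Rightarrow> complex"
  where "sandwich \<Gamma> \<Lambda> \<tau> = mat_mul (bond_configs \<Gamma> (bdry \<Gamma> \<Lambda>)) (peps_map \<Gamma> \<Lambda>)
    (mat_mul (bond_configs \<Gamma> (bdry \<Gamma> \<Lambda>)) \<tau> (mat_adj (peps_map \<Gamma> \<Lambda>)))"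

text \<open>Instantiates \<open>factorization_algebra\<close> on the common sites and returns to
  entries by \<open>lift_clip_inject\<close>. The two factors between the PEPS maps stand in the
  order of the inverse of \<open>\<sigma>\<close>, reversed with respect to \<open>\<sigma>\<close>
  itself.\<close>

lemma peps_products:
  fixes \<Gamma> :: "'v peps" and \<Delta>az' \<Delta>zb' :: "('v set \<Rightarrow> nat) \<Rightarrow> ('v set \<Rightarrow> nat) \<Rightarrow> complex"
  assumes \<Gamma>: "is_peps \<Gamma>" and A: "finite A" "A \<subseteq> verts \<Gamma>" and B: "finite B" "B \<subseteq> verts \<Gamma>"
    and C: "finite C" "C \<subseteq> verts \<Gamma>"
    and disj: "A \<inter> B = {}" "B \<inter> C = {}" "A \<inter> C = {}"
    and AC: "\<forall>u\<in>A. \<forall>w\<in>C. {u, w} \<notin> edges \<Gamma>"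
    and m: "BL \<union> z \<union> BR = bdry \<Gamma> B \<inter> bdry \<Gamma> (A \<union> B \<union> C)"
      "BL \<inter> z = {}" "z \<inter> BR = {}" "BL \<inter> BR = {}"
    and R: "R = A \<union> B \<union> C"
    and az: "az = bdry \<Gamma> A \<inter> bdry \<Gamma> (A \<union> B \<union> C) \<union> BL \<union> z"
    and zb: "zb = z \<union> (bdry \<Gamma> C \<inter> bdry \<Gamma> (A \<union> B \<union> C) \<union> BR)"
    and dz: "dz = bdry \<Gamma> A \<inter> bdry \<Gamma> B \<union> BL \<union> z"
    and zc: "zc = z \<union> (bdry \<Gamma> B \<inter> bdry \<Gamma> C \<union> BR)"
    and L: "mat_eq_on (bond_configs \<Gamma> (bdry \<Gamma> B)) (mat_mul (phys_configs \<Gamma> B) L (peps_map \<Gamma> B)) mat_id"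
    and inv: "is_mat_inverse (bond_configs \<Gamma> zc) \<Omega>zc \<Omega>zc'" "is_mat_inverse (bond_configs \<Gamma> dz) \<Omega>dz \<Omega>dz'"
  defines "H \<equiv> phys_configs \<Gamma> R" and "I \<equiv> \<lambda>\<Lambda>. bond_configs \<Gamma> (bdry \<Gamma> \<Lambda>)"
  defines "qAB \<equiv> extend_op (A \<union> B) R (sandwich \<Gamma> (A \<union> B) (mat_mul (I (A \<union> B))
      (extend_op az (bdry \<Gamma> (A \<union> B)) \<Delta>az') (extend_op zc (bdry \<Gamma> (A \<union> B)) \<Omega>zc')))"
    and "qBC \<equiv> extend_op (B \<union> C) R (sandwich \<Gamma> (B \<union> C) (mat_mul (I (B \<union> C))
      (extend_op dz (bdry \<Gamma> (B \<union> C)) \<Omega>dz') (extend_op zb (bdry \<Gamma> (B \<union> C)) \<Delta>zb')))"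
    and "qABC \<equiv> extend_op R R (sandwich \<Gamma> R (mat_mul (I R)
      (extend_op az (bdry \<Gamma> R) \<Delta>az') (extend_op zb (bdry \<Gamma> R) \<Delta>zb')))"
    and "g \<equiv> extend_op B R (mat_mul (I B) (mat_adj L) (mat_mul (I B) (mat_mul (I B)
      (extend_op zc (bdry \<Gamma> B) \<Omega>zc) (extend_op dz (bdry \<Gamma> B) \<Omega>dz)) L))"
    and "pB \<equiv> extend_op B R (mat_mul (I B) (peps_map \<Gamma> B) L)"
  assumes s: "s \<in> H" "s' \<in> H"
  shows "mat_mul H (mat_mul H qAB g) qBC s s' = qABC s s'" and "mat_mul H pB qBC s s' = qBC s s'"
proof -
  define a where "a = bdry \<Gamma> A \<inter> bdry \<Gamma> (A \<union> B \<union> C)"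
  define b where "b = bdry \<Gamma> C \<inter> bdry \<Gamma> (A \<union> B \<union> C)"
  define \<alpha> where "\<alpha> = bdry \<Gamma> A \<inter> bdry \<Gamma> B"
  define \<gamma> where "\<gamma> = bdry \<Gamma> B \<inter> bdry \<Gamma> C"
  note bd = three_regions_bdry[OF \<Gamma> disj AC, folded m(1) a_def b_def \<alpha>_def \<gamma>_def]
  have M_disj: "a \<inter> BL = {}" "a \<inter> z = {}" "a \<inter> BR = {}" "\<alpha> \<inter> BL = {}" "\<alpha> \<inter> z = {}" "\<alpha> \<inter> BR = {}"
      "BL \<inter> \<gamma> = {}" "z \<inter> \<gamma> = {}" "BR \<inter> \<gamma> = {}" "BL \<inter> b = {}" "z \<inter> b = {}" "BR \<inter> b = {}"
    using bd(8,11,14,15) by (simp_all add: Int_Un_distrib Int_Un_distrib2)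
  note all_disj = M_disj bd(7,9,10,12,13,16) m(2-4)
  have all_disj': "Z \<inter> X = {}" if "X \<inter> Z = {}" for X Z :: "'v set set"
    using that by auto
  note dj = all_disj all_disj[THEN all_disj']
  have S: "az = a \<union> BL \<union> z" "zb = z \<union> b \<union> BR" "dz = \<alpha> \<union> BL \<union> z" "zc = z \<union> \<gamma> \<union> BR"
    unfolding az zb dz zc a_def b_def \<alpha>_def \<gamma>_def by auto
  have \<alpha>_BC: "\<alpha> = bdry \<Gamma> (B \<union> C) \<inter> bdry \<Gamma> A" and \<gamma>_AB: "\<gamma> = bdry \<Gamma> (A \<union> B) \<inter> bdry \<Gamma> C"
    by (simp_all add: bd(1-6) dj Int_Un_distrib Int_Un_distrib2)
  have S_sub: "az \<subseteq> bdry \<Gamma> (A \<union> B)" "zc \<subseteq> bdry \<Gamma> (A \<union> B)" "dz \<subseteq> bdry \<Gamma> (B \<union> C)" "zb \<subseteq> bdry \<Gamma> (B \<union> C)"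
      "az \<subseteq> bdry \<Gamma> R" "zb \<subseteq> bdry \<Gamma> R" "zc \<subseteq> bdry \<Gamma> B" "dz \<subseteq> bdry \<Gamma> B"
    unfolding S R bd(2,4-6) by auto
  have fin_bd: "finite (bdry \<Gamma> A)" "finite (bdry \<Gamma> B)" "finite (bdry \<Gamma> C)" "finite (bdry \<Gamma> (A \<union> B))"
      "finite (bdry \<Gamma> (B \<union> C))" "finite (bdry \<Gamma> R)"
    by (rule finite_bdry[OF \<Gamma>]; use A B C R in auto)+
  have fin: "finite a" "finite b" "finite \<alpha>" "finite \<gamma>" "finite BL" "finite z" "finite BR"
    using fin_bd(1-3)[unfolded bd(1-3)] by auto
  have Diff_Un': "X - (Z \<union> W) = X - Z - W" for X Z W :: "'v set set"
    by auto
  have diff: "bdry \<Gamma> (A \<union> B) - az = BR \<union> \<gamma>" "bdry \<Gamma> (A \<union> B) - zc = a \<union> BL"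
      "bdry \<Gamma> (B \<union> C) - dz = BR \<union> b" "bdry \<Gamma> (B \<union> C) - zb = \<alpha> \<union> BL"
      "bdry \<Gamma> R - az = BR \<union> b" "bdry \<Gamma> R - zb = a \<union> BL" "bdry \<Gamma> B - zc = \<alpha> \<union> BL" "bdry \<Gamma> B - dz = BR \<union> \<gamma>"
      "bdry \<Gamma> B - \<alpha> = BL \<union> z \<union> BR \<union> \<gamma>" "bdry \<Gamma> B - \<gamma> = \<alpha> \<union> BL \<union> z \<union> BR"
      "bdry \<Gamma> (A \<union> B) - \<gamma> = a \<union> BL \<union> z \<union> BR" "bdry \<Gamma> (B \<union> C) - \<alpha> = BL \<union> z \<union> BR \<union> b"
      "bdry \<Gamma> A - \<alpha> = a" "bdry \<Gamma> C - \<gamma> = b"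
    unfolding S R bd(1-6) by (simp_all add: dj Un_Diff Diff_Un' Diff_triv Un_assoc)
  have diff_R: "R - (A \<union> B) = C" "R - (B \<union> C) = A" "R - B = A \<union> C" "R - R = {}"
    using disj by (auto simp: R)
  define n where "n = site_dim \<Gamma>"
  note n = site_dim_comp[of \<Gamma>, folded n_def]
  let ?p = "\<lambda>X. Inl ` X :: ('v + 'v set) set" and ?i = "\<lambda>X. Inr ` X :: ('v + 'v set) set"
  let ?v = "\<lambda>\<Lambda>. lift Inl Inr (peps_map \<Gamma> \<Lambda>) :: ('v + 'v set \<Rightarrow> nat) \<Rightarrow> ('v + 'v set \<Rightarrow> nat) \<Rightarrow> complex"
  let ?w = "\<lambda>K. lift Inr Inr K :: ('v + 'v set \<Rightarrow> nat) \<Rightarrow> ('v + 'v set \<Rightarrow> nat) \<Rightarrow> complex"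
  define HS where "HS = cfg n (?p R)"
  define XA where "XA = cfg n (?i (bdry \<Gamma> (A \<union> B)) \<union> ?p C)"
  define XC where "XC = cfg n (?i (bdry \<Gamma> (B \<union> C)) \<union> ?p A)"
  define XB where "XB = cfg n (?i (bdry \<Gamma> B) \<union> ?p (A \<union> C))"
  \<comment> \<open>The whole region has no further sites; the empty set \<open>?p {}\<close> keeps
    it in the form shared with the other regions.\<close>
  define Y where "Y = cfg n (?i (bdry \<Gamma> R) \<union> ?p {})"
  define VAB where "VAB = local_op n (?p (A \<union> B)) (?i (bdry \<Gamma> (A \<union> B))) (?p C) (?v (A \<union> B))"
  define VBC where "VBC = local_op n (?p (B \<union> C)) (?i (bdry \<Gamma> (B \<union> C))) (?p A) (?v (B \<union> C))"
  define VABC where "VABC = local_op n (?p R) (?i (bdry \<Gamma> R)) (?p {}) (?v R)"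
  define VB where "VB = local_op n (?p B) (?i (bdry \<Gamma> B)) (?p (A \<union> C)) (?v B)"
  define LB where "LB = local_op n (?i (bdry \<Gamma> B)) (?p B) (?p (A \<union> C)) (lift Inr Inl L)"
  define At where "At = local_op n (?p A \<union> ?i \<alpha>) (?i a) (?p C \<union> ?i (BL \<union> z \<union> BR \<union> \<gamma>)) (glue \<Gamma> \<alpha> A)"
  define Ct where "Ct = local_op n (?p C \<union> ?i \<gamma>) (?i b) (?p A \<union> ?i (\<alpha> \<union> BL \<union> z \<union> BR)) (glue \<Gamma> \<gamma> C)"
  define Ct' where "Ct' = local_op n (?p C \<union> ?i \<gamma>) (?i b) (?i (a \<union> BL \<union> z \<union> BR)) (glue \<Gamma> \<gamma> C)"
  define At' where "At' = local_op n (?p A \<union> ?i \<alpha>) (?i a) (?i (BL \<union> z \<union> BR \<union> b)) (glue \<Gamma> \<alpha> A)"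
  define Oc where "Oc = local_op n (?i zc) (?i zc) (?i (\<alpha> \<union> BL) \<union> ?p (A \<union> C)) (?w \<Omega>zc)"
  define Oc' where "Oc' = local_op n (?i zc) (?i zc) (?i (a \<union> BL) \<union> ?p C) (?w \<Omega>zc)"
  define Od where "Od = local_op n (?i dz) (?i dz) (?i (BR \<union> \<gamma>) \<union> ?p (A \<union> C)) (?w \<Omega>dz)"
  define Od' where "Od' = local_op n (?i dz) (?i dz) (?i (BR \<union> b) \<union> ?p A) (?w \<Omega>dz)"
  define Oi where "Oi = local_op n (?i zc) (?i zc) (?i (a \<union> BL) \<union> ?p C) (?w \<Omega>zc')"
  define Odi where "Odi = local_op n (?i dz) (?i dz) (?i (BR \<union> b) \<union> ?p A) (?w \<Omega>dz')"
  define Da where "Da = local_op n (?i az) (?i az) (?i (BR \<union> \<gamma>) \<union> ?p C) (?w \<Delta>az')"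
  define Da' where "Da' = local_op n (?i az) (?i az) (?i (BR \<union> b) \<union> ?p {}) (?w \<Delta>az')"
  define Db where "Db = local_op n (?i zb) (?i zb) (?i (\<alpha> \<union> BL) \<union> ?p A) (?w \<Delta>zb')"
  define Db' where "Db' = local_op n (?i zb) (?i zb) (?i (a \<union> BL) \<union> ?p {}) (?w \<Delta>zb')"
  have disjoint_images: "?i X \<inter> ?p Z = {}" "?p Z \<inter> ?i X = {}" for X Z by auto
  have finp: "finite (?p A)" "finite (?p B)" "finite (?p C)" "finite (?p (A \<union> C))" "finite (?p {})"
    using A B C by auto
  have lift_ext: "clip HS HS (lift Inl Inl (extend_op \<Lambda> R K)) = local_op n (?p \<Lambda>) (?p \<Lambda>) (?p (R - \<Lambda>)) (lift Inl Inl K)"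
    if "\<Lambda> \<subseteq> R" for \<Lambda> K
    unfolding HS_def by (rule lift_extend_op[OF inj_Inl n(1) that])
  note sand = local_op_lift_sandwich[OF inj_Inr n(2)]
  have adj_LB: "mat_adj LB = local_op n (?p B) (?i (bdry \<Gamma> B)) (?p (A \<union> C)) (lift Inl Inr (mat_adj L))"
    by (simp add: LB_def mat_adj_local_op mat_adj_lift)
  have QAB: "clip HS HS (lift Inl Inl qAB) = mat_mul XA VAB (mat_mul XA (mat_mul XA Da Oi) (mat_adj VAB))"
    unfolding qAB_def sandwich_def I_def
    by (subst lift_ext, force simp: R)
      (simp only: diff_R diff sand[OF S_sub(1,2) fin_bd(4) finp(3) disjoint_images(1)] XA_def VAB_def Da_def Oi_def)
  have QBC: "clip HS HS (lift Inl Inl qBC) = mat_mul XC VBC (mat_mul XC (mat_mul XC Odi Db) (mat_adj VBC))"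
    unfolding qBC_def sandwich_def I_def
    by (subst lift_ext, force simp: R)
      (simp only: diff_R diff sand[OF S_sub(3,4) fin_bd(5) finp(1) disjoint_images(1)] XC_def VBC_def Db_def Odi_def)
  have QABC: "clip HS HS (lift Inl Inl qABC) = mat_mul Y VABC (mat_mul Y (mat_mul Y Da' Db') (mat_adj VABC))"
    unfolding qABC_def sandwich_def I_def
    by (subst lift_ext, simp)
      (simp only: diff_R diff sand[OF S_sub(5,6) fin_bd(6) finp(5) disjoint_images(1)] Y_def VABC_def Da'_def Db'_def)
  have G: "clip HS HS (lift Inl Inl g) = mat_mul XB (mat_adj LB) (mat_mul XB (mat_mul XB Oc Od) LB)"
    unfolding g_def I_def
    using sand[OF S_sub(7,8) fin_bd(2) finp(4) disjoint_images(1), of Inl B "mat_adj L" \<Omega>zc \<Omega>dz]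
    by (subst lift_ext, force simp: R) (simp only: diff_R diff XB_def adj_LB[symmetric] mat_adj_adj Oc_def Od_def)
  have PB: "clip HS HS (lift Inl Inl pB) = mat_mul XB VB LB"
    unfolding pB_def I_def
    by (subst lift_ext, force simp: R)
      (simp only: diff_R local_op_lift_mul[OF inj_Inr n(2) fin_bd(2) finp(4) disjoint_images(1), symmetric] XB_def VB_def LB_def)
  note glue = local_op_peps_map_Un[OF \<Gamma>, folded n_def]
  have bd_R: "bdry \<Gamma> R = a \<union> (BL \<union> z \<union> BR) \<union> b" by (simp add: R bd(6))
  have AB: "VAB = mat_mul XB VB At"
    unfolding VAB_def XB_def VB_def At_def
    by (rule glue[OF B A]) (use disj C in \<open>simp_all add: diff Int_commute image_Un \<alpha>_def[symmetric] Un_commute\<close>)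
  have BC: "VBC = mat_mul XB VB Ct"
    unfolding VBC_def XB_def VB_def Ct_def
    by (rule glue[OF B C]) (use disj A in \<open>simp_all add: diff Int_commute image_Un \<gamma>_def[symmetric] Un_commute\<close>)
  have ABC1: "VABC = mat_mul XA VAB Ct'"
    unfolding VABC_def XA_def VAB_def Ct'_def
    by (rule glue[OF _ _ C]) (use disj A B in \<open>simp_all add: R diff \<gamma>_AB[symmetric] Int_Un_distrib2\<close>)
  have ABC2: "VABC = mat_mul XC VBC At'"
    unfolding VABC_def XC_def VBC_def At'_def
    by (rule glue[OF _ _ A]) (use disj B C in \<open>simp_all add: R diff \<alpha>_BC[symmetric] Int_Un_distrib Int_Un_distrib2 Int_commute[of _ A] Un_ac\<close>)
  have disj': "B \<inter> A = {}" "C \<inter> B = {}" "C \<inter> A = {}"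
    using disj by auto
  note fins = fin fin_bd finp A(1) B(1) C(1)
  note sets = S bd(2,4,5) bd_R image_Un Int_Un_distrib Int_Un_distrib2 disjoint_images
    image_Int[OF inj_Inr, symmetric] image_Int[OF inj_Inl, symmetric] dj disj disj' Un_ac
  have adj_At: "mat_adj At = local_op n (?i a) (?p A \<union> ?i \<alpha>) (?p C \<union> ?i (BL \<union> z \<union> BR \<union> \<gamma>)) (mat_adj (glue \<Gamma> \<alpha> A))"
    and adj_At': "mat_adj At' = local_op n (?i a) (?p A \<union> ?i \<alpha>) (?i (BL \<union> z \<union> BR \<union> b)) (mat_adj (glue \<Gamma> \<alpha> A))"
    by (simp_all add: At_def At'_def mat_adj_local_op)
  \<comment> \<open>In each of the five commutations \<open>R\<close> collects the sites that
    neither operator touches.\<close>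
  have comm: "mat_mul XB (mat_adj At) Oc = mat_mul XA Oc' (mat_adj At)"
    unfolding adj_At XB_def XA_def Oc_def Oc'_def
    by (rule local_op_commute'[where R = "?p C \<union> ?i BL"]) (simp_all add: fins sets)
  have comm2: "mat_mul XB Od Ct = mat_mul XC Ct Od'"
    unfolding XB_def XC_def Od_def Od'_def Ct_def
    by (rule local_op_commute'[where R = "?p A \<union> ?i BR"]) (simp_all add: fins sets)
  have comm3: "mat_mul XB (mat_adj At) Ct = mat_mul Y Ct' (mat_adj At')"
    unfolding adj_At adj_At' XB_def Y_def Ct_def Ct'_def
    by (rule local_op_commute'[where R = "?i (BL \<union> z \<union> BR)"]) (simp_all add: fins sets)
  have comm4: "mat_mul XA Da Ct' = mat_mul Y Ct' Da'"
    unfolding XA_def Y_def Da_def Da'_def Ct'_def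
    by (rule local_op_commute'[where R = "?i BR"]) (simp_all add: fins sets)
  have comm5: "mat_mul XC (mat_adj At') Db = mat_mul Y Db' (mat_adj At')"
    unfolding adj_At' XC_def Y_def Db_def Db'_def
    by (rule local_op_commute'[where R = "?i BL"]) (simp_all add: fins sets)
  have inv1: "mat_mul XA Oi Oc' = id_on XA"
  proof -
    have "?i (bdry \<Gamma> (A \<union> B)) \<union> ?p C = ?i zc \<union> (?i (a \<union> BL) \<union> ?p C)"
      by (simp add: sets)
    then show ?thesis
      unfolding XA_def Oi_def Oc'_def
      by (simp only:) (rule local_op_lift_inverse[OF inj_Inr n(2) inj_Inr n(2)],
        use inv(1) in \<open>simp_all add: fins sets is_mat_inverse_def mat_eq_on_def\<close>)
  qed
  have inv2: "mat_mul XC Od' Odi = id_on XC"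
  proof -
    have "?i (bdry \<Gamma> (B \<union> C)) \<union> ?p A = ?i dz \<union> (?i (BR \<union> b) \<union> ?p A)"
      by (simp add: sets)
    then show ?thesis
      unfolding XC_def Odi_def Od'_def
      by (simp only:) (rule local_op_lift_inverse[OF inj_Inr n(2) inj_Inr n(2)],
        use inv(2) in \<open>simp_all add: fins sets is_mat_inverse_def mat_eq_on_def\<close>)
  qed
  have HS_eq: "HS = cfg n (?p B \<union> ?p (A \<union> C))"
    by (simp add: HS_def R image_Un Un_ac)
  have LV: "mat_mul HS LB VB = id_on XB"
    unfolding HS_eq LB_def VB_def XB_def
    by (rule local_op_lift_inverse[OF inj_Inr n(2) inj_Inl n(1)])
      (use L disj in \<open>simp_all add: fins sets mat_eq_on_def\<close>)
  have supp: "supp_on XB XA At" "supp_on XB XC Ct" "supp_on XC XC Db"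
  proof -
    have "?i (bdry \<Gamma> B) \<union> ?p (A \<union> C) = ?p A \<union> ?i \<alpha> \<union> (?p C \<union> ?i (BL \<union> z \<union> BR \<union> \<gamma>))"
      "?i (bdry \<Gamma> (A \<union> B)) \<union> ?p C = ?i a \<union> (?p C \<union> ?i (BL \<union> z \<union> BR \<union> \<gamma>))"
      "?i (bdry \<Gamma> (B \<union> C)) \<union> ?p A = ?i zb \<union> (?i (\<alpha> \<union> BL) \<union> ?p A)"
      by (simp_all add: sets)
    then show "supp_on XB XA At" "supp_on XC XC Db"
      unfolding XB_def XA_def XC_def At_def Db_def by (simp_all only: supp_on_local_op)
    have "?i (bdry \<Gamma> B) \<union> ?p (A \<union> C) = ?p C \<union> ?i \<gamma> \<union> (?p A \<union> ?i (\<alpha> \<union> BL \<union> z \<union> BR))"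
      "?i (bdry \<Gamma> (B \<union> C)) \<union> ?p A = ?i b \<union> (?p A \<union> ?i (\<alpha> \<union> BL \<union> z \<union> BR))"
      by (simp_all add: sets)
    then show "supp_on XB XC Ct"
      unfolding XB_def XC_def Ct_def by (simp_all only: supp_on_local_op)
  qed
  have finX: "finite XA" "finite XB" "finite XC"
    unfolding XA_def XB_def XC_def by (simp_all add: fins)
  note alg = factorization_algebra[OF finX supp AB BC ABC1 ABC2 LV comm comm2 comm3 comm4 comm5 inv1 inv2]
  have lift_mul: "mat_mul HS (clip HS HS (lift Inl Inl K)) (clip HS HS (lift Inl Inl M))
      = clip HS HS (lift Inl Inl (mat_mul H K M))" for K M
    unfolding H_def HS_def by (simp add: mat_mul_clip mat_mul_lift[OF inj_Inl n(1)])
  note unlift = lift_clip_inject[OF _ inj_Inl n(1) s[unfolded H_def], folded HS_def]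
  show "mat_mul H (mat_mul H qAB g) qBC s s' = qABC s s'"
    by (rule unlift) (use alg(1) in \<open>simp only: lift_mul[symmetric] QAB QBC QABC G\<close>)
  show "mat_mul H pB qBC s s' = qBC s s'"
    by (rule unlift) (use alg(2) in \<open>simp only: lift_mul[symmetric] QBC PB\<close>)
qed

section \<open>The norm estimate\<close>

lemma extend_op_diff: "mat_diff (extend_op S R K) (extend_op S R M) = extend_op S R (mat_diff K M)"
  by (simp add: mat_diff_def extend_op_def algebra_simps)

text \<open>\<open>inverse_approx_projector\<close> applied to \<open>V\<^sub>\<Lambda>\<close>,
  with the inverse of \<open>\<sigma>\<close> written as the reversed product of the inverse
  factors; adding spectators does not increase the norm.\<close>

lemma region_inverse_approx:
  assumes \<Gamma>: "is_peps \<Gamma>" "injective_peps \<Gamma>" and \<Lambda>: "\<Lambda> \<subseteq> R" and R: "finite R" "R \<subseteq> verts \<Gamma>"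
    and S: "S \<subseteq> bdry \<Gamma> \<Lambda>" "is_mat_inverse (bond_configs \<Gamma> S) K M"
    and S': "S' \<subseteq> bdry \<Gamma> \<Lambda>" "is_mat_inverse (bond_configs \<Gamma> S') K' M'"
  defines "I \<equiv> bond_configs \<Gamma> (bdry \<Gamma> \<Lambda>)"
  assumes approx: "inverse_approx I \<epsilon> (bdry_state \<Gamma> \<Lambda>)
      (mat_mul I (extend_op S (bdry \<Gamma> \<Lambda>) K) (extend_op S' (bdry \<Gamma> \<Lambda>) K'))"
  shows "op_norm (phys_configs \<Gamma> R) (mat_diff
    (extend_op \<Lambda> R (sandwich \<Gamma> \<Lambda> (mat_mul I (extend_op S' (bdry \<Gamma> \<Lambda>) M') (extend_op S (bdry \<Gamma> \<Lambda>) M))))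
    (ground_projector \<Gamma> R \<Lambda>)) \<le> \<epsilon>"
proof -
  have \<Lambda>': "finite \<Lambda>" "\<Lambda> \<subseteq> verts \<Gamma>" using \<Lambda> R by (auto intro: rev_finite_subset)
  let ?H = "phys_configs \<Gamma> \<Lambda>" and ?V = "peps_map \<Gamma> \<Lambda>" and ?bd = "bdry \<Gamma> \<Lambda>"
  let ?\<tau> = "mat_mul I (extend_op S' ?bd M') (extend_op S ?bd M)"
  let ?P = "orth_projector ?H (mat_app ?H I ?V ` extensional I)"
  have bd: "finite ?bd" by (rule finite_bdry[OF \<Gamma>(1) \<Lambda>'])
  have fin: "finite ?H" "finite I" using \<Lambda>' bd by (auto simp: I_def intro: finite_configs)
  have inj: "inj_on (mat_app ?H I ?V) (extensional I)"
    using \<Gamma>(2) \<Lambda>' by (simp add: injective_peps_def I_def)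
  have "op_norm ?H (mat_diff (mat_mul I (clip ?H I ?V) (mat_mul I (clip I I ?\<tau>) (mat_adj (clip ?H I ?V)))) ?P) \<le> \<epsilon>"
  proof (rule inverse_approx_projector[OF fin inj approx[unfolded bdry_state_def] supp_on_clip])
    show "mat_mul I (clip I I (mat_mul I (extend_op S ?bd K) (extend_op S' ?bd K'))) (clip I I ?\<tau>) = id_on I"
      unfolding I_def by (rule extend_op_product_inverse[OF bd S S'])
    show "mat_mul I (clip I I ?\<tau>) (clip I I (mat_mul I (extend_op S ?bd K) (extend_op S' ?bd K'))) = id_on I"
      unfolding I_def
      by (rule extend_op_product_inverse[OF bd S'(1) _ S(1)])
        (use S(2) S'(2) in \<open>simp_all add: is_mat_inverse_commute\<close>)
  qed
  moreover have "mat_mul I (clip ?H I ?V) (mat_mul I (clip I I ?\<tau>) (mat_adj (clip ?H I ?V)))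
      = clip ?H ?H (sandwich \<Gamma> \<Lambda> ?\<tau>)"
    by (simp add: sandwich_def I_def mat_adj_clip mat_mul_clip)
  moreover have "op_norm ?H (mat_diff (clip ?H ?H (sandwich \<Gamma> \<Lambda> ?\<tau>)) ?P) = op_norm ?H (mat_diff (sandwich \<Gamma> \<Lambda> ?\<tau>) ?P)"
    by (rule op_norm_cong) (simp add: mat_diff_def clip_def)
  ultimately have "op_norm ?H (mat_diff (sandwich \<Gamma> \<Lambda> ?\<tau>) ?P) \<le> \<epsilon>" by simp
  then show ?thesis
    unfolding ground_projector_def extend_op_diff I_def[symmetric]
    by (rule order_trans[OF op_norm_extend_op[OF R(1) \<Lambda>]])
qed

lemma op_norm_ground_projector:
  assumes \<Gamma>: "is_peps \<Gamma>" "injective_peps \<Gamma>" and \<Lambda>: "\<Lambda> \<subseteq> R" and R: "finite R" "R \<subseteq> verts \<Gamma>"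
  shows "op_norm (phys_configs \<Gamma> R) (ground_projector \<Gamma> R \<Lambda>) \<le> 1"
proof -
  have \<Lambda>': "finite \<Lambda>" "\<Lambda> \<subseteq> verts \<Gamma>" using \<Lambda> R by (auto intro: rev_finite_subset)
  have "finite (phys_configs \<Gamma> \<Lambda>)" "finite (bond_configs \<Gamma> (bdry \<Gamma> \<Lambda>))"
    using \<Lambda>' finite_bdry[OF \<Gamma>(1) \<Lambda>'] by (auto intro: finite_configs)
  then have "op_norm (phys_configs \<Gamma> \<Lambda>) (orth_projector (phys_configs \<Gamma> \<Lambda>)
      (peps_op \<Gamma> \<Lambda> ` extensional (bond_configs \<Gamma> (bdry \<Gamma> \<Lambda>)))) \<le> 1"
    using \<Gamma>(2) \<Lambda>' by (intro op_norm_orth_projector) (auto simp: injective_peps_def)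
  then show ?thesis
    unfolding ground_projector_def by (rule order_trans[OF op_norm_extend_op[OF R(1) \<Lambda>]])
qed

text \<open>Carries the left inverse \<open>L\<close> and the estimate for \<open>G\<close> from the
  region to \<open>R\<close>, with the identities stated on entries instead of clipped
  matrices.\<close>

lemma region_direct_approx:
  assumes \<Gamma>: "is_peps \<Gamma>" "injective_peps \<Gamma>" and \<Lambda>: "\<Lambda> \<subseteq> R" and R: "finite R" "R \<subseteq> verts \<Gamma>"
  defines "I \<equiv> bond_configs \<Gamma> (bdry \<Gamma> \<Lambda>)"
  assumes approx: "direct_approx I \<epsilon> (bdry_state \<Gamma> \<Lambda>) \<sigma>"
  obtains L where "mat_eq_on I (mat_mul (phys_configs \<Gamma> \<Lambda>) L (peps_map \<Gamma> \<Lambda>)) mat_id"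
    and "\<And>s t. s \<in> phys_configs \<Gamma> R \<Longrightarrow> t \<in> phys_configs \<Gamma> R \<Longrightarrow>
      extend_op \<Lambda> R (mat_mul I (peps_map \<Gamma> \<Lambda>) L) s t = ground_projector \<Gamma> R \<Lambda> s t"
    and "op_norm (phys_configs \<Gamma> R) (mat_diff (extend_op \<Lambda> R (mat_mul I (mat_adj L) (mat_mul I \<sigma> L)))
      (ground_projector \<Gamma> R \<Lambda>)) \<le> \<epsilon>"
proof -
  have \<Lambda>': "finite \<Lambda>" "\<Lambda> \<subseteq> verts \<Gamma>" using \<Lambda> R by (auto intro: rev_finite_subset)
  let ?H = "phys_configs \<Gamma> \<Lambda>" and ?V = "peps_map \<Gamma> \<Lambda>" and ?bd = "bdry \<Gamma> \<Lambda>"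
  let ?P = "orth_projector ?H (mat_app ?H I ?V ` extensional I)"
  have bd: "finite ?bd" by (rule finite_bdry[OF \<Gamma>(1) \<Lambda>'])
  have fin: "finite ?H" "finite I" using \<Lambda>' bd by (auto simp: I_def intro: finite_configs)
  have inj: "inj_on (mat_app ?H I ?V) (extensional I)"
    using \<Gamma>(2) \<Lambda>' by (simp add: injective_peps_def I_def)
  obtain L where L: "supp_on I ?H L" "mat_mul ?H L (clip ?H I ?V) = id_on I"
    "mat_mul I (clip ?H I ?V) L = clip ?H ?H ?P"
    "op_norm ?H (mat_diff (mat_mul I (mat_adj L) (mat_mul I (clip I I \<sigma>) L)) ?P) \<le> \<epsilon>"
    by (rule direct_approx_projector[OF fin inj approx[unfolded bdry_state_def]])
  have ground: "ground_projector \<Gamma> R \<Lambda> = extend_op \<Lambda> R ?P"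
    by (simp add: ground_projector_def I_def)
  show ?thesis
  proof (rule that[of L])
    show "mat_eq_on I (mat_mul ?H L ?V) mat_id"
      unfolding mat_eq_on_def
    proof (intro ballI)
      fix x y assume "x \<in> I" "y \<in> I"
      then show "mat_mul ?H L ?V x y = mat_id x y"
        using fun_cong[OF fun_cong[OF L(2), of x], of y]
        by (simp add: mat_mul_def id_on_def clip_def)
    qed
    show "extend_op \<Lambda> R (mat_mul I ?V L) s t = ground_projector \<Gamma> R \<Lambda> s t"
      if "s \<in> phys_configs \<Gamma> R" "t \<in> phys_configs \<Gamma> R" for s t
    proof -
      have "restrict s \<Lambda> \<in> ?H" "restrict t \<Lambda> \<in> ?H"
        using that \<Lambda> by (auto simp: configs_def PiE_iff)
      then have "mat_mul I ?V L (restrict s \<Lambda>) (restrict t \<Lambda>) = ?P (restrict s \<Lambda>) (restrict t \<Lambda>)"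
        using fun_cong[OF fun_cong[OF L(3), of "restrict s \<Lambda>"], of "restrict t \<Lambda>"]
        by (simp add: mat_mul_def clip_def)
      then show ?thesis by (simp add: ground extend_op_def)
    qed
    have "mat_mul I (mat_adj L) (mat_mul I (clip I I \<sigma>) L) = mat_mul I (mat_adj L) (mat_mul I \<sigma> L)"
      by (simp add: mat_mul_def clip_def)
    then have "op_norm ?H (mat_diff (mat_mul I (mat_adj L) (mat_mul I \<sigma> L)) ?P) \<le> \<epsilon>"
      using L(4) by simp
    then show "op_norm (phys_configs \<Gamma> R) (mat_diff (extend_op \<Lambda> R (mat_mul I (mat_adj L) (mat_mul I \<sigma> L)))
      (ground_projector \<Gamma> R \<Lambda>)) \<le> \<epsilon>"
      unfolding ground extend_op_diff by (rule order_trans[OF op_norm_extend_op[OF R(1) \<Lambda>]])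
  qed
qed

text \<open>\<open>qAB\<close> and \<open>qBC\<close> have norm at most
  \<open>1 + \<epsilon> \<le> 2\<close>, whence 4\<epsilon> for the term with \<open>g\<close>
  between them and 2\<epsilon> for replacing \<open>qAB\<close> beside \<open>qBC\<close>. Replacing
  \<open>qBC\<close> beside the projector \<open>pAB\<close> and \<open>qABC\<close> by
  \<open>pABC\<close> costs \<epsilon> each.\<close>

lemma op_norm_product_estimate:
  assumes H: "finite H" and \<epsilon>: "0 \<le> \<epsilon>" "\<epsilon> \<le> 1"
    and q: "op_norm H (mat_diff qAB pAB) \<le> \<epsilon>" "op_norm H (mat_diff qBC pBC) \<le> \<epsilon>"
      "op_norm H (mat_diff qABC pABC) \<le> \<epsilon>" "op_norm H (mat_diff g pB) \<le> \<epsilon>"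
    and p: "op_norm H pAB \<le> 1" "op_norm H pBC \<le> 1"
    and prod: "\<And>s t. s \<in> H \<Longrightarrow> t \<in> H \<Longrightarrow> mat_mul H (mat_mul H qAB g) qBC s t = qABC s t"
      "\<And>s t. s \<in> H \<Longrightarrow> t \<in> H \<Longrightarrow> mat_mul H pB qBC s t = qBC s t"
  shows "op_norm H (mat_diff (mat_mul H pAB pBC) pABC) \<le> 8 * \<epsilon>"
proof -
  let ?N = "op_norm H"
  have N: "0 \<le> ?N M" for M by (rule op_norm_nonneg[OF H])
  have le2: "?N q \<le> 2" if "?N (mat_diff q p) \<le> \<epsilon>" "?N p \<le> 1" for p q
  proof -
    have "?N q = ?N (mat_diff (mat_diff q p) (\<lambda>i j. - 1 * p i j))"
      by (rule op_norm_cong) (simp add: mat_diff_def)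
    also have "\<dots> \<le> ?N (mat_diff q p) + ?N p"
      using op_norm_diff_le[OF H, of "mat_diff q p" "\<lambda>i j. - 1 * p i j"] op_norm_scale[OF H, of "-1" p] by simp
    finally show ?thesis using that \<epsilon> by linarith
  qed
  have mul_le: "?N (mat_mul H M K) \<le> m * k" if "?N M \<le> m" "?N K \<le> k" for M K m k
    using op_norm_mul_le[OF H, of M K] mult_mono[OF that order_trans[OF N that(1)] N] by linarith
  let ?X = "mat_mul H (mat_mul H qAB (mat_diff g pB)) qBC"
  let ?Y = "mat_mul H (mat_diff qAB pAB) qBC"
  let ?Z = "mat_mul H pAB (mat_diff qBC pBC)"
  have X: "?N ?X \<le> (2 * \<epsilon>) * 2"
    by (intro mul_le le2[OF q(1) p(1)] le2[OF q(2) p(2)] q(4))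
  have Y: "?N ?Y \<le> \<epsilon> * 2" by (intro mul_le le2[OF q(2) p(2)] q(1))
  have Z: "?N ?Z \<le> 1 * \<epsilon>" by (intro mul_le p(1) q(2))
  have "?N (mat_diff (mat_mul H pAB pBC) pABC) = ?N (mat_diff (mat_diff (mat_diff (mat_diff qABC pABC) ?X) ?Y) ?Z)"
  proof (rule op_norm_cong)
    fix s t assume s: "s \<in> H" and t: "t \<in> H"
    have "mat_mul H (mat_mul H qAB pB) qBC s t = mat_mul H qAB qBC s t"
      unfolding mat_mul_assoc using prod(2)[OF _ t] by (simp add: mat_mul_def)
    then show "mat_diff (mat_mul H pAB pBC) pABC s t
        = mat_diff (mat_diff (mat_diff (mat_diff qABC pABC) ?X) ?Y) ?Z s t"
      using prod(1)[OF s t] unfolding mat_mul_diff_left mat_mul_diff_right by (simp add: mat_diff_def)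
  qed
  also have "\<dots> \<le> ((?N (mat_diff qABC pABC) + ?N ?X) + ?N ?Y) + ?N ?Z"
    by (intro order_trans[OF op_norm_diff_le[OF H] add_right_mono]) simp
  finally show ?thesis using X Y Z q(3) by linarith
qed

theorem theorem10:
  fixes \<Gamma> :: "'v peps" and A B C :: "'v set" and B\<^sub>L z B\<^sub>R :: "'v set set" and len \<epsilon> :: real
  assumes "is_peps \<Gamma>" and "injective_peps \<Gamma>"
    and "three_rectangles \<Gamma> len A B C B\<^sub>L z B\<^sub>R"
    and "approx_factorizable \<Gamma> \<epsilon> A B C B\<^sub>L z B\<^sub>R"
    and "\<epsilon> \<le> 1"
  shows "op_norm (phys_configs \<Gamma> (A \<union> B \<union> C))
    (mat_diff
      (mat_mul (phys_configs \<Gamma> (A \<union> B \<union> C))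
        (ground_projector \<Gamma> (A \<union> B \<union> C) (A \<union> B))
        (ground_projector \<Gamma> (A \<union> B \<union> C) (B \<union> C)))
      (ground_projector \<Gamma> (A \<union> B \<union> C) (A \<union> B \<union> C))) \<le> 8 * \<epsilon>"
proof -
  note \<Gamma> = assms(1,2)
  define R where "R = A \<union> B \<union> C"
  have fin: "finite R" and AC: "\<forall>u\<in>A. \<forall>w\<in>C. {u, w} \<notin> edges \<Gamma>"
    and m: "B\<^sub>L \<union> z \<union> B\<^sub>R = bdry \<Gamma> B \<inter> bdry \<Gamma> (A \<union> B \<union> C)" "B\<^sub>L \<inter> z = {}" "z \<inter> B\<^sub>R = {}" "B\<^sub>L \<inter> B\<^sub>R = {}"
    using assms(3) unfolding three_rectangles_def R_def by simp_all
  obtain x0 x1 x2 x3 y0 y1 where rect: "x0 < x1" "x1 < x2" "x2 < x3"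
      "A = rectangle \<Gamma> x0 x1 y0 y1" "B = rectangle \<Gamma> x1 x2 y0 y1" "C = rectangle \<Gamma> x2 x3 y0 y1"
    using assms(3) unfolding three_rectangles_def by (elim exE conjE) (rule that; assumption)
  have disj: "A \<inter> B = {}" "B \<inter> C = {}" "A \<inter> C = {}"
    using rect(1-3) by (auto simp: rect(4-6) rectangle_def)
  have verts: "R \<subseteq> verts \<Gamma>"
    by (auto simp: R_def rect(4-6) rectangle_def)
  have A: "finite A" "A \<subseteq> verts \<Gamma>" and B: "finite B" "B \<subseteq> verts \<Gamma>" and C: "finite C" "C \<subseteq> verts \<Gamma>"
    using fin verts by (auto simp: R_def)
  have R: "A \<union> B \<subseteq> R" "B \<union> C \<subseteq> R" "B \<subseteq> R" "R \<subseteq> R" by (auto simp: R_def)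
  define az where "az = bdry \<Gamma> A \<inter> bdry \<Gamma> (A \<union> B \<union> C) \<union> B\<^sub>L \<union> z"
  define zb where "zb = z \<union> (bdry \<Gamma> C \<inter> bdry \<Gamma> (A \<union> B \<union> C) \<union> B\<^sub>R)"
  define dz where "dz = bdry \<Gamma> A \<inter> bdry \<Gamma> B \<union> B\<^sub>L \<union> z"
  define zc where "zc = z \<union> (bdry \<Gamma> B \<inter> bdry \<Gamma> C \<union> B\<^sub>R)"
  have sub: "az \<subseteq> bdry \<Gamma> (A \<union> B)" "zc \<subseteq> bdry \<Gamma> (A \<union> B)" "dz \<subseteq> bdry \<Gamma> (B \<union> C)" "zb \<subseteq> bdry \<Gamma> (B \<union> C)"
      "az \<subseteq> bdry \<Gamma> R" "zb \<subseteq> bdry \<Gamma> R"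
    unfolding R_def az_def zb_def dz_def zc_def
    using three_regions_bdry(4-6)[OF \<Gamma>(1) disj AC, folded m(1)] by auto
  let ?I = "\<lambda>\<Lambda>. bond_configs \<Gamma> (bdry \<Gamma> \<Lambda>)"
  obtain \<Delta>az \<Delta>zb \<Omega>dz \<Omega>zc where
    invertible: "invertible_op (bond_configs \<Gamma> az) \<Delta>az" "invertible_op (bond_configs \<Gamma> zb) \<Delta>zb"
      "invertible_op (bond_configs \<Gamma> dz) \<Omega>dz" "invertible_op (bond_configs \<Gamma> zc) \<Omega>zc" and
    approx: "inverse_approx (?I R) \<epsilon> (bdry_state \<Gamma> R)
        (mat_mul (?I R) (extend_op zb (bdry \<Gamma> R) \<Delta>zb) (extend_op az (bdry \<Gamma> R) \<Delta>az))"
      "inverse_approx (?I (A \<union> B)) \<epsilon> (bdry_state \<Gamma> (A \<union> B))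
        (mat_mul (?I (A \<union> B)) (extend_op zc (bdry \<Gamma> (A \<union> B)) \<Omega>zc) (extend_op az (bdry \<Gamma> (A \<union> B)) \<Delta>az))"
      "inverse_approx (?I (B \<union> C)) \<epsilon> (bdry_state \<Gamma> (B \<union> C))
        (mat_mul (?I (B \<union> C)) (extend_op zb (bdry \<Gamma> (B \<union> C)) \<Delta>zb) (extend_op dz (bdry \<Gamma> (B \<union> C)) \<Omega>dz))"
      "direct_approx (?I B) \<epsilon> (bdry_state \<Gamma> B)
        (mat_mul (?I B) (extend_op zc (bdry \<Gamma> B) \<Omega>zc) (extend_op dz (bdry \<Gamma> B) \<Omega>dz))"
    using assms(4)[unfolded approx_factorizable_def Let_def, folded az_def zb_def dz_def zc_def, folded R_def]
    by (elim exE conjE) (rule that; assumption)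
  obtain \<Delta>az' \<Delta>zb' \<Omega>dz' \<Omega>zc' where
    inv: "is_mat_inverse (bond_configs \<Gamma> az) \<Delta>az \<Delta>az'" "is_mat_inverse (bond_configs \<Gamma> zb) \<Delta>zb \<Delta>zb'"
      "is_mat_inverse (bond_configs \<Gamma> dz) \<Omega>dz \<Omega>dz'" "is_mat_inverse (bond_configs \<Gamma> zc) \<Omega>zc \<Omega>zc'"
    using invertible unfolding invertible_op_def by blast
  obtain L where
    L: "mat_eq_on (?I B) (mat_mul (phys_configs \<Gamma> B) L (peps_map \<Gamma> B)) mat_id"
    and pB: "\<And>s t. s \<in> phys_configs \<Gamma> R \<Longrightarrow> t \<in> phys_configs \<Gamma> R \<Longrightarrow>
      extend_op B R (mat_mul (?I B) (peps_map \<Gamma> B) L) s t = ground_projector \<Gamma> R B s t"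
    and g: "op_norm (phys_configs \<Gamma> R) (mat_diff (extend_op B R (mat_mul (?I B) (mat_adj L) (mat_mul (?I B)
        (mat_mul (?I B) (extend_op zc (bdry \<Gamma> B) \<Omega>zc) (extend_op dz (bdry \<Gamma> B) \<Omega>dz)) L)))
      (ground_projector \<Gamma> R B)) \<le> \<epsilon>"
    by (rule region_direct_approx[OF \<Gamma> R(3) fin verts approx(4)]) (rule that; simp)
  note products = peps_products[OF \<Gamma>(1) A B C disj AC m R_def az_def zb_def dz_def zc_def L inv(4,3)]
  have H: "finite (phys_configs \<Gamma> R)" using fin by (rule finite_configs)
  \<comment> \<open>An operator norm is bounded by \<epsilon>.\<close>
  have \<epsilon>: "0 \<le> \<epsilon>" by (rule order_trans[OF op_norm_nonneg[OF H] g])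
  show ?thesis
    unfolding R_def[symmetric]
  proof (rule op_norm_product_estimate[OF H \<epsilon> assms(5)
        region_inverse_approx[OF \<Gamma> R(1) fin verts sub(2) inv(4) sub(1) inv(1) approx(2)]
        region_inverse_approx[OF \<Gamma> R(2) fin verts sub(4) inv(2) sub(3) inv(3) approx(3)]
        region_inverse_approx[OF \<Gamma> R(4) fin verts sub(6) inv(2) sub(5) inv(1) approx(1)] g
        op_norm_ground_projector[OF \<Gamma> R(1) fin verts] op_norm_ground_projector[OF \<Gamma> R(2) fin verts]],
      goal_cases)
    case (1 s t)
    then show ?case by (rule products(1))
  next
    \<comment> \<open>The projector of \<open>B\<close> agrees with \<open>V\<^sub>B L\<close> on
      the entries that occur in the product.\<close>
    case (2 s t)
    then show ?case
      using products(2)[OF 2, of \<Delta>zb'] pB[OF 2(1)] by (simp add: mat_mul_def)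
  qed
qed

end
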